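(* Let $G$ be a finitely generated nilpotent group with $Z(G)\le Is(G')$, and let $H$ be a finitely generated group with $H\equiv G$. Then $G\cong H$.
   Context: $Is(G')=\{x\in G:\ x^k\in G' \text{ for some integer } k\ge1\}$ is the isolator of the commutator subgroup $G'$; $Z(G)$ is the center; $\equiv$ is elementary equivalence in the language of groups. *)

theory Defs
  imports "HOL-Algebra.Algebra"
begin

definition fin_gen_group :: "('a, 'b) monoid_scheme \<Rightarrow> bool" where
  "fin_gen_group G \<longleftrightarrow> (\<exists>S. finite S \<and> S \<subseteq> carrier G \<and> generate G S = carrier G)"

definition comm_subgroup :: "('a, 'b) monoid_scheme \<Rightarrow> 'a set \<Rightarrow> 'a set \<Rightarrow> 'a set" where
  "comm_subgroup G A B = generate G
     {a \<otimes>\<^bsub>G\<^esub> b \<otimes>\<^bsub>G\<^esub> inv\<^bsub>G\<^esub> a \<otimes>\<^bsub>G\<^esub> inv\<^bsub>G\<^esub> b | a b. a \<in> A \<and> b \<in> B}"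

primrec lower_central :: "('a, 'b) monoid_scheme \<Rightarrow> nat \<Rightarrow> 'a set" where
  "lower_central G 0 = carrier G"
| "lower_central G (Suc n) = comm_subgroup G (lower_central G n) (carrier G)"

definition nilpotent_group :: "('a, 'b) monoid_scheme \<Rightarrow> bool" where
  "nilpotent_group G \<longleftrightarrow> group G \<and> (\<exists>n. lower_central G n = {\<one>\<^bsub>G\<^esub>})"

definition group_center :: "('a, 'b) monoid_scheme \<Rightarrow> 'a set" where
  "group_center G = {z \<in> carrier G. \<forall>g \<in> carrier G. z \<otimes>\<^bsub>G\<^esub> g = g \<otimes>\<^bsub>G\<^esub> z}"

definition isolator :: "('a, 'b) monoid_scheme \<Rightarrow> 'a set \<Rightarrow> 'a set" where
  "isolator G N = {x \<in> carrier G. \<exists>k::nat. k \<ge> 1 \<and> x [^]\<^bsub>G\<^esub> k \<in> N}"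

datatype gterm = GVar nat | GOne | GMul gterm gterm | GInv gterm

datatype gform = GEq gterm gterm | GNeg gform | GAnd gform gform | GEx nat gform

primrec tvars :: "gterm \<Rightarrow> nat set" where
  "tvars (GVar i) = {i}"
| "tvars GOne = {}"
| "tvars (GMul s t) = tvars s \<union> tvars t"
| "tvars (GInv t) = tvars t"

primrec fvars :: "gform \<Rightarrow> nat set" where
  "fvars (GEq s t) = tvars s \<union> tvars t"
| "fvars (GNeg f) = fvars f"
| "fvars (GAnd f g) = fvars f \<union> fvars g"
| "fvars (GEx i f) = fvars f - {i}"

primrec teval :: "('a, 'b) monoid_scheme \<Rightarrow> (nat \<Rightarrow> 'a) \<Rightarrow> gterm \<Rightarrow> 'a" where
  "teval G v (GVar i) = v i"
| "teval G v GOne = \<one>\<^bsub>G\<^esub>"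
| "teval G v (GMul s t) = teval G v s \<otimes>\<^bsub>G\<^esub> teval G v t"
| "teval G v (GInv t) = inv\<^bsub>G\<^esub> (teval G v t)"

primrec fsat :: "('a, 'b) monoid_scheme \<Rightarrow> (nat \<Rightarrow> 'a) \<Rightarrow> gform \<Rightarrow> bool" where
  "fsat G v (GEq s t) = (teval G v s = teval G v t)"
| "fsat G v (GNeg f) = (\<not> fsat G v f)"
| "fsat G v (GAnd f g) = (fsat G v f \<and> fsat G v g)"
| "fsat G v (GEx i f) = (\<exists>a \<in> carrier G. fsat G (v(i := a)) f)"

definition sentence :: "gform \<Rightarrow> bool" where
  "sentence f \<longleftrightarrow> fvars f = {}"

text \<open>Truth of a sentence (the assignment is irrelevant for sentences; we use the constant one).\<close>
definition models :: "('a, 'b) monoid_scheme \<Rightarrow> gform \<Rightarrow> bool" where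
  "models G f \<longleftrightarrow> fsat G (\<lambda>_. \<one>\<^bsub>G\<^esub>) f"

definition elem_equiv :: "('a, 'b) monoid_scheme \<Rightarrow> ('c, 'd) monoid_scheme \<Rightarrow> bool" where
  "elem_equiv G H \<longleftrightarrow> (\<forall>f. sentence f \<longrightarrow> (models G f \<longleftrightarrow> models H f))"

end

(* A formula satisfied by a generating tuple a of G, transferred to H, yields a tuple b (one for each N below) such that
   a |-> b extends to a homomorphism from G to H; its image is V. On each factor Z_{h+2}/Z_{h+1} the commutator pairing
   with the group has a commutative ring C of adjointable endomorphisms commuting with all others;
   C and its action are first-order definable, and the factor is a finitely generated C-module.
   The formula can also say, for each n, that certain elements of C coming from b are roots of given
   monic polynomials with integer coefficients and generate C modulo n.  Taking n = N! and letting N grow,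
   counting roots of these polynomials modulo the primes of C shows that for all but finitely many N the
   elements generate C modulo its nilradical, and a bound on nilpotency then forces V to cover the factor.
   Hence H = V Z(H) for suitable b, and so H' lies in V.  Since Z(G) lies in the isolator of G', there are e and m
   such that the e-th power of each central element is a product of m commutators; this is first-order, so
   e-th powers of central elements of H lie in V, and Z(H) modulo e-th powers is controlled by
   finitely many further witnesses, so V = H.  Thus G maps onto H, symmetrically H maps onto G,
   and finitely generated nilpotent groups are Hopfian. *)

theory Submission
  imports Defs
begin

section \<open>Definable terms and predicates\<close>

text \<open>Generation by a tuple is not directly a first-order property, so the tuple found in H is
  controlled only by approximations: for each N, the elements it codes generate C up to multiples of
  N!. The tuples for different N are chosen independently. They can be compared because C depends
  only on the group and the level, and because C is additively finitely generated, hence integral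
  over the integers: the monic polynomials satisfied by its generators in G are part of the formula
  and bind all families in H at once. Factorials are taken because every positive integer divides N!
  for large N, and a finitely generated divisible abelian group is trivial. Counting roots does not
  see nilpotent elements. For them a bound on nilpotency in the ring of H is fixed before the
  formula is written down; elements below this bound are required to act through finitely many
  listed nilpotent generators, and a Nakayama argument removes these. The pairing on the factor
  above Z_(h+1) is built from commutators and cannot reach the center, which is why the center needs
  the isolator hypothesis.\<close>

text \<open>\<open>ft s\<close> and \<open>fo \<phi>\<close> say that one term, respectively one formula, defines the semantic object \<open>s\<close>, \<open>\<phi>\<close>
  uniformly in all groups over a type. Definability is thus proved by syntax-directed closure rules on HOL predicates.\<close>

definition ft :: "('u monoid \<Rightarrow> (nat \<Rightarrow> 'u) \<Rightarrow> 'u) \<Rightarrow> bool" where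
  "ft s \<longleftrightarrow> (\<exists>t. \<forall>K v. group K \<longrightarrow> range v \<subseteq> carrier K \<longrightarrow> s K v = teval K v t)"

definition fo :: "('u monoid \<Rightarrow> (nat \<Rightarrow> 'u) \<Rightarrow> bool) \<Rightarrow> bool" where
  "fo \<phi> \<longleftrightarrow> (\<exists>f. \<forall>K v. group K \<longrightarrow> range v \<subseteq> carrier K \<longrightarrow> \<phi> K v = fsat K v f)"

lemma teval_closed:
  assumes "group K" "range v \<subseteq> carrier K" shows "teval K v t \<in> carrier K"
proof -
  interpret group K by fact
  show ?thesis using assms(2) by (induction t) auto
qed

lemma teval_cong: "(\<And>i. i \<in> tvars t \<Longrightarrow> v i = w i) \<Longrightarrow> teval K v t = teval K w t"
  by (induction t) auto

lemma fsat_cong: "(\<And>i. i \<in> fvars f \<Longrightarrow> v i = w i) \<Longrightarrow> fsat K v f = fsat K w f"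
proof (induction f arbitrary: v w)
  case (GEq s t)
  then show ?case using teval_cong[of s v w K] teval_cong[of t v w K] by simp
next
  case (GNeg f)
  have "fsat K v f = fsat K w f" by (rule GNeg.IH) (use GNeg.prems in simp)
  then show ?case by simp
next
  case (GAnd f g)
  have "fsat K v f = fsat K w f" "fsat K v g = fsat K w g"
    by (rule GAnd.IH, use GAnd.prems in simp)+
  then show ?case by simp
next
  case (GEx j f)
  have "fsat K (v(j := a)) f = fsat K (w(j := a)) f" for a
    by (rule GEx.IH) (use GEx.prems in auto)
  then show ?case by simp
qed

lemma finite_fvars: "finite (fvars f)"
proof -
  have "finite (tvars t)" for t by (induction t) auto
  then show ?thesis by (induction f) auto
qed

primrec tsub :: "(nat \<Rightarrow> gterm) \<Rightarrow> gterm \<Rightarrow> gterm" where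
  "tsub w (GVar i) = w i"
| "tsub w GOne = GOne"
| "tsub w (GMul s t) = GMul (tsub w s) (tsub w t)"
| "tsub w (GInv t) = GInv (tsub w t)"

lemma teval_tsub: "teval K v (tsub w t) = teval K (\<lambda>i. teval K v (w i)) t"
  by (induction t) auto

text \<open>Bound variables are renamed together with the free ones, so an injective renaming
  captures nothing.\<close>

primrec fren :: "(nat \<Rightarrow> nat) \<Rightarrow> gform \<Rightarrow> gform" where
  "fren \<pi> (GEq s t) = GEq (tsub (\<lambda>i. GVar (\<pi> i)) s) (tsub (\<lambda>i. GVar (\<pi> i)) t)"
| "fren \<pi> (GNeg f) = GNeg (fren \<pi> f)"
| "fren \<pi> (GAnd f g) = GAnd (fren \<pi> f) (fren \<pi> g)"
| "fren \<pi> (GEx i f) = GEx (\<pi> i) (fren \<pi> f)"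

lemma fsat_fren:
  assumes "inj \<pi>" shows "fsat K v (fren \<pi> f) = fsat K (\<lambda>i. v (\<pi> i)) f"
proof (induction f arbitrary: v)
  case (GEx j f)
  have "(\<lambda>i. (v(\<pi> j := a)) (\<pi> i)) = (\<lambda>i. v (\<pi> i))(j := a)" for a
    by (rule ext) (simp add: inj_eq[OF assms])
  then show ?case by (simp add: GEx.IH)
qed (simp_all add: teval_tsub)

lemma ft_subst:
  assumes "ft s" "\<And>i. ft (\<lambda>K v. w K v i)" shows "ft (\<lambda>K v. s K (w K v))"
proof -
  obtain t where t: "\<And>K v. group K \<Longrightarrow> range v \<subseteq> carrier K \<Longrightarrow> s K v = teval K v t"
    using assms(1) unfolding ft_def by blast
  obtain u where u: "\<And>i K v. group K \<Longrightarrow> range v \<subseteq> carrier K \<Longrightarrow> w K v i = teval K v (u i)"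
    using assms(2) unfolding ft_def by metis
  have "s K (w K v) = teval K v (tsub u t)" if "group K" "range v \<subseteq> carrier K" for K v
  proof -
    have w: "w K v = (\<lambda>i. teval K v (u i))" using u[OF that] by auto
    have "range (w K v) \<subseteq> carrier K" using teval_closed[OF that] by (auto simp: w)
    then show ?thesis using t[OF that(1), of "w K v"] by (simp add: teval_tsub w)
  qed
  then show ?thesis unfolding ft_def by blast
qed

lemma ft_var: "ft (\<lambda>K v. v i)"
  unfolding ft_def by (rule exI[of _ "GVar i"]) simp

lemma ft_one: "ft (\<lambda>K v. \<one>\<^bsub>K\<^esub>)"
  unfolding ft_def by (rule exI[of _ "GOne"]) simp

lemma ft_mult: assumes "ft s" "ft t" shows "ft (\<lambda>K v. s K v \<otimes>\<^bsub>K\<^esub> t K v)"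
proof -
  obtain a b where "\<forall>K v. group K \<longrightarrow> range v \<subseteq> carrier K \<longrightarrow> s K v = teval K v a"
    "\<forall>K v. group K \<longrightarrow> range v \<subseteq> carrier K \<longrightarrow> t K v = teval K v b"
    using assms unfolding ft_def by blast
  then show ?thesis unfolding ft_def by (intro exI[of _ "GMul a b"]) simp
qed

lemma ft_inv: assumes "ft s" shows "ft (\<lambda>K v. inv\<^bsub>K\<^esub> (s K v))"
proof -
  obtain a where "\<forall>K v. group K \<longrightarrow> range v \<subseteq> carrier K \<longrightarrow> s K v = teval K v a"
    using assms unfolding ft_def by blast
  then show ?thesis unfolding ft_def by (intro exI[of _ "GInv a"]) simp
qed

text \<open>The condition \<open>P\<close> is a fixed proposition, decided when the term is chosen.
  The rule serves tuples that are padded with one from some index on.\<close>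

lemma ft_if: "ft s \<Longrightarrow> ft t \<Longrightarrow> ft (\<lambda>K v. if P then s K v else t K v)"
  by (cases P) simp_all

lemma ft_nat_pow: assumes "ft s" shows "ft (\<lambda>K v. s K v [^]\<^bsub>K\<^esub> (n::nat))"
proof (induction n)
  case (Suc n)
  show ?case using ft_mult[OF Suc.IH assms] by (simp add: nat_pow_def)
qed (simp add: nat_pow_def ft_one)

lemma ft_int_pow: assumes "ft s" shows "ft (\<lambda>K v. s K v [^]\<^bsub>K\<^esub> (n::int))"
  using ft_nat_pow[OF assms, of "nat n"] ft_inv[OF ft_nat_pow[OF assms, of "nat (- n)"]]
  by (cases "n < 0") (simp_all add: int_pow_def2 del: pow_nat)

lemma ft_teval:
  assumes "\<And>i. ft (\<lambda>K v. w K v i)" shows "ft (\<lambda>K v. teval K (w K v) t)"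
proof (induction t)
  case (GMul s t)
  then show ?case using ft_mult[OF GMul.IH] by simp
next
  case (GInv t)
  then show ?case using ft_inv[OF GInv.IH] by simp
qed (simp_all add: ft_one assms)

text \<open>Ordered product x_0 x_1 ... x_(d-1) in a possibly noncommutative group; for each fixed
  length it unrolls to one term.\<close>

definition lprod :: "('u, 'm) monoid_scheme \<Rightarrow> (nat \<Rightarrow> 'u) \<Rightarrow> nat \<Rightarrow> 'u" where
  "lprod K x d = rec_nat \<one>\<^bsub>K\<^esub> (\<lambda>i p. p \<otimes>\<^bsub>K\<^esub> x i) d"

lemma lprod_0 [simp]: "lprod K x 0 = \<one>\<^bsub>K\<^esub>"
  and lprod_Suc [simp]: "lprod K x (Suc d) = lprod K x d \<otimes>\<^bsub>K\<^esub> x d"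
  by (simp_all add: lprod_def)

lemma ft_lprod:
  assumes "\<And>i. ft (\<lambda>K v. w K v i)" shows "ft (\<lambda>K v. lprod K (w K v) d)"
proof (induction d)
  case (Suc d)
  show ?case using ft_mult[OF Suc.IH assms] by simp
qed (simp add: ft_one)

lemma fo_eq: assumes "ft s" "ft t" shows "fo (\<lambda>K v. s K v = t K v)"
proof -
  obtain a b where "\<forall>K v. group K \<longrightarrow> range v \<subseteq> carrier K \<longrightarrow> s K v = teval K v a"
    "\<forall>K v. group K \<longrightarrow> range v \<subseteq> carrier K \<longrightarrow> t K v = teval K v b"
    using assms unfolding ft_def by blast
  then show ?thesis unfolding fo_def by (intro exI[of _ "GEq a b"]) simp
qed

lemma fo_not: assumes "fo \<phi>" shows "fo (\<lambda>K v. \<not> \<phi> K v)"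
proof -
  obtain f where "\<forall>K v. group K \<longrightarrow> range v \<subseteq> carrier K \<longrightarrow> \<phi> K v = fsat K v f"
    using assms unfolding fo_def by blast
  then show ?thesis unfolding fo_def by (intro exI[of _ "GNeg f"]) simp
qed

lemma fo_conj: assumes "fo \<phi>" "fo \<psi>" shows "fo (\<lambda>K v. \<phi> K v \<and> \<psi> K v)"
proof -
  obtain f g where "\<forall>K v. group K \<longrightarrow> range v \<subseteq> carrier K \<longrightarrow> \<phi> K v = fsat K v f"
    "\<forall>K v. group K \<longrightarrow> range v \<subseteq> carrier K \<longrightarrow> \<psi> K v = fsat K v g"
    using assms unfolding fo_def by blast
  then show ?thesis unfolding fo_def by (intro exI[of _ "GAnd f g"]) simp
qed

lemma fo_disj: assumes "fo \<phi>" "fo \<psi>" shows "fo (\<lambda>K v. \<phi> K v \<or> \<psi> K v)"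
  using fo_not[OF fo_conj[OF fo_not[OF assms(1)] fo_not[OF assms(2)]]] by simp

lemma fo_imp: assumes "fo \<phi>" "fo \<psi>" shows "fo (\<lambda>K v. \<phi> K v \<longrightarrow> \<psi> K v)"
  using fo_disj[OF fo_not[OF assms(1)] assms(2)] by simp

lemma fo_const: "fo (\<lambda>K v. P)"
proof (cases P)
  case True
  then show ?thesis using fo_eq[OF ft_one ft_one] by simp
next
  case False
  then show ?thesis using fo_not[OF fo_eq[OF ft_one ft_one]] by simp
qed

text \<open>De Bruijn style: the premise finds the witness at position 0 and the old assignment
  shifted by one, so the rule applies without naming a fresh variable.\<close>

lemma fo_ex:
  assumes "fo (\<lambda>K v. \<phi> K (\<lambda>i. v (Suc i)) (v 0))"
  shows "fo (\<lambda>K v. \<exists>a \<in> carrier K. \<phi> K v a)"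
proof -
  obtain f where f: "\<And>K v. group K \<Longrightarrow> range v \<subseteq> carrier K \<Longrightarrow> \<phi> K (\<lambda>i. v (Suc i)) (v 0) = fsat K v f"
    using assms unfolding fo_def by blast
  obtain N where N: "\<And>i. i \<in> fvars f \<Longrightarrow> i < N"
    using finite_fvars[of f] unfolding finite_nat_set_iff_bounded by blast
  \<comment> \<open>\<open>N\<close> exceeds every free variable of \<open>f\<close>. The
    permutation sends the witness from position 0 to \<open>N\<close> and moves positions 1 to
    \<open>N\<close> down by one, undoing the shift, so that \<open>GEx N\<close> binds the
    witness.\<close>
  define \<pi> where "\<pi> i = (if i = 0 then N else if i \<le> N then i - 1 else i)" for i
  have inj: "inj \<pi>"
  proof (rule injI)
    fix i j show "\<pi> i = \<pi> j \<Longrightarrow> i = j" unfolding \<pi>_def by presburger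
  qed
  have "\<phi> K v a = fsat K (v(N := a)) (fren \<pi> f)"
    if K: "group K" and v: "range v \<subseteq> carrier K" and a: "a \<in> carrier K" for K v a
  proof -
    define v' where "v' i = (case i of 0 \<Rightarrow> a | Suc i \<Rightarrow> v i)" for i
    have "range v' \<subseteq> carrier K" using v a by (simp add: v'_def image_subset_iff split: nat.split)
    from f[OF K this] have "\<phi> K v a = fsat K v' f" by (simp add: v'_def)
    also have "\<dots> = fsat K (\<lambda>i. (v(N := a)) (\<pi> i)) f"
    proof (rule fsat_cong)
      fix i assume "i \<in> fvars f"
      then have "i < N" by (rule N)
      then show "v' i = (v(N := a)) (\<pi> i)" by (cases i) (auto simp: v'_def \<pi>_def)
    qed
    finally show ?thesis by (simp add: fsat_fren[OF inj])
  qed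
  then have "(\<exists>a \<in> carrier K. \<phi> K v a) \<longleftrightarrow> fsat K v (GEx N (fren \<pi> f))"
    if "group K" "range v \<subseteq> carrier K" for K v
    unfolding fsat.simps using that by (intro bex_cong refl) blast
  then show ?thesis unfolding fo_def by blast
qed

lemma fo_all:
  assumes "fo (\<lambda>K v. \<phi> K (\<lambda>i. v (Suc i)) (v 0))"
  shows "fo (\<lambda>K v. \<forall>a \<in> carrier K. \<phi> K v a)"
  using fo_not[OF fo_ex[of "\<lambda>K v a. \<not> \<phi> K v a", OF fo_not[OF assms]]] by simp

text \<open>Tuples are total functions, like assignments; fixing the entries from \<open>k\<close>
  on makes the representative of each k-tuple unique.\<close>

definition tup :: "('u, 'm) monoid_scheme \<Rightarrow> nat \<Rightarrow> (nat \<Rightarrow> 'u) set" where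
  "tup K k = {y. (\<forall>j<k. y j \<in> carrier K) \<and> (\<forall>j\<ge>k. y j = \<one>\<^bsub>K\<^esub>)}"

lemma tup_Suc_ex:
  "(\<exists>y \<in> tup K (Suc k). P y) \<longleftrightarrow> (\<exists>a \<in> carrier K. \<exists>y \<in> tup K k. P (y(k := a)))"
proof
  assume "\<exists>y \<in> tup K (Suc k). P y"
  then obtain y where y: "y \<in> tup K (Suc k)" "P y" by blast
  have "y(k := \<one>\<^bsub>K\<^esub>) \<in> tup K k" using y(1) by (auto simp: tup_def)
  moreover have "(y(k := \<one>\<^bsub>K\<^esub>))(k := y k) = y" by simp
  moreover have "y k \<in> carrier K" using y(1) by (simp add: tup_def)
  ultimately show "\<exists>a \<in> carrier K. \<exists>y \<in> tup K k. P (y(k := a))"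
    using y(2) by (intro bexI[of _ "y k"] bexI[of _ "y(k := \<one>\<^bsub>K\<^esub>)"]) simp_all
next
  assume "\<exists>a \<in> carrier K. \<exists>y \<in> tup K k. P (y(k := a))"
  then obtain a y where "a \<in> carrier K" "y \<in> tup K k" "P (y(k := a))" by blast
  then show "\<exists>y \<in> tup K (Suc k). P y"
    by (intro bexI[of _ "y(k := a)"]) (auto simp: tup_def)
qed

lemma fo_ex_tup:
  assumes "fo (\<lambda>K v. \<phi> K (\<lambda>i. v (i + k)) (\<lambda>j. if j < k then v j else \<one>\<^bsub>K\<^esub>))"
  shows "fo (\<lambda>K v. \<exists>y \<in> tup K k. \<phi> K v y)"
  using assms
proof (induction k arbitrary: \<phi>)
  case 0
  have "tup K 0 = {\<lambda>_. \<one>\<^bsub>K\<^esub>}" for K :: "'a monoid" by (auto simp: tup_def)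
  then show ?case using 0 by simp
next
  case (Suc k)
  have "(\<lambda>j. if j < k then v j else \<one>\<^bsub>K\<^esub>)(k := v k) = (\<lambda>j. if j < Suc k then v j else \<one>\<^bsub>K\<^esub>)"
    for K :: "'a monoid" and v by auto
  then have "fo (\<lambda>K v. \<exists>y \<in> tup K k. \<phi> K (\<lambda>i. v (Suc i)) (y(k := v 0)))"
    by (intro Suc.IH) (use Suc.prems in simp)
  from fo_ex[of "\<lambda>K v a. \<exists>y \<in> tup K k. \<phi> K v (y(k := a))", OF this]
  show ?case by (simp add: tup_Suc_ex)
qed

lemma fo_all_tup:
  assumes "fo (\<lambda>K v. \<phi> K (\<lambda>i. v (i + k)) (\<lambda>j. if j < k then v j else \<one>\<^bsub>K\<^esub>))"
  shows "fo (\<lambda>K v. \<forall>y \<in> tup K k. \<phi> K v y)"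
  using fo_not[OF fo_ex_tup[of "\<lambda>K v a. \<not> \<phi> K v a", OF fo_not[OF assms]]] by simp

lemma fo_all_less: "(\<And>j. j < k \<Longrightarrow> fo (\<phi> j)) \<Longrightarrow> fo (\<lambda>K v. \<forall>j<(k::nat). \<phi> j K v)"
proof (induction k)
  case 0
  then show ?case using fo_const[of True] by simp
next
  case (Suc k)
  have "fo (\<lambda>K v. \<phi> k K v \<and> (\<forall>j<k. \<phi> j K v))"
    by (rule fo_conj[OF Suc.prems Suc.IH]) (use Suc.prems in simp_all)
  then show ?case by (simp only: All_less_Suc)
qed

text \<open>Integers cannot be quantified over inside a formula; bounded exponents enter as finite
  disjunctions.\<close>

lemma fo_ex_finite:
  assumes "finite I" "\<And>j. j \<in> I \<Longrightarrow> fo (\<phi> j)" shows "fo (\<lambda>K v. \<exists>j \<in> I. \<phi> j K v)"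
  using assms
proof (induction I)
  case empty
  then show ?case using fo_const[of False] by simp
next
  case (insert i I)
  have "fo (\<lambda>K v. \<phi> i K v \<or> (\<exists>j \<in> I. \<phi> j K v))"
    by (rule fo_disj[OF insert.prems insert.IH]) (use insert.prems in simp_all)
  then show ?case by simp
qed

lemma fo_cong:
  assumes "fo \<phi>" "\<And>K v. group K \<Longrightarrow> range v \<subseteq> carrier K \<Longrightarrow> \<phi> K v = \<psi> K v"
  shows "fo \<psi>"
proof -
  obtain f where "\<forall>K v. group K \<longrightarrow> range v \<subseteq> carrier K \<longrightarrow> \<phi> K v = fsat K v f"
    using assms(1) unfolding fo_def by blast
  then show ?thesis unfolding fo_def using assms(2) by (intro exI[of _ f]) simp
qed

lemma fsat_foldr_GEx:
  "fsat K v (foldr GEx xs f) \<longleftrightarrow>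
   (\<exists>w. (\<forall>i. i \<notin> set xs \<longrightarrow> w i = v i) \<and> (\<forall>i \<in> set xs. w i \<in> carrier K) \<and> fsat K w f)"
proof (induction xs arbitrary: v)
  case Nil
  have "(\<forall>i. w i = v i) \<longleftrightarrow> w = v" for w by auto
  then show ?case by simp
next
  case (Cons x xs)
  have eq: "fsat K v (foldr GEx (x # xs) f) \<longleftrightarrow> (\<exists>a \<in> carrier K. \<exists>w. (\<forall>i. i \<notin> set xs \<longrightarrow> w i = (v(x := a)) i) \<and>
      (\<forall>i \<in> set xs. w i \<in> carrier K) \<and> fsat K w f)"
    by (simp only: foldr.simps comp_apply fsat.simps Cons)
  show ?case unfolding eq
  proof (intro iffI; elim bexE exE conjE)
    fix a w
    assume a: "a \<in> carrier K" and w: "\<forall>i. i \<notin> set xs \<longrightarrow> w i = (v(x := a)) i"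
      "\<forall>i \<in> set xs. w i \<in> carrier K" "fsat K w f"
    have "w x \<in> carrier K"
    proof (cases "x \<in> set xs")
      case False
      then have "w x = (v(x := a)) x" using w(1) by blast
      then show ?thesis using a by simp
    qed (use w(2) in blast)
    then have 1: "\<forall>i \<in> set (x # xs). w i \<in> carrier K" using w(2) by simp
    have 2: "\<forall>i. i \<notin> set (x # xs) \<longrightarrow> w i = v i"
    proof (intro allI impI)
      fix i assume i: "i \<notin> set (x # xs)"
      then have "w i = (v(x := a)) i" using w(1) by simp
      then show "w i = v i" using i by simp
    qed
    show "\<exists>w. (\<forall>i. i \<notin> set (x # xs) \<longrightarrow> w i = v i) \<and>
        (\<forall>i \<in> set (x # xs). w i \<in> carrier K) \<and> fsat K w f"
      using 1 2 w(3) by blast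
  next
    fix w
    assume w: "\<forall>i. i \<notin> set (x # xs) \<longrightarrow> w i = v i"
      "\<forall>i \<in> set (x # xs). w i \<in> carrier K" "fsat K w f"
    have 1: "w x \<in> carrier K" "\<forall>i \<in> set xs. w i \<in> carrier K" using w(2) by simp_all
    have 2: "\<forall>i. i \<notin> set xs \<longrightarrow> w i = (v(x := w x)) i"
    proof (intro allI impI)
      fix i assume "i \<notin> set xs"
      then have "i = x \<or> i \<notin> set (x # xs)" by auto
      then show "w i = (v(x := w x)) i" using w(1) by (cases "i = x") simp_all
    qed
    show "\<exists>a \<in> carrier K. \<exists>w. (\<forall>i. i \<notin> set xs \<longrightarrow> w i = (v(x := a)) i) \<and>
      (\<forall>i \<in> set xs. w i \<in> carrier K) \<and> fsat K w f"
      using 1 2 w(3) by blast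
  qed
qed

text \<open>Elementary equivalence speaks of sentences only, so the formula is closed existentially
  and an assignment is recovered from the witnesses. The tuple found in \<open>H\<close> shares
  nothing with \<open>v\<close> except that it satisfies \<phi>.\<close>

lemma elem_equiv_transfer:
  assumes "fo \<phi>" "elem_equiv G H" "group G" "group H" "range v \<subseteq> carrier G" "\<phi> G v"
  shows "\<exists>w. range w \<subseteq> carrier H \<and> \<phi> H w"
proof -
  obtain f where f: "\<And>K v. group K \<Longrightarrow> range v \<subseteq> carrier K \<Longrightarrow> \<phi> K v = fsat K v f"
    using assms(1) unfolding fo_def by blast
  obtain xs where xs: "set xs = fvars f" using finite_fvars finite_list by blast
  have "fvars (foldr GEx ys f) = fvars f - set ys" for ys by (induction ys) auto
  then have "sentence (foldr GEx xs f)" by (simp add: sentence_def xs)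
  moreover have "models G (foldr GEx xs f)"
  proof -
    \<comment> \<open>\<open>models\<close> evaluates at the constant assignment one, so the witness
      assignment has to be one outside the quantified variables.\<close>
    define w where "w i = (if i \<in> set xs then v i else \<one>\<^bsub>G\<^esub>)" for i
    have "fsat G v f" using f[OF assms(3,5)] assms(6) by simp
    then have "fsat G w f" using fsat_cong[of f v w G] by (simp add: w_def xs)
    then show ?thesis unfolding models_def fsat_foldr_GEx
      using assms(5) by (intro exI[of _ w]) (simp add: w_def image_subset_iff)
  qed
  ultimately have "models H (foldr GEx xs f)" using assms(2) by (simp add: elem_equiv_def)
  then obtain w where w: "\<forall>i. i \<notin> set xs \<longrightarrow> w i = \<one>\<^bsub>H\<^esub>" "\<forall>i \<in> set xs. w i \<in> carrier H" "fsat H w f"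
    unfolding models_def fsat_foldr_GEx by blast
  have "w i \<in> carrier H" for i
    using w(1,2) group.is_monoid[OF assms(4)] by (cases "i \<in> set xs") (simp_all add: monoid.one_closed)
  then have "range w \<subseteq> carrier H" by blast
  then show ?thesis using f[OF assms(4)] w(3) by blast
qed

section \<open>Central series and finitely generated nilpotent groups\<close>

definition com :: "('a, 'b) monoid_scheme \<Rightarrow> 'a \<Rightarrow> 'a \<Rightarrow> 'a" where
  "com G x y = x \<otimes>\<^bsub>G\<^esub> y \<otimes>\<^bsub>G\<^esub> inv\<^bsub>G\<^esub> x \<otimes>\<^bsub>G\<^esub> inv\<^bsub>G\<^esub> y"

text \<open>The upper central series in commutator form. For fixed \<open>i\<close>, membership
  unfolds to a formula, one universal quantifier per step; \<open>uc G 1\<close> is the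
  center.\<close>

primrec uc :: "('a, 'b) monoid_scheme \<Rightarrow> nat \<Rightarrow> 'a set" where
  "uc G 0 = {\<one>\<^bsub>G\<^esub>}"
| "uc G (Suc i) = {z \<in> carrier G. \<forall>g \<in> carrier G. com G z g \<in> uc G i}"

definition fgs :: "('a, 'b) monoid_scheme \<Rightarrow> 'a set \<Rightarrow> bool" where
  "fgs G U \<longleftrightarrow> (\<exists>S. finite S \<and> S \<subseteq> carrier G \<and> generate G S = U)"

definition noeth :: "('a, 'b) monoid_scheme \<Rightarrow> bool" where
  "noeth G \<longleftrightarrow> group G \<and> (\<forall>U. subgroup U G \<longrightarrow> fgs G U)"

lemma subset_generate: "A \<subseteq> B \<Longrightarrow> A \<subseteq> generate G B"
  by (meson generate.incl subset_iff)

section \<open>Commutator calculus and the two central series\<close>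

context group
begin

lemma inv_cancel1: "x \<in> carrier G \<Longrightarrow> y \<in> carrier G \<Longrightarrow> inv x \<otimes> (x \<otimes> y) = y"
  by (simp add: m_assoc[symmetric])

lemma inv_cancel2: "x \<in> carrier G \<Longrightarrow> y \<in> carrier G \<Longrightarrow> x \<otimes> (inv x \<otimes> y) = y"
  by (simp add: m_assoc[symmetric])

lemmas gsimps = m_assoc inv_mult_group inv_cancel1 inv_cancel2

lemma com_closed [simp, intro]: "x \<in> carrier G \<Longrightarrow> y \<in> carrier G \<Longrightarrow> com G x y \<in> carrier G"
  by (simp add: com_def)

lemma com_mult_left:
  "x \<in> carrier G \<Longrightarrow> y \<in> carrier G \<Longrightarrow> g \<in> carrier G \<Longrightarrow>
   com G (x \<otimes> y) g = (x \<otimes> com G y g \<otimes> inv x) \<otimes> com G x g"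
  by (simp add: com_def gsimps)

lemma com_inv_left:
  "x \<in> carrier G \<Longrightarrow> g \<in> carrier G \<Longrightarrow> com G (inv x) g = inv x \<otimes> inv (com G x g) \<otimes> x"
  by (simp add: com_def gsimps)

lemma com_mult_right:
  "x \<in> carrier G \<Longrightarrow> y \<in> carrier G \<Longrightarrow> z \<in> carrier G \<Longrightarrow>
   com G x (y \<otimes> z) = com G x y \<otimes> (y \<otimes> com G x z \<otimes> inv y)"
  by (simp add: com_def gsimps)

lemma com_inv_right:
  "x \<in> carrier G \<Longrightarrow> y \<in> carrier G \<Longrightarrow> com G x (inv y) = inv y \<otimes> inv (com G x y) \<otimes> y"
  by (simp add: com_def gsimps)

lemma inv_com: "x \<in> carrier G \<Longrightarrow> y \<in> carrier G \<Longrightarrow> inv (com G x y) = com G y x"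
  by (simp add: com_def gsimps)

lemma com_one [simp]:
  "x \<in> carrier G \<Longrightarrow> com G x \<one> = \<one>" "x \<in> carrier G \<Longrightarrow> com G \<one> x = \<one>"
  by (simp_all add: com_def)

lemma com_conj:
  "x \<in> carrier G \<Longrightarrow> h \<in> carrier G \<Longrightarrow> g \<in> carrier G \<Longrightarrow>
   com G (h \<otimes> x \<otimes> inv h) g = h \<otimes> com G x (inv h \<otimes> g \<otimes> h) \<otimes> inv h"
  by (simp add: com_def gsimps)

lemma conj_eq_com: "x \<in> carrier G \<Longrightarrow> h \<in> carrier G \<Longrightarrow> h \<otimes> x \<otimes> inv h = com G h x \<otimes> x"
  by (simp add: com_def gsimps)

lemma normal_conj: "N \<lhd> G \<Longrightarrow> h \<in> carrier G \<Longrightarrow> x \<in> N \<Longrightarrow> h \<otimes> x \<otimes> inv h \<in> N"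
  by (simp add: normal_inv_iff)

lemma normal_conj': "N \<lhd> G \<Longrightarrow> h \<in> carrier G \<Longrightarrow> x \<in> N \<Longrightarrow> inv h \<otimes> x \<otimes> h \<in> N"
  using normal_conj[of N "inv h" x] by simp

lemma normalD:
  assumes "N \<lhd> G" shows "subgroup N G" "N \<subseteq> carrier G" "\<one> \<in> N"
    "x \<in> N \<Longrightarrow> y \<in> N \<Longrightarrow> x \<otimes> y \<in> N" "x \<in> N \<Longrightarrow> inv x \<in> N"
proof -
  show s: "subgroup N G" using assms normal_imp_subgroup by blast
  show "N \<subseteq> carrier G" "\<one> \<in> N" "x \<in> N \<Longrightarrow> y \<in> N \<Longrightarrow> x \<otimes> y \<in> N" "x \<in> N \<Longrightarrow> inv x \<in> N"
    using subgroup.subset[OF s] subgroup.one_closed[OF s] subgroup.m_closed[OF s]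
      subgroup.m_inv_closed[OF s] by blast+
qed

text \<open>This is the preimage of the center of the quotient by \<open>N\<close>. Being a
  subgroup, it allows commutator conditions to be checked on generators.\<close>

lemma subgroup_com_left:
  assumes N: "N \<lhd> G"
  shows "subgroup {x \<in> carrier G. \<forall>g \<in> carrier G. com G x g \<in> N} G"
proof (rule subgroupI)
  show "{x \<in> carrier G. \<forall>g \<in> carrier G. com G x g \<in> N} \<noteq> {}"
    using normalD(3)[OF N] by (intro ex_in_conv[THEN iffD1] exI[of _ \<one>]) simp
next
  fix a assume "a \<in> {x \<in> carrier G. \<forall>g \<in> carrier G. com G x g \<in> N}"
  then show "inv a \<in> {x \<in> carrier G. \<forall>g \<in> carrier G. com G x g \<in> N}"
    by (simp add: com_inv_left normal_conj'[OF N] normalD(5)[OF N])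
next
  fix a b
  assume "a \<in> {x \<in> carrier G. \<forall>g \<in> carrier G. com G x g \<in> N}"
    "b \<in> {x \<in> carrier G. \<forall>g \<in> carrier G. com G x g \<in> N}"
  then show "a \<otimes> b \<in> {x \<in> carrier G. \<forall>g \<in> carrier G. com G x g \<in> N}"
    by (simp add: com_mult_left normal_conj[OF N] normalD(4)[OF N])
qed blast

lemma subgroup_com_right:
  assumes N: "N \<lhd> G" and x: "x \<in> carrier G"
  shows "subgroup {g \<in> carrier G. com G x g \<in> N} G"
proof (rule subgroupI)
  show "{g \<in> carrier G. com G x g \<in> N} \<noteq> {}"
    using normalD(3)[OF N] x by (intro ex_in_conv[THEN iffD1] exI[of _ \<one>]) simp
next
  fix a assume "a \<in> {g \<in> carrier G. com G x g \<in> N}"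
  then show "inv a \<in> {g \<in> carrier G. com G x g \<in> N}"
    using x by (simp add: com_inv_right normal_conj'[OF N] normalD(5)[OF N])
next
  fix a b
  assume "a \<in> {g \<in> carrier G. com G x g \<in> N}" "b \<in> {g \<in> carrier G. com G x g \<in> N}"
  then show "a \<otimes> b \<in> {g \<in> carrier G. com G x g \<in> N}"
    using x by (simp add: com_mult_right normal_conj[OF N] normalD(4)[OF N])
qed blast

lemma uc_normal: "uc G i \<lhd> G"
proof (induction i)
  case 0
  show ?case by (simp add: one_is_normal)
next
  case (Suc i)
  have "h \<otimes> x \<otimes> inv h \<in> uc G (Suc i)" if "h \<in> carrier G" "x \<in> uc G (Suc i)" for h x
  proof -
    have "com G (h \<otimes> x \<otimes> inv h) g \<in> uc G i" if "g \<in> carrier G" for g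
      using \<open>x \<in> uc G (Suc i)\<close> \<open>h \<in> carrier G\<close> that
      by (simp add: com_conj normal_conj[OF Suc])
    then show ?thesis using that by simp
  qed
  then show ?case using subgroup_com_left[OF Suc] by (simp add: normal_inv_iff)
qed

lemma uc_closed: "x \<in> uc G i \<Longrightarrow> x \<in> carrier G"
  using normalD(2)[OF uc_normal] by blast

lemma uc_com: "x \<in> uc G (Suc i) \<Longrightarrow> g \<in> carrier G \<Longrightarrow> com G x g \<in> uc G i"
  by simp

lemma uc_com': "x \<in> uc G (Suc i) \<Longrightarrow> g \<in> carrier G \<Longrightarrow> com G g x \<in> uc G i"
  using normalD(5)[OF uc_normal uc_com, of x i g] inv_com[of x g] uc_closed by simp

lemma uc_subset_Suc: "uc G i \<subseteq> uc G (Suc i)"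
proof
  fix x assume x: "x \<in> uc G i"
  have "com G x g \<in> uc G i" if g: "g \<in> carrier G" for g
  proof -
    have "com G x g = x \<otimes> (g \<otimes> inv x \<otimes> inv g)"
      using g uc_closed[OF x] by (simp add: com_def gsimps)
    then show ?thesis
      using normalD(4)[OF uc_normal x normal_conj[OF uc_normal g normalD(5)[OF uc_normal x]]] by simp
  qed
  then show "x \<in> uc G (Suc i)" using uc_closed[OF x] by simp
qed

lemma lower_central_Suc: "lower_central G (Suc n) = generate G {com G a b |a b. a \<in> lower_central G n \<and> b \<in> carrier G}"
  by (simp add: comm_subgroup_def com_def)

lemma lc_normal: "lower_central G n \<lhd> G"
proof (induction n)
  case 0
  show ?case by (simp add: normal_self)
next
  case (Suc n)
  let ?A = "{com G a b |a b. a \<in> lower_central G n \<and> b \<in> carrier G}"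
  note sub = normalD(2)[OF Suc]
  show ?case unfolding lower_central_Suc
  proof (rule normal_generateI)
    show "?A \<subseteq> carrier G" using sub by blast
    fix x g assume x: "x \<in> ?A" and g: "g \<in> carrier G"
    then obtain a b where ab: "x = com G a b" "a \<in> lower_central G n" "b \<in> carrier G" by blast
    have "g \<otimes> x \<otimes> inv g = com G (g \<otimes> a \<otimes> inv g) (g \<otimes> b \<otimes> inv g)"
      using ab g sub by (simp add: com_def gsimps subset_iff)
    then show "g \<otimes> x \<otimes> inv g \<in> ?A" using normal_conj[OF Suc g ab(2)] g ab(3) by blast
  qed
qed

lemma lc_closed: "x \<in> lower_central G n \<Longrightarrow> x \<in> carrier G"
  using normalD(2)[OF lc_normal] by blast

lemma lc_com: "x \<in> lower_central G n \<Longrightarrow> g \<in> carrier G \<Longrightarrow> com G x g \<in> lower_central G (Suc n)"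
  unfolding lower_central_Suc by (intro generate.incl) blast

lemma lc_com': "x \<in> lower_central G n \<Longrightarrow> g \<in> carrier G \<Longrightarrow> com G g x \<in> lower_central G (Suc n)"
  using normalD(5)[OF lc_normal lc_com, of x n g] inv_com[of x g] lc_closed by simp

lemma lc_Suc_subset: "lower_central G (Suc n) \<subseteq> lower_central G n"
proof -
  have "com G a b \<in> lower_central G n" if ab: "a \<in> lower_central G n" "b \<in> carrier G" for a b
  proof -
    have "com G a b = a \<otimes> (b \<otimes> inv a \<otimes> inv b)"
      using ab lc_closed by (simp add: com_def gsimps)
    then show ?thesis
      using normalD(4)[OF lc_normal ab(1) normal_conj[OF lc_normal ab(2) normalD(5)[OF lc_normal ab(1)]]] by simp
  qed
  then show ?thesis unfolding lower_central_Suc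
    by (intro generate_subgroup_incl normalD(1)[OF lc_normal]) blast
qed

lemma uc_if_lc:
  assumes "lower_central G n = {\<one>}" shows "uc G n = carrier G"
proof -
  have "lower_central G (n - i) \<subseteq> uc G i" if "i \<le> n" for i
    using that
  proof (induction i)
    case 0
    then show ?case using assms by simp
  next
    case (Suc i)
    show ?case
    proof
      fix x assume x: "x \<in> lower_central G (n - Suc i)"
      have "com G x g \<in> uc G i" if "g \<in> carrier G" for g
        using lc_com[OF x that] Suc by (auto simp: Suc_diff_Suc)
      then show "x \<in> uc G (Suc i)" using lc_closed[OF x] by simp
    qed
  qed
  from this[of n] show ?thesis using uc_closed by auto
qed

lemma lc_if_uc:
  assumes "uc G n = carrier G" shows "lower_central G n = {\<one>}"
proof -
  have "lower_central G i \<subseteq> uc G (n - i)" if "i \<le> n" for i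
    using that
  proof (induction i)
    case 0
    then show ?case using assms by simp
  next
    case (Suc i)
    have "com G a b \<in> uc G (n - Suc i)" if "a \<in> lower_central G i" "b \<in> carrier G" for a b
      using Suc that uc_com[of a "n - Suc i" b] by (auto simp: Suc_diff_Suc)
    then show ?case unfolding lower_central_Suc
      by (intro generate_subgroup_incl normalD(1)[OF uc_normal]) blast
  qed
  from this[of n] show ?thesis using normalD(3)[OF lc_normal] by auto
qed

lemma generate_idem_Un:
  assumes "A \<subseteq> carrier G" "B \<subseteq> carrier G"
  shows "generate G (generate G A \<union> B) = generate G (A \<union> B)"
proof
  have "generate G A \<subseteq> generate G (A \<union> B)" by (rule mono_generate) blast
  moreover have "B \<subseteq> generate G (A \<union> B)" by (rule subset_generate) blast
  ultimately show "generate G (generate G A \<union> B) \<subseteq> generate G (A \<union> B)"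
    using assms by (intro generate_subgroup_incl generate_is_subgroup) blast+
  show "generate G (A \<union> B) \<subseteq> generate G (generate G A \<union> B)"
    by (rule mono_generate) (use subset_generate[of A A G] in blast)
qed

text \<open>Conjugating an element of the j-th lower central term multiplies it by a commutator from
  the next term, and that term lies in \<open>V\<close>.\<close>

lemma between_normal:
  assumes "subgroup V G" "lower_central G (Suc j) \<subseteq> V" "V \<subseteq> lower_central G j"
  shows "V \<lhd> G"
proof -
  have "h \<otimes> x \<otimes> inv h \<in> V" if "h \<in> carrier G" "x \<in> V" for h x
  proof -
    have "x \<in> lower_central G j" using that assms by blast
    then have "com G h x \<in> V" using lc_com' that assms by blast
    then show ?thesis using conj_eq_com[of x h] subgroup.m_closed[OF assms(1)] that
      subgroup.mem_carrier[OF assms(1)] by simp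
  qed
  then show ?thesis using assms(1) by (simp add: normal_inv_iff)
qed

end

text \<open>If \<open>T\<close> generates one lower central factor and \<open>S\<close> the group,
  the commutators [t, s] generate the next factor. The clause for positive \<open>j\<close> records
  this commutator form, in which \<open>lc_induct\<close> adjoins the generators.\<close>

lemma (in group) lc_generators:
  assumes S: "finite S" "S \<subseteq> carrier G" "generate G S = carrier G"
  shows "\<exists>T. finite T \<and> T \<subseteq> lower_central G j \<and>
    (0 < j \<longrightarrow> T \<subseteq> {com G u s |u s. u \<in> lower_central G (j - 1) \<and> s \<in> carrier G}) \<and>
    lower_central G j = generate G (lower_central G (Suc j) \<union> T)"
proof (induction j)
  case 0
  have "carrier G = generate G (lower_central G (Suc 0) \<union> S)"
    using mono_generate[of S "lower_central G (Suc 0) \<union> S"] S lc_closed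
      generate_incl[of "lower_central G (Suc 0) \<union> S"] by blast
  then show ?case using S by (intro exI[of _ S]) simp
next
  case (Suc j)
  then obtain T where T: "finite T" "T \<subseteq> lower_central G j"
    "lower_central G j = generate G (lower_central G (Suc j) \<union> T)" by blast
  let ?T = "{com G t s |t s. t \<in> T \<and> s \<in> S}"
  let ?W = "generate G (lower_central G (Suc (Suc j)) \<union> ?T)"
  have T': "?T \<subseteq> lower_central G (Suc j)" using T S lc_com by blast
  have finT: "finite ?T" using finite_image_set2[of "\<lambda>t. t \<in> T" "\<lambda>s. s \<in> S"] T(1) S(1) by simp
  have sub: "lower_central G (Suc (Suc j)) \<union> ?T \<subseteq> lower_central G (Suc j)"
    using T' lc_Suc_subset by blast
  then have subc: "lower_central G (Suc (Suc j)) \<union> ?T \<subseteq> carrier G" using lc_closed by blast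
  have W1: "?W \<subseteq> lower_central G (Suc j)"
    by (rule generate_subgroup_incl[OF sub normalD(1)[OF lc_normal]])
  have W2: "lower_central G (Suc (Suc j)) \<subseteq> ?W" "?T \<subseteq> ?W" by (rule subset_generate, blast)+
  \<comment> \<open>Normality makes the elements whose commutators fall into this subgroup a
    subgroup themselves, so it is enough to test generators, first in the right and then in the left
    argument.\<close>
  have W: "?W \<lhd> G" by (rule between_normal[OF generate_is_subgroup[OF subc] W2(1) W1])
  have t: "com G t g \<in> ?W" if "t \<in> T" "g \<in> carrier G" for t g
  proof -
    have "S \<subseteq> {g \<in> carrier G. com G t g \<in> ?W}" using S(2) W2(2) that by blast
    from generate_subgroup_incl[OF this subgroup_com_right[OF W]]
    show ?thesis using S(3) that T(2) lc_closed by blast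
  qed
  have "lower_central G (Suc j) \<union> T \<subseteq> {x \<in> carrier G. \<forall>g \<in> carrier G. com G x g \<in> ?W}"
    using t T(2) lc_closed lc_com W2(1) by blast
  from generate_subgroup_incl[OF this subgroup_com_left[OF W]]
  have "com G a b \<in> ?W" if "a \<in> lower_central G j" "b \<in> carrier G" for a b
    using T(3) that by blast
  then have "lower_central G (Suc j) \<subseteq> ?W" unfolding lower_central_Suc[of j]
    by (intro generate_subgroup_incl normalD(1)[OF W]) blast
  then have "lower_central G (Suc j) = ?W" using W1 by blast
  moreover have "?T \<subseteq> {com G u s |u s. u \<in> lower_central G j \<and> s \<in> carrier G}"
    using T(2) S(2) by blast
  ultimately show ?case using finT T' by (intro exI[of _ ?T]) simp
qed

text \<open>Climbs from the trivial subgroup to the derived subgroup by adjoining one commutator at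
  a time; every \<open>V\<close> on the way lies between consecutive lower central terms and is
  therefore normal. Both the maximal condition and the bound on commutator width are obtained from
  it.\<close>

lemma (in group) lc_induct:
  assumes S: "finite S" "S \<subseteq> carrier G" "generate G S = carrier G"
    and c: "lower_central G c = {\<one>}" and P1: "P {\<one>}"
    and step: "\<And>V j u s. V \<lhd> G \<Longrightarrow> lower_central G (Suc (Suc j)) \<subseteq> V \<Longrightarrow> V \<subseteq> lower_central G (Suc j) \<Longrightarrow>
      u \<in> lower_central G j \<Longrightarrow> s \<in> carrier G \<Longrightarrow> P V \<Longrightarrow> P (generate G (V \<union> {com G u s}))"
  shows "P (lower_central G 1)"
proof -
  have down: "P (lower_central G (Suc j))" if P: "P (lower_central G (Suc (Suc j)))" for j
  proof -
    let ?L = "lower_central G (Suc (Suc j))"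
    obtain T where T: "finite T" "T \<subseteq> lower_central G (Suc j)"
      "T \<subseteq> {com G u s |u s. u \<in> lower_central G j \<and> s \<in> carrier G}"
      "lower_central G (Suc j) = generate G (?L \<union> T)"
      using lc_generators[OF S, of "Suc j"] by auto
    have "P (generate G (?L \<union> F))" if "finite F" "F \<subseteq> T" for F
      using that
    proof (induction F)
      case empty
      have "generate G ?L = ?L"
        by (rule subset_antisym[OF generate_subgroup_incl[OF subset_refl normalD(1)[OF lc_normal]]])
          (rule subset_generate[OF subset_refl])
      then show ?case using P by simp
    next
      case (insert t F)
      let ?V = "generate G (?L \<union> F)"
      have sub: "?L \<union> F \<subseteq> lower_central G (Suc j)" using insert.prems T(2) lc_Suc_subset by blast
      then have subc: "?L \<union> F \<subseteq> carrier G" using lc_closed by blast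
      have V1: "?V \<subseteq> lower_central G (Suc j)"
        by (rule generate_subgroup_incl[OF sub normalD(1)[OF lc_normal]])
      have V2: "?L \<subseteq> ?V" by (rule subset_generate) blast
      have V: "?V \<lhd> G" by (rule between_normal[OF generate_is_subgroup[OF subc] V2 V1])
      obtain u s where us: "t = com G u s" "u \<in> lower_central G j" "s \<in> carrier G"
        using insert.prems T(3) by blast
      have "P (generate G (?V \<union> {t}))"
        unfolding us(1) by (rule step[OF V V2 V1 us(2,3) insert.IH]) (use insert.prems in blast)
      moreover have "t \<in> carrier G" using us lc_closed by simp
      ultimately show ?case using generate_idem_Un[OF subc, of "{t}"] by simp
    qed
    from this[OF T(1) subset_refl] show ?thesis by (simp only: T(4)[symmetric])
  qed
  have "P (lower_central G (Suc (c - i)))" if "i \<le> c" for i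
    using that
  proof (induction i)
    case 0
    have "lower_central G (Suc c) = {\<one>}"
      using lc_Suc_subset[of c] c normalD(3)[OF lc_normal[of "Suc c"]] by blast
    then show ?case using P1 by simp
  next
    case (Suc i)
    then have "P (lower_central G (Suc (Suc (c - Suc i))))" by (simp add: Suc_diff_Suc)
    then show ?case by (rule down)
  qed
  from this[of c] show ?thesis by simp
qed

section \<open>The maximal condition on subgroups\<close>

lemma (in group_hom) fgs_extension:
  assumes U: "subgroup U G" and im: "fgs H (h ` U)" and ker: "fgs G (U \<inter> kernel G H h)"
  shows "fgs G U"
proof -
  obtain S where S: "finite S" "S \<subseteq> carrier H" "generate H S = h ` U" using im unfolding fgs_def by blast
  obtain T where T: "finite T" "T \<subseteq> carrier G" "generate G T = U \<inter> kernel G H h" using ker unfolding fgs_def by blast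
  have "S \<subseteq> h ` U" using S(3) subset_generate[of S S H] by blast
  then obtain F where F: "F \<subseteq> U" "finite F" "S = h ` F"
    using finite_subset_image[OF S(1)] by metis
  have TU: "T \<subseteq> U" using T(3) subset_generate[of T T G] by blast
  have Uc: "U \<subseteq> carrier G" using subgroup.subset[OF U] .
  have FT: "F \<union> T \<subseteq> carrier G" using F TU Uc by blast
  have "generate G (F \<union> T) = U"
  proof
    show "generate G (F \<union> T) \<subseteq> U" using F TU by (intro G.generate_subgroup_incl[OF _ U]) blast
    show "U \<subseteq> generate G (F \<union> T)"
    proof
      fix u assume u: "u \<in> U"
      have "h u \<in> generate H (h ` F)" using u S(3) F(3) by blast
      also have "generate H (h ` F) = h ` generate G F"
        using generate_img[of F] F Uc by blast
      finally obtain g where g: "g \<in> generate G F" "h u = h g" by blast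
      have gU: "g \<in> U" using G.generate_subgroup_incl[OF F(1) U] g by blast
      have c: "u \<in> carrier G" "g \<in> carrier G" using u gU Uc by blast+
      have "u \<otimes>\<^bsub>G\<^esub> inv\<^bsub>G\<^esub> g \<in> U \<inter> kernel G H h"
        using subgroup.m_closed[OF U u subgroup.m_inv_closed[OF U gU]] c g(2)
        by (simp add: kernel_def)
      then have "u \<otimes>\<^bsub>G\<^esub> inv\<^bsub>G\<^esub> g \<in> generate G (F \<union> T)"
        using T(3) G.mono_generate[of T "F \<union> T"] by blast
      moreover have "g \<in> generate G (F \<union> T)" using g G.mono_generate[of F "F \<union> T"] by blast
      ultimately have "u \<otimes>\<^bsub>G\<^esub> inv\<^bsub>G\<^esub> g \<otimes>\<^bsub>G\<^esub> g \<in> generate G (F \<union> T)" by (rule generate.eng)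
      then show "u \<in> generate G (F \<union> T)" using c by (simp add: G.m_assoc)
    qed
  qed
  moreover have "finite (F \<union> T)" using F T by simp
  ultimately show ?thesis using FT unfolding fgs_def by blast
qed

lemma (in group) fgs_trivial: "fgs G {\<one>}"
  unfolding fgs_def using generate_one by (intro exI[of _ "{\<one>}"]) simp

lemma (in group) fgs_cyclic:
  assumes t: "t \<in> carrier G" and U: "subgroup U G" "U \<subseteq> generate G {t}"
  shows "fgs G U"
proof (cases "\<exists>n::nat. 0 < n \<and> t [^] int n \<in> U")
  case False
  have "U = {\<one>}"
  proof -
    have "x = \<one>" if x: "x \<in> U" for x
    proof -
      obtain k :: int where k: "x = t [^] k" using x U(2) generate_pow[OF t] by auto
      have "k = 0"
      proof (rule ccontr)
        assume "k \<noteq> 0"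
        then consider "k = int (nat k)" "0 < nat k" | "- k = int (nat (- k))" "0 < nat (- k)" by linarith
        then show False
        proof cases
          case 1
          then show ?thesis using False x k by metis
        next
          case 2
          have "t [^] (- k) \<in> U"
            using subgroup.m_inv_closed[OF U(1) x] k t by (simp add: int_pow_neg)
          then show ?thesis using False 2 by metis
        qed
      qed
      then show ?thesis using k by simp
    qed
    then show ?thesis using subgroup.one_closed[OF U(1)] by blast
  qed
  then show ?thesis using fgs_trivial by simp
next
  case True
  define d where "d = (LEAST n::nat. 0 < n \<and> t [^] int n \<in> U)"
  have d: "0 < d" "t [^] int d \<in> U" using LeastI_ex[OF True] unfolding d_def by blast+
  have least: "\<not> (0 < n \<and> t [^] int n \<in> U)" if "n < d" for n
    using not_less_Least that unfolding d_def by blast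
  have tc: "t [^] int d \<in> carrier G" using t by (rule int_pow_closed)
  have "generate G {t [^] int d} = U"
  proof
    show "generate G {t [^] int d} \<subseteq> U" using d by (intro generate_subgroup_incl[OF _ U(1)]) blast
    show "U \<subseteq> generate G {t [^] int d}"
    proof
      fix x assume x: "x \<in> U"
      obtain k :: int where k: "x = t [^] k" using x U(2) generate_pow[OF t] by auto
      have q: "(t [^] int d) [^] (k div int d) \<in> U" using d(2) subgroup_int_pow_closed[OF U(1)] by blast
      have "t [^] (k mod int d) = x \<otimes> inv ((t [^] int d) [^] (k div int d))"
        using t by (simp add: k int_pow_pow int_pow_diff[symmetric] minus_mult_div_eq_mod)
      then have r: "t [^] (k mod int d) \<in> U"
        using subgroup.m_closed[OF U(1) x subgroup.m_inv_closed[OF U(1) q]] by simp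
      have "k mod int d = int (nat (k mod int d))" "nat (k mod int d) < d"
        using d(1) by (simp_all add: nat_less_iff)
      then have "k mod int d = 0" using least r d(1)
        by (metis gr0I of_nat_0)
      then have "k = int d * (k div int d)" using mult_div_mod_eq[of "int d" k] by simp
      then have "x = (t [^] int d) [^] (k div int d)"
        using t by (metis k int_pow_pow)
      then show "x \<in> generate G {t [^] int d}"
        using generate_pow[OF tc] by blast
    qed
  qed
  then show ?thesis using tc unfolding fgs_def by (intro exI[of _ "{t [^] int d}"]) simp
qed

lemma (in normal) quot_hom: "group_hom G (G Mod H) ((#>) H)"
  using r_coset_hom_Mod factorgroup_is_group
  by (simp add: group_hom_def group_hom_axioms_def is_group)

lemma (in group) coset_eq_iff:
  assumes "N \<lhd> G" "x \<in> carrier G" "y \<in> carrier G"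
  shows "N #> x = N #> y \<longleftrightarrow> x \<otimes> inv y \<in> N"
proof -
  have "N #> x = N #> y \<longleftrightarrow> x \<in> N #> y"
    using repr_independence[OF _ assms(3) normalD(1)[OF assms(1)], of x]
      rcos_self[OF assms(2) normalD(1)[OF assms(1)]] by metis
  then show ?thesis using subgroup.rcos_module[OF normalD(1)[OF assms(1)] is_group assms(3,2)] by simp
qed

lemma (in group) quot_one_iff:
  assumes "N \<lhd> G" "x \<in> carrier G" shows "N #> x = \<one>\<^bsub>G Mod N\<^esub> \<longleftrightarrow> x \<in> N"
  using coset_eq_iff[OF assms one_closed] assms(2) coset_mult_one[OF normalD(2)[OF assms(1)]] by simp

text \<open>\<open>U\<close> meets \<open>V\<close> in a finitely generated group, and the image of
  \<open>U\<close> modulo \<open>V\<close> lies in the cyclic group generated by the coset of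
  \<open>t\<close>.\<close>

lemma (in group) noeth_step:
  assumes V: "V \<lhd> G" and fV: "\<And>U. subgroup U G \<Longrightarrow> U \<subseteq> V \<Longrightarrow> fgs G U"
    and t: "t \<in> carrier G" and U: "subgroup U G" "U \<subseteq> generate G (V \<union> {t})"
  shows "fgs G U"
proof -
  interpret q: group_hom G "G Mod V" "(#>) V" by (rule normal.quot_hom[OF V])
  have Vt: "V \<union> {t} \<subseteq> carrier G" using normalD(2)[OF V] t by blast
  have "(#>) V ` U \<subseteq> (#>) V ` generate G (V \<union> {t})" using U(2) by blast
  also have "\<dots> = generate (G Mod V) ((#>) V ` (V \<union> {t}))" using q.generate_img[OF Vt] by simp
  also have "\<dots> \<subseteq> generate (G Mod V) {V #> t}"
  proof (rule q.H.generate_subgroup_incl[OF _ q.H.generate_is_subgroup])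
    have "V #> v \<in> generate (G Mod V) {V #> t}" if "v \<in> V" for v
    proof -
      have "V #> v = \<one>\<^bsub>G Mod V\<^esub>" using that quot_one_iff[OF V] normalD(2)[OF V] by blast
      then show ?thesis using generate.one[of "G Mod V" "{V #> t}"] by metis
    qed
    moreover have "V #> t \<in> generate (G Mod V) {V #> t}" by (rule generate.incl) simp
    ultimately show "(#>) V ` (V \<union> {t}) \<subseteq> generate (G Mod V) {V #> t}" by blast
  qed (use t in simp)
  finally have "fgs (G Mod V) ((#>) V ` U)"
    using t by (intro q.H.fgs_cyclic[of "V #> t"] q.subgroup_img_is_subgroup[OF U(1)]) simp_all
  moreover have "kernel G (G Mod V) ((#>) V) = V"
    using quot_one_iff[OF V] normalD(2)[OF V] by (auto simp: kernel_def)
  then have "fgs G (U \<inter> kernel G (G Mod V) ((#>) V))"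
    by (intro fV) (use subgroups_Inter_pair[OF U(1) normalD(1)[OF V]] in simp_all)
  ultimately show ?thesis by (rule q.fgs_extension[OF U(1)])
qed

lemma (in group) noeth_nilpotent:
  assumes S: "finite S" "S \<subseteq> carrier G" "generate G S = carrier G" and c: "lower_central G c = {\<one>}"
  shows "noeth G"
proof -
  let ?P = "\<lambda>V. \<forall>U. subgroup U G \<longrightarrow> U \<subseteq> V \<longrightarrow> fgs G U"
  have P1: "?P {\<one>}"
  proof (intro allI impI)
    fix U assume "subgroup U G" "U \<subseteq> {\<one>}"
    then have "U = {\<one>}" using subgroup.one_closed by blast
    then show "fgs G U" using fgs_trivial by simp
  qed
  have L: "?P (lower_central G 1)"
  proof (rule lc_induct[where P = ?P, OF S c P1])
    fix V j u s
    assume "V \<lhd> G" "u \<in> lower_central G j" "s \<in> carrier G" and P: "?P V"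
    then show "?P (generate G (V \<union> {com G u s}))"
      using noeth_step[OF \<open>V \<lhd> G\<close>, of "com G u s"] lc_closed com_closed by blast
  qed
  \<comment> \<open>Every subgroup above the derived subgroup is normal, so the generators of the
    group can be adjoined one at a time by the same step.\<close>
  let ?L = "lower_central G 1"
  have "?P (generate G (?L \<union> F))" if "finite F" "F \<subseteq> carrier G" for F
    using that
  proof (induction F)
    case empty
    have "generate G ?L = ?L"
      by (rule subset_antisym[OF generate_subgroup_incl[OF subset_refl normalD(1)[OF lc_normal]]])
        (rule subset_generate[OF subset_refl])
    then show ?case using L by simp
  next
    case (insert t F)
    let ?V = "generate G (?L \<union> F)"
    have subc: "?L \<union> F \<subseteq> carrier G" using insert.prems lc_closed by blast
    have V2: "?L \<subseteq> ?V" by (rule subset_generate) blast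
    have V: "?V \<lhd> G"
      using between_normal[OF generate_is_subgroup[OF subc], of 0] V2 generate_incl[OF subc] by simp
    have "?P (generate G (?V \<union> {t}))"
      using noeth_step[OF V, of t] insert by blast
    then show ?case using generate_idem_Un[OF subc, of "{t}"] insert.prems by simp
  qed
  from this[OF S(1,2)] have "?P (generate G (?L \<union> S))" .
  moreover have "generate G (?L \<union> S) = carrier G"
    using mono_generate[of S "?L \<union> S"] generate_incl[of "?L \<union> S"] S lc_closed by blast
  ultimately show ?thesis unfolding noeth_def using subgroup.subset is_group by metis
qed

lemma generate_monotone: "A \<subseteq> B \<Longrightarrow> generate G A \<subseteq> generate G B"
proof
  fix x assume "A \<subseteq> B" "x \<in> generate G A"
  from this(2,1) show "x \<in> generate G B"
    by (induction rule: generate.induct) (auto intro: generate.intros)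
qed

lemma noeth_generate_mono_chain:
  assumes "\<And>n. A n \<subseteq> A (Suc n)" "x \<in> generate G (\<Union>n. A n)"
  shows "\<exists>n. x \<in> generate G (A n)"
  using assms(2)
proof (induction rule: generate.induct)
  case one
  show ?case by (rule exI, rule generate.one)
next
  case (incl h)
  then obtain n where "h \<in> A n" by blast
  then show ?case by (intro exI[of _ n] generate.incl)
next
  case (inv h)
  then obtain n where "h \<in> A n" by blast
  then show ?case by (intro exI[of _ n] generate.inv)
next
  case (eng h1 h2)
  then obtain m n where mn: "h1 \<in> generate G (A m)" "h2 \<in> generate G (A n)" by blast
  have "A m \<subseteq> A (max m n)" "A n \<subseteq> A (max m n)"
    using lift_Suc_mono_le[of A, OF assms(1)] by simp_all
  then have "h1 \<in> generate G (A (max m n))" "h2 \<in> generate G (A (max m n))"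
    using mn generate_monotone by (metis subsetD)+
  then show ?case using generate.eng by metis
qed

lemma noeth_chain:
  assumes "noeth G" "\<And>n. subgroup (U n) G" "\<And>n. U n \<subseteq> U (Suc n)"
  shows "\<exists>n. \<forall>m\<ge>n. U m = U n"
proof -
  interpret group G using assms(1) noeth_def by blast
  have mono: "U m \<subseteq> U n" if "m \<le> n" for m n using lift_Suc_mono_le[of U, OF assms(3) that] .
  have "subgroup (generate G (\<Union>n. U n)) G"
    by (rule generate_is_subgroup) (use assms(2) subgroup.subset in blast)
  then obtain S where S: "finite S" "S \<subseteq> carrier G" "generate G S = generate G (\<Union>n. U n)"
    using assms(1) noeth_def fgs_def by metis
  have gU: "generate G (U n) = U n" for n
    by (rule subset_antisym[OF generate_subgroup_incl[OF subset_refl assms(2)] subset_generate[OF subset_refl]])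
  have "\<exists>n. x \<in> U n" if "x \<in> S" for x
  proof -
    have "x \<in> generate G (\<Union>n. U n)" using that S(3) subset_generate[of S S G] by blast
    from noeth_generate_mono_chain[of U, OF assms(3) this] show ?thesis using gU by simp
  qed
  then obtain f where f: "\<And>x. x \<in> S \<Longrightarrow> x \<in> U (f x)" by metis
  obtain n where n: "\<And>x. x \<in> S \<Longrightarrow> f x \<le> n"
    using finite_nat_set_iff_bounded_le[of "f ` S"] S(1) by blast
  have "S \<subseteq> U n" using f n mono by blast
  then have "generate G (\<Union>n. U n) \<subseteq> U n" using generate_subgroup_incl[OF _ assms(2)] S(3) by metis
  then have "U m \<subseteq> U n" for m using subset_generate[of "U m" "\<Union>n. U n" G] by blast
  then show ?thesis using mono by blast
qed

lemma (in group_hom) noeth_image: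
  assumes "noeth G" "h ` carrier G = carrier H" shows "noeth H"
  unfolding noeth_def
proof (intro conjI allI impI)
  show "group H" by (rule H.is_group)
  fix U assume U: "subgroup U H"
  let ?W = "{g \<in> carrier G. h g \<in> U}"
  have "subgroup ?W G"
  proof (rule G.subgroupI)
    show "?W \<noteq> {}" using subgroup.one_closed[OF U] by (intro ex_in_conv[THEN iffD1] exI[of _ "\<one>\<^bsub>G\<^esub>"]) simp
  qed (use U subgroup.m_closed[OF U] subgroup.m_inv_closed[OF U] in auto)
  then obtain S where S: "finite S" "S \<subseteq> carrier G" "generate G S = ?W"
    using assms(1) by (auto simp: noeth_def fgs_def)
  have "generate H (h ` S) = h ` ?W" using generate_img[OF S(2)] S(3) by simp
  also have "\<dots> = U"
  proof -
    have "U \<subseteq> h ` carrier G" using assms(2) subgroup.subset[OF U] by simp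
    then show ?thesis by blast
  qed
  finally show "fgs H U" unfolding fgs_def using S by (intro exI[of _ "h ` S"]) auto
qed

lemma noeth_subgroup:
  assumes "noeth G" "subgroup V G" shows "noeth (G\<lparr>carrier := V\<rparr>)"
proof -
  interpret group G using assms(1) noeth_def by blast
  have "fgs (G\<lparr>carrier := V\<rparr>) U" if "subgroup U (G\<lparr>carrier := V\<rparr>)" for U
  proof -
    have UV: "U \<subseteq> V" using subgroup.subset[OF that] by simp
    have "subgroup U G" using incl_subgroup[OF assms(2) that] .
    then obtain S where S: "finite S" "S \<subseteq> carrier G" "generate G S = U"
      using assms(1) by (auto simp: noeth_def fgs_def)
    then have "S \<subseteq> V" using UV subset_generate[of S S G] by blast
    then show ?thesis unfolding fgs_def using S generate_consistent[OF _ assms(2)]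
      by (intro exI[of _ S]) simp
  qed
  then show ?thesis unfolding noeth_def using subgroup_imp_group[OF assms(2)] by blast
qed

text \<open>The maps \<open>ev j\<close> jointly embed \<open>A\<close> into a power of
  \<open>B\<close>. The induction removes one coordinate at a time, passing to the image and the
  kernel of the last one.\<close>

lemma noeth_separated:
  fixes s :: nat
  assumes A: "group A" and B: "noeth B" and ev: "\<And>j. j < s \<Longrightarrow> group_hom A B (ev j)"
    and sep: "\<And>x. x \<in> carrier A \<Longrightarrow> (\<And>j. j < s \<Longrightarrow> ev j x = \<one>\<^bsub>B\<^esub>) \<Longrightarrow> x = \<one>\<^bsub>A\<^esub>"
  shows "noeth A"
proof -
  have *: "fgs A U" if "subgroup U A" "n \<le> s"
    "\<And>x. x \<in> U \<Longrightarrow> (\<And>j. j < n \<Longrightarrow> ev j x = \<one>\<^bsub>B\<^esub>) \<Longrightarrow> x = \<one>\<^bsub>A\<^esub>" for U n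
    using that
  proof (induction n arbitrary: U)
    case 0
    then have "U = {\<one>\<^bsub>A\<^esub>}" using subgroup.one_closed by fastforce
    then show ?case using group.fgs_trivial[OF A] by simp
  next
    case (Suc n)
    interpret group_hom A B "ev n" using ev Suc by simp
    have "fgs A (U \<inter> kernel A B (ev n))"
    proof (rule Suc.IH)
      show "subgroup (U \<inter> kernel A B (ev n)) A"
        using G.subgroups_Inter_pair[OF Suc.prems(1) subgroup_kernel] .
      show "n \<le> s" using Suc by simp
      fix x assume x: "x \<in> U \<inter> kernel A B (ev n)" and j: "\<And>j. j < n \<Longrightarrow> ev j x = \<one>\<^bsub>B\<^esub>"
      have "ev j x = \<one>\<^bsub>B\<^esub>" if "j < Suc n" for j
        using that j x by (cases "j = n") (auto simp: kernel_def)
      then show "x = \<one>\<^bsub>A\<^esub>" using Suc.prems(3) x by blast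
    qed
    moreover have "fgs B (ev n ` U)"
      using subgroup_img_is_subgroup[OF Suc.prems(1)] B by (simp add: noeth_def)
    ultimately show ?case using fgs_extension[OF Suc.prems(1)] by blast
  qed
  show ?thesis unfolding noeth_def
  proof (intro conjI A allI impI)
    fix U assume U: "subgroup U A"
    show "fgs A U" by (rule *[OF U le_refl]) (use sep subgroup.subset[OF U] in blast)
  qed
qed

text \<open>The kernels of the iterates of \<open>f\<close> ascend, so ker f^n = ker f^(n+1) for
  some n. By surjectivity an element killed by \<open>f\<close> is f^n y for some y; this y lies in
  ker f^(n+1), hence in ker f^n, and the element is trivial.\<close>

lemma hopfian:
  assumes G: "noeth G" and f: "f \<in> hom G G" and surj: "f ` carrier G = carrier G"
  shows "inj_on f (carrier G)"
proof -
  interpret group G using G noeth_def by blast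
  have hom: "(f ^^ n) \<in> hom G G" for n
  proof (induction n)
    case 0
    show ?case by (simp add: hom_def)
  next
    case (Suc n)
    show ?case using Group.hom_compose[OF Suc f] by (simp add: comp_def)
  qed
  then have gh: "group_hom G G (f ^^ n)" for n
    by (simp add: group_hom_def group_hom_axioms_def is_group)
  have surjn: "(f ^^ n) ` carrier G = carrier G" for n
  proof (induction n)
    case (Suc n)
    have "(f ^^ Suc n) ` carrier G = f ` ((f ^^ n) ` carrier G)" by (simp add: image_comp comp_def)
    then show ?case using Suc surj by simp
  qed simp
  have "kernel G G (f ^^ n) \<subseteq> kernel G G (f ^^ Suc n)" for n
    using hom_one[OF f is_group is_group] by (auto simp: kernel_def)
  from noeth_chain[of G "\<lambda>n. kernel G G (f ^^ n)", OF G group_hom.subgroup_kernel[OF gh] this]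
  obtain n where n: "\<forall>m\<ge>n. kernel G G (f ^^ m) = kernel G G (f ^^ n)" by blast
  have triv: "x = \<one>\<^bsub>G\<^esub>" if x: "x \<in> carrier G" "f x = \<one>\<^bsub>G\<^esub>" for x
  proof -
    obtain y where y: "y \<in> carrier G" "x = (f ^^ n) y" using surjn[of n] x(1) by blast
    then have "y \<in> kernel G G (f ^^ Suc n)" using x(2) unfolding y(2) by (simp add: kernel_def)
    then have "y \<in> kernel G G (f ^^ n)" using n[rule_format, of "Suc n"] by (simp only: le_SucI[OF le_refl])
    then show ?thesis unfolding y(2) by (simp add: kernel_def)
  qed
  interpret f: group_hom G G f using f by (simp add: group_hom_def group_hom_axioms_def is_group)
  show ?thesis using f.inj_on_one_iff triv by blast
qed

section \<open>Products of powers, bounded exponents and commutator width\<close>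

lemma lprod_cong: "(\<And>i. i < d \<Longrightarrow> x i = y i) \<Longrightarrow> lprod G x d = lprod G y d"
  by (induction d) simp_all

lemma (in monoid) lprod_closed: "(\<And>i. i < d \<Longrightarrow> x i \<in> carrier G) \<Longrightarrow> lprod G x d \<in> carrier G"
  by (induction d) simp_all

lemma (in group) lprod_in_subgroup:
  assumes "subgroup U G" "\<And>i. i < d \<Longrightarrow> x i \<in> U" shows "lprod G x d \<in> U"
  using assms(2) by (induction d) (simp_all add: subgroup.one_closed[OF assms(1)] subgroup.m_closed[OF assms(1)])

lemma (in group_hom) hom_lprod:
  "(\<And>i. i < d \<Longrightarrow> x i \<in> carrier G) \<Longrightarrow> h (lprod G x d) = lprod H (\<lambda>i. h (x i)) d"
  by (induction d) (simp_all add: G.lprod_closed)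

lemma (in monoid) lprod_one: "lprod G (\<lambda>i. \<one>) d = \<one>"
  by (induction d) simp_all

lemma (in monoid) lprod_single:
  assumes "x \<in> carrier G" "l < d" shows "lprod G (\<lambda>i. if i = l then x else \<one>) d = x"
  using assms(2)
proof (induction d)
  case (Suc d)
  show ?case
  proof (cases "l = d")
    case True
    have "lprod G (\<lambda>i. if i = l then x else \<one>) d = lprod G (\<lambda>i. \<one>) d"
      by (rule lprod_cong) (use True in simp)
    then show ?thesis using assms True by (simp add: lprod_one)
  qed (use Suc assms in simp)
qed simp

context comm_group
begin

lemma lprod_mult:
  "(\<And>i. i < d \<Longrightarrow> x i \<in> carrier G) \<Longrightarrow> (\<And>i. i < d \<Longrightarrow> y i \<in> carrier G) \<Longrightarrow>
   lprod G (\<lambda>i. x i \<otimes> y i) d = lprod G x d \<otimes> lprod G y d"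
  by (induction d) (simp_all add: lprod_closed m_ac)

lemma lprod_inv:
  "(\<And>i. i < d \<Longrightarrow> x i \<in> carrier G) \<Longrightarrow> lprod G (\<lambda>i. inv (x i)) d = inv (lprod G x d)"
  by (induction d) (simp_all add: lprod_closed inv_mult)

lemma lprod_nat_pow:
  "(\<And>i. i < d \<Longrightarrow> x i \<in> carrier G) \<Longrightarrow> lprod G (\<lambda>i. x i [^] (n::nat)) d = lprod G x d [^] n"
  by (induction d) (simp_all add: lprod_closed nat_pow_distrib)

lemma generate_lprod:
  fixes d :: nat
  assumes x: "\<And>i. i < d \<Longrightarrow> x i \<in> carrier G" and g: "g \<in> generate G (x ` {..<d})"
  shows "\<exists>e :: nat \<Rightarrow> int. g = lprod G (\<lambda>i. x i [^] e i) d"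
  using g
proof (induction rule: generate.induct)
  case one
  show ?case by (intro exI[of _ "\<lambda>_. 0"]) (simp add: lprod_one)
next
  case (incl h)
  then obtain l where l: "l < d" "h = x l" by blast
  have "lprod G (\<lambda>i. x i [^] (if i = l then 1 else 0 :: int)) d = lprod G (\<lambda>i. if i = l then x l else \<one>) d"
    by (rule lprod_cong) (use x in simp)
  then show ?case using lprod_single[of "x l" l d] x l by metis
next
  case (inv h)
  then obtain l where l: "l < d" "h = x l" by blast
  have "lprod G (\<lambda>i. x i [^] (if i = l then - 1 else 0 :: int)) d = lprod G (\<lambda>i. if i = l then inv (x l) else \<one>) d"
    by (rule lprod_cong) (use x int_pow_neg[of _ 1] in simp)
  then show ?case using lprod_single[of "inv (x l)" l d] x l inv_closed by metis
next
  case (eng h1 h2)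
  then obtain e f :: "nat \<Rightarrow> int" where ef: "h1 = lprod G (\<lambda>i. x i [^] e i) d" "h2 = lprod G (\<lambda>i. x i [^] f i) d"
    by blast
  have "lprod G (\<lambda>i. x i [^] (e i + f i)) d = lprod G (\<lambda>i. x i [^] e i \<otimes> x i [^] f i) d"
    by (rule lprod_cong) (use x in \<open>simp add: int_pow_mult\<close>)
  then have "h1 \<otimes> h2 = lprod G (\<lambda>i. x i [^] (e i + f i)) d"
    using x by (simp add: ef lprod_mult)
  then show ?case by (rule exI[of _ "\<lambda>i. e i + f i"])
qed

lemma lprod_in_generate:
  fixes d :: nat and e :: "nat \<Rightarrow> int"
  assumes x: "\<And>i. i < d \<Longrightarrow> x i \<in> carrier G"
  shows "lprod G (\<lambda>i. x i [^] e i) d \<in> generate G (x ` {..<d})"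
proof -
  have s: "subgroup (generate G (x ` {..<d})) G" by (rule generate_is_subgroup) (use x in blast)
  have "x i [^] e i \<in> generate G (x ` {..<d})" if "i < d" for i
    by (rule subgroup_int_pow_closed[OF s]) (use that in \<open>auto intro: generate.incl\<close>)
  then show ?thesis by (rule lprod_in_subgroup[OF s])
qed

end

text \<open>Exponent vectors reduced modulo \<open>n\<close>. Setting them to zero from
  \<open>d\<close> on makes the set finite, so it can index a disjunction in a formula.\<close>

definition digits :: "nat \<Rightarrow> nat \<Rightarrow> (nat \<Rightarrow> nat) set" where
  "digits d n = {r. (\<forall>l<d. r l < n) \<and> (\<forall>l\<ge>d. r l = 0)}"

lemma finite_digits: "finite (digits d n)"
proof -
  have "digits d n = {f. \<forall>x. (x \<in> {..<d} \<longrightarrow> f x \<in> {..<n}) \<and> (x \<notin> {..<d} \<longrightarrow> f x = 0)}"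
    unfolding digits_def by (rule Collect_cong) (simp add: all_conj_distrib not_less)
  then show ?thesis using finite_set_of_finite_funs[of "{..<d}" "{..<n}" 0] by simp
qed

lemma (in comm_group) lprod_digits:
  fixes d n :: nat and e :: "nat \<Rightarrow> int"
  assumes x: "\<And>i. i < d \<Longrightarrow> x i \<in> carrier G" and n: "0 < n"
  shows "\<exists>r \<in> digits d n. \<exists>q :: nat \<Rightarrow> int.
    lprod G (\<lambda>i. x i [^] e i) d = lprod G (\<lambda>i. x i [^] r i) d \<otimes> lprod G (\<lambda>i. x i [^] q i) d [^] n"
proof -
  define r where "r i = (if i < d then nat (e i mod int n) else 0)" for i
  define q where "q i = e i div int n" for i
  have "r \<in> digits d n" using n by (simp add: digits_def r_def nat_less_iff)
  moreover have "lprod G (\<lambda>i. x i [^] e i) d = lprod G (\<lambda>i. x i [^] r i \<otimes> (x i [^] q i) [^] n) d"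
  proof (rule lprod_cong)
    fix i assume i: "i < d"
    have "int (r i) = e i mod int n" using i n by (simp add: r_def)
    then have "e i = int (r i) + q i * int n" using mod_div_mult_eq[of "e i" "int n"] by (simp only: q_def)
    then have "x i [^] e i = x i [^] int (r i) \<otimes> x i [^] (q i * int n)"
      using int_pow_mult[OF x[OF i], of "int (r i)" "q i * int n"] by metis
    also have "x i [^] int (r i) = x i [^] r i" by (rule int_pow_int)
    also have "x i [^] (q i * int n) = (x i [^] q i) [^] n"
      by (simp only: int_pow_pow[OF x[OF i], symmetric] int_pow_int)
    finally show "x i [^] e i = x i [^] r i \<otimes> (x i [^] q i) [^] n" .
  qed
  moreover have "\<dots> = lprod G (\<lambda>i. x i [^] r i) d \<otimes> lprod G (\<lambda>i. x i [^] q i) d [^] n"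
    using x by (subst lprod_mult) (simp_all add: lprod_nat_pow)
  ultimately show ?thesis by metis
qed

definition comprods :: "('a, 'b) monoid_scheme \<Rightarrow> nat \<Rightarrow> 'a set" where
  "comprods G m = {g. \<exists>x \<in> tup G m. \<exists>y \<in> tup G m. g = lprod G (\<lambda>j. com G (x j) (y j)) m}"

lemma (in group) comprods_Suc:
  assumes "g \<in> comprods G m" "a \<in> carrier G" "b \<in> carrier G"
  shows "g \<otimes> com G a b \<in> comprods G (Suc m)"
proof -
  obtain x y where xy: "x \<in> tup G m" "y \<in> tup G m" "g = lprod G (\<lambda>j. com G (x j) (y j)) m"
    using assms(1) by (auto simp: comprods_def)
  have "lprod G (\<lambda>j. com G ((x(m := a)) j) ((y(m := b)) j)) m = g"
    unfolding xy(3) by (rule lprod_cong) simp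
  then have "g \<otimes> com G a b = lprod G (\<lambda>j. com G ((x(m := a)) j) ((y(m := b)) j)) (Suc m)" by simp
  moreover have "x(m := a) \<in> tup G (Suc m)" "y(m := b) \<in> tup G (Suc m)"
    using xy assms by (auto simp: tup_def)
  ultimately show ?thesis unfolding comprods_def by blast
qed

lemma (in group) derived_eq_lc: "derived G (carrier G) = lower_central G 1"
proof -
  have "(\<Union>a \<in> carrier G. \<Union>b \<in> carrier G. {a \<otimes> b \<otimes> inv a \<otimes> inv b}) =
    {a \<otimes> b \<otimes> inv a \<otimes> inv b |a b. a \<in> carrier G \<and> b \<in> carrier G}" by blast
  then show ?thesis by (simp add: derived_def comm_subgroup_def)
qed

text \<open>Modulo \<open>V\<close>, x \<mapsto> [x, s] is a homomorphism on the j-th lower central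
  term, so [u, s]^k is congruent to the single commutator [u^k, s]. Adjoining [u, s] to
  \<open>V\<close> thus costs one further commutator, whatever the exponent.\<close>

lemma (in group) derived_width:
  assumes S: "finite S" "S \<subseteq> carrier G" "generate G S = carrier G" and c: "lower_central G c = {\<one>}"
  shows "\<exists>m. derived G (carrier G) \<subseteq> comprods G m"
  unfolding derived_eq_lc
proof (rule lc_induct[where P = "\<lambda>V. \<exists>m. V \<subseteq> comprods G m", OF S c])
  have "(\<lambda>_. \<one>) \<in> tup G 0" by (simp add: tup_def)
  then have "\<one> \<in> comprods G 0" unfolding comprods_def by auto
  then show "\<exists>m. {\<one>} \<subseteq> comprods G m" by blast
next
  fix V j u s
  assume V: "V \<lhd> G" and LV: "lower_central G (Suc (Suc j)) \<subseteq> V" "V \<subseteq> lower_central G (Suc j)"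
    and u: "u \<in> lower_central G j" and s: "s \<in> carrier G" and P: "\<exists>m. V \<subseteq> comprods G m"
  let ?t = "com G u s"
  interpret q: group_hom G "G Mod V" "(#>) V" by (rule normal.quot_hom[OF V])
  have uc: "u \<in> carrier G" and tc: "?t \<in> carrier G" using u s lc_closed by simp_all
  note Ls = normalD(1)[OF lc_normal]
  let ?L = "G\<lparr>carrier := lower_central G j\<rparr>"
  have L: "group ?L" by (rule subgroup_imp_group[OF Ls])
  have fhom: "(\<lambda>x. V #> com G x s) \<in> hom ?L (G Mod V)"
  proof (rule homI)
    fix x assume "x \<in> carrier ?L"
    then show "V #> com G x s \<in> carrier (G Mod V)" using s lc_closed q.hom_closed by simp
  next
    fix x y assume xy: "x \<in> carrier ?L" "y \<in> carrier ?L"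
    then have c: "x \<in> carrier G" "y \<in> carrier G" using lc_closed by simp_all
    let ?c = "com G y s" and ?d = "com G x s"
    have cd: "?c \<in> lower_central G (Suc j)" "?c \<in> carrier G" "?d \<in> carrier G"
      using xy s c lc_com by (simp_all del: lower_central.simps)
    have tr: "V #> (a \<otimes> b) = V #> b" if "a \<in> V" "b \<in> carrier G" for a b
      using that normalD(2)[OF V] by (subst coset_eq_iff[OF V]) (auto simp: m_assoc)
    \<comment> \<open>With c = [y, s] and d = [x, s] one has [xy, s] = [x, c] c d. Both [x, c] and
      [c, d] lie in the lower central term of index j + 2, which \<open>V\<close> contains; the
      first drops out and the second lets c and d be swapped.\<close>
    have "com G (x \<otimes> y) s = com G x ?c \<otimes> (?c \<otimes> ?d)"
      using com_mult_left[OF c s] conj_eq_com[OF cd(2) c(1)] m_assoc[OF com_closed[OF c(1) cd(2)] cd(2,3)] by simp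
    moreover have "com G x ?c \<in> V" using lc_com'[OF cd(1) c(1)] LV by blast
    ultimately have "V #> com G (x \<otimes> y) s = V #> (?c \<otimes> ?d)" using tr cd by simp
    also have "?c \<otimes> ?d = com G ?c ?d \<otimes> (?d \<otimes> ?c)" using cd by (simp add: com_def gsimps)
    also have "V #> \<dots> = V #> (?d \<otimes> ?c)"
      using tr[of "com G ?c ?d" "?d \<otimes> ?c"] lc_com[OF cd(1,3)] LV cd by blast
    also have "\<dots> = (V #> ?d) \<otimes>\<^bsub>G Mod V\<^esub> (V #> ?c)" using cd by simp
    finally show "V #> com G (x \<otimes>\<^bsub>?L\<^esub> y) s = (V #> ?d) \<otimes>\<^bsub>G Mod V\<^esub> (V #> ?c)" by simp
  qed
  obtain m where m: "V \<subseteq> comprods G m" using P by blast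
  have "generate G (V \<union> {?t}) \<subseteq> comprods G (Suc m)"
  proof
    fix x assume x: "x \<in> generate G (V \<union> {?t})"
    have Vt: "V \<union> {?t} \<subseteq> carrier G" using normalD(2)[OF V] tc by blast
    have xc: "x \<in> carrier G" using generate_in_carrier[OF Vt x] .
    have "V #> x \<in> generate (G Mod V) ((#>) V ` (V \<union> {?t}))" using q.generate_img[OF Vt] x by blast
    also have "\<dots> \<subseteq> generate (G Mod V) {V #> ?t}"
    proof (rule q.H.generate_subgroup_incl[OF _ q.H.generate_is_subgroup])
      have "V #> v \<in> generate (G Mod V) {V #> ?t}" if "v \<in> V" for v
      proof -
        have "V #> v = \<one>\<^bsub>G Mod V\<^esub>" using that quot_one_iff[OF V] normalD(2)[OF V] by blast
        then show ?thesis using generate.one[of "G Mod V" "{V #> ?t}"] by metis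
      qed
      moreover have "V #> ?t \<in> generate (G Mod V) {V #> ?t}" by (rule generate.incl) simp
      ultimately show "(#>) V ` (V \<union> {?t}) \<subseteq> generate (G Mod V) {V #> ?t}" by blast
    qed (use q.hom_closed[OF tc] in blast)
    finally obtain k :: int where k: "V #> x = (V #> ?t) [^]\<^bsub>G Mod V\<^esub> k"
      using q.H.generate_pow[OF q.hom_closed[OF tc]] by blast
    have "V #> com G (u [^]\<^bsub>?L\<^esub> k) s = (V #> ?t) [^]\<^bsub>G Mod V\<^esub> k"
      using hom_int_pow[OF fhom _ L q.H.is_group, of u k] u by simp
    moreover have "u [^]\<^bsub>?L\<^esub> k = u [^] k" using int_pow_consistent[OF Ls u] by simp
    ultimately have eq: "V #> x = V #> com G (u [^] k) s" using k by simp
    have uk: "u [^] k \<in> carrier G" using uc by simp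
    have "x \<otimes> inv (com G (u [^] k) s) \<in> V"
      using eq coset_eq_iff[OF V xc com_closed[OF uk s]] by simp
    then have "x \<otimes> inv (com G (u [^] k) s) \<otimes> com G (u [^] k) s \<in> comprods G (Suc m)"
      using comprods_Suc[OF _ uk s] m by blast
    then show "x \<in> comprods G (Suc m)" using xc com_closed[OF uk s] by (simp add: m_assoc)
  qed
  then show "\<exists>m. generate G (V \<union> {?t}) \<subseteq> comprods G m" by blast
qed

lemma (in comm_group) generate_insert_subgroup:
  assumes S: "subgroup S G" and g: "g \<in> carrier G" and x: "x \<in> generate G (S \<union> {g})"
  shows "\<exists>s \<in> S. \<exists>e::int. x = s \<otimes> g [^] e"
  using x
proof (induction rule: generate.induct)
  case one
  show ?case using subgroup.one_closed[OF S] by (intro bexI[of _ \<one>] exI[of _ 0]) simp_all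
next
  case (incl h)
  then show ?case
  proof
    assume "h \<in> S"
    then show ?thesis using subgroup.mem_carrier[OF S] by (intro bexI[of _ h] exI[of _ 0]) simp_all
  next
    assume "h \<in> {g}"
    then show ?thesis using g subgroup.one_closed[OF S] by (intro bexI[of _ \<one>] exI[of _ 1]) simp_all
  qed
next
  case (inv h)
  then show ?case
  proof
    assume "h \<in> S"
    then show ?thesis using subgroup.mem_carrier[OF S] subgroup.m_inv_closed[OF S]
      by (intro bexI[of _ "inv h"] exI[of _ 0]) simp_all
  next
    assume "h \<in> {g}"
    then show ?thesis using g subgroup.one_closed[OF S]
      by (intro bexI[of _ \<one>] exI[of _ "- 1"]) (simp_all add: int_pow_neg)
  qed
next
  case (eng h1 h2)
  then obtain s e t f where st: "s \<in> S" "h1 = s \<otimes> g [^] (e::int)" "t \<in> S" "h2 = t \<otimes> g [^] (f::int)" by blast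
  then have "s \<in> carrier G" "t \<in> carrier G" using subgroup.mem_carrier[OF S] by blast+
  then have "h1 \<otimes> h2 = (s \<otimes> t) \<otimes> g [^] (e + f)" using g st by (simp add: int_pow_mult m_ac)
  then show ?case using subgroup.m_closed[OF S st(1,3)] by blast
qed

text \<open>Modulo \<open>S\<close> the group is finitely generated and divisible, hence trivial.
  Generators are removed one by one: g = s u^2 and u = s' g^e put g^(1 - 2e) into the subgroup
  spanned by the rest, with an odd and so nonzero exponent; divisibility by the absolute value of
  that exponent then brings every element into this subgroup.\<close>

lemma (in comm_group) fin_gen_divisible:
  assumes "finite T" "T \<subseteq> carrier G" "subgroup S G" "generate G (S \<union> T) = carrier G"
    and div: "\<And>t r. 0 < (t::nat) \<Longrightarrow> r \<in> carrier G \<Longrightarrow> \<exists>s \<in> S. \<exists>u \<in> carrier G. r = s \<otimes> u [^] t"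
  shows "S = carrier G"
  using assms(1,2,4)
proof (induction T)
  case empty
  then show ?case using generate_subgroup_incl[OF subset_refl assms(3)] subgroup.subset[OF assms(3)] by auto
next
  case (insert g T)
  let ?S = "generate G (S \<union> T)"
  have g: "g \<in> carrier G" and T: "T \<subseteq> carrier G" using insert.prems by auto
  have ST: "S \<union> T \<subseteq> carrier G" using T subgroup.subset[OF assms(3)] by blast
  have S': "subgroup ?S G" using generate_is_subgroup[OF ST] .
  have SS: "S \<subseteq> ?S" by (rule subset_generate) blast
  have "generate G (?S \<union> {g}) = carrier G"
    using generate_idem_Un[OF ST, of "{g}"] g insert.prems by simp
  then have rep: "\<exists>s \<in> ?S. \<exists>e::int. x = s \<otimes> g [^] e" if "x \<in> carrier G" for x
    using generate_insert_subgroup[OF S' g] that by blast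
  obtain s u where su: "s \<in> S" "u \<in> carrier G" "g = s \<otimes> u [^] (2::nat)" using div[of 2 g] g by auto
  obtain s' e where s': "s' \<in> ?S" "u = s' \<otimes> g [^] (e::int)" using rep[OF su(2)] by blast
  have c: "s \<in> carrier G" "s' \<in> carrier G" using su s' subgroup.mem_carrier[OF S'] SS by blast+
  define k where "k = 1 - 2 * e"
  have "g = s \<otimes> (s' \<otimes> s') \<otimes> g [^] (2 * e)"
  proof -
    have "g [^] (2 * e) = g [^] e \<otimes> g [^] e" using int_pow_mult[OF g, of e e] by simp
    then have "s \<otimes> u [^] (2::nat) = s \<otimes> (s' \<otimes> s') \<otimes> g [^] (2 * e)"
      unfolding s'(2) using c g by (simp add: numeral_2_eq_2 m_ac)
    then show ?thesis using su(3) by (rule trans[rotated])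
  qed
  then have "g [^] k = s \<otimes> (s' \<otimes> s')"
    using int_pow_diff[OF g, of 1 "2 * e"] c g
    by (metis int_pow_1 int_pow_closed inv_solve_right m_closed k_def)
  then have gk: "g [^] k \<in> ?S" using subgroup.m_closed[OF S'] s' su(1) SS by (metis subsetD)
  define t where "t = nat \<bar>k\<bar>"
  have k0: "k \<noteq> 0" unfolding k_def by presburger
  have t: "0 < t" using k0 by (simp add: t_def)
  have gt: "g [^] t \<in> ?S"
  proof (cases "k > 0")
    case True
    then have "g [^] t = g [^] k" using int_pow_int[of G g t] by (simp add: t_def)
    then show ?thesis using gk by simp
  next
    case False
    then have "g [^] t = g [^] (- k)" using int_pow_int[of G g t] by (simp add: t_def)
    then show ?thesis using subgroup.m_inv_closed[OF S' gk] g by (simp add: int_pow_neg)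
  qed
  have "r \<in> ?S" if r: "r \<in> carrier G" for r
  proof -
    obtain s u where su: "s \<in> S" "u \<in> carrier G" "r = s \<otimes> u [^] t" using div[OF t r] by blast
    obtain s' e where s': "s' \<in> ?S" "u = s' \<otimes> g [^] (e::int)" using rep[OF su(2)] by blast
    have c: "s' \<in> carrier G" using s' subgroup.mem_carrier[OF S'] by blast
    have "(g [^] e) [^] t = (g [^] t) [^] e"
      using g by (metis int_pow_int int_pow_pow mult.commute)
    then have "u [^] t = s' [^] t \<otimes> (g [^] t) [^] e"
      using s' c g by (simp add: nat_pow_distrib)
    moreover have "s' [^] t \<in> ?S"
      using subgroup_int_pow_closed[OF S' s'(1), of "int t"] by (simp add: int_pow_int)
    moreover have "(g [^] t) [^] e \<in> ?S" using subgroup_int_pow_closed[OF S' gt] .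
    ultimately show ?thesis using su SS subgroup.m_closed[OF S'] by (metis subsetD)
  qed
  then have "generate G (S \<union> T) = carrier G" using subgroup.subset[OF S'] by blast
  then show ?case using insert.IH T by blast
qed

section \<open>Rings with finitely generated additive group\<close>

text \<open>\<open>hp R [c\<^sub>0, \<dots>, c\<^sub>n\<^sub>-\<^sub>1]\<close> is the monic polynomial of degree \<open>n\<close> with lower coefficients \<open>c\<^sub>i\<close>.\<close>

primrec hp :: "('a, 'b) ring_scheme \<Rightarrow> 'a list \<Rightarrow> 'a \<Rightarrow> 'a" where
  "hp R [] x = \<one>\<^bsub>R\<^esub>"
| "hp R (c # cs) x = c \<oplus>\<^bsub>R\<^esub> x \<otimes>\<^bsub>R\<^esub> hp R cs x"

definition rad :: "('a, 'b) ring_scheme \<Rightarrow> 'a set \<Rightarrow> 'a set" where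
  "rad R I = {x \<in> carrier R. \<exists>k::nat. x [^]\<^bsub>R\<^esub> k \<in> I}"

context cring
begin

lemma hp_closed [simp]: "set cs \<subseteq> carrier R \<Longrightarrow> x \<in> carrier R \<Longrightarrow> hp R cs x \<in> carrier R"
  by (induction cs) simp_all

text \<open>Adding a multiple of a polynomial of lower degree keeps a monic polynomial monic; this
  keeps the cofactor in \<open>hp_factor\<close> within the monic form of \<open>hp\<close>.\<close>

lemma hp_add_smult:
  assumes "set cs \<subseteq> carrier R" "set ds \<subseteq> carrier R" "length ds < length cs" "s \<in> carrier R"
  shows "\<exists>es. set es \<subseteq> carrier R \<and> length es = length cs \<and>
    (\<forall>x \<in> carrier R. hp R cs x \<oplus> s \<otimes> hp R ds x = hp R es x)"
  using assms
proof (induction cs arbitrary: ds)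
  case (Cons c cs)
  have c: "c \<in> carrier R" "set cs \<subseteq> carrier R" using Cons.prems by simp_all
  show ?case
  proof (cases ds)
    case Nil
    have "hp R (c # cs) x \<oplus> s \<otimes> hp R ds x = hp R ((c \<oplus> s) # cs) x" if "x \<in> carrier R" for x
      using that c Cons.prems(4) by (simp add: Nil a_ac)
    then show ?thesis using c Cons.prems(4) by (intro exI[of _ "(c \<oplus> s) # cs"]) simp
  next
    case ds: (Cons e ds')
    have e: "e \<in> carrier R" "set ds' \<subseteq> carrier R" "length ds' < length cs" using Cons.prems ds by simp_all
    obtain es where es: "set es \<subseteq> carrier R" "length es = length cs"
      "\<forall>x \<in> carrier R. hp R cs x \<oplus> s \<otimes> hp R ds' x = hp R es x"
      using Cons.IH[OF c(2) e(2,3) Cons.prems(4)] by blast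
    have "hp R (c # cs) x \<oplus> s \<otimes> hp R ds x = hp R ((c \<oplus> s \<otimes> e) # es) x" if x: "x \<in> carrier R" for x
    proof -
      have "hp R ((c \<oplus> s \<otimes> e) # es) x = (c \<oplus> s \<otimes> e) \<oplus> x \<otimes> (hp R cs x \<oplus> s \<otimes> hp R ds' x)"
        using es(3) x by simp
      also have "\<dots> = hp R (c # cs) x \<oplus> s \<otimes> hp R ds x"
        using x c e Cons.prems(4) hp_closed[OF c(2) x] hp_closed[OF e(2) x] unfolding ds hp.simps by algebra
      finally show ?thesis by simp
    qed
    then show ?thesis using c e es Cons.prems(4) by (intro exI[of _ "(c \<oplus> s \<otimes> e) # es"]) simp
  qed
qed simp

text \<open>For f = c + x h one has f(x) - f(s) = (x - s) h(x) + s (h(x) - h(s)), so the cofactor of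
  f is h plus s times the cofactor of h. It is again monic, of degree one less.\<close>

lemma hp_factor:
  assumes "set cs \<subseteq> carrier R" "cs \<noteq> []" "s \<in> carrier R"
  shows "\<exists>ds. set ds \<subseteq> carrier R \<and> Suc (length ds) = length cs \<and>
    (\<forall>x \<in> carrier R. hp R cs x \<ominus> hp R cs s = (x \<ominus> s) \<otimes> hp R ds x)"
  using assms
proof (induction cs)
  case (Cons c cs)
  have c: "c \<in> carrier R" "set cs \<subseteq> carrier R" using Cons.prems by simp_all
  show ?case
  proof (cases "cs = []")
    case True
    have "hp R (c # cs) x \<ominus> hp R (c # cs) s = (x \<ominus> s) \<otimes> hp R [] x" if "x \<in> carrier R" for x
      using that c Cons.prems(3) unfolding True hp.simps by algebra
    then show ?thesis using True by (intro exI[of _ "[]"]) simp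
  next
    case False
    obtain ds where ds: "set ds \<subseteq> carrier R" "Suc (length ds) = length cs"
      "\<forall>x \<in> carrier R. hp R cs x \<ominus> hp R cs s = (x \<ominus> s) \<otimes> hp R ds x"
      using Cons.IH[OF c(2) False Cons.prems(3)] by blast
    obtain es where es: "set es \<subseteq> carrier R" "length es = length cs"
      "\<forall>x \<in> carrier R. hp R cs x \<oplus> s \<otimes> hp R ds x = hp R es x"
      using hp_add_smult[OF c(2) ds(1) _ Cons.prems(3)] ds(2) by (metis lessI)
    have "hp R (c # cs) x \<ominus> hp R (c # cs) s = (x \<ominus> s) \<otimes> hp R es x" if x: "x \<in> carrier R" for x
    proof -
      have cl: "hp R cs x \<in> carrier R" "hp R cs s \<in> carrier R" "hp R ds x \<in> carrier R" "s \<in> carrier R"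
        using x c ds Cons.prems(3) by simp_all
      have "hp R (c # cs) x \<ominus> hp R (c # cs) s = (x \<ominus> s) \<otimes> hp R cs x \<oplus> s \<otimes> (hp R cs x \<ominus> hp R cs s)"
        using x c cl unfolding hp.simps by algebra
      also have "\<dots> = (x \<ominus> s) \<otimes> hp R cs x \<oplus> s \<otimes> ((x \<ominus> s) \<otimes> hp R ds x)" using ds(3) x by simp
      also have "\<dots> = (x \<ominus> s) \<otimes> (hp R cs x \<oplus> s \<otimes> hp R ds x)" using x cl by algebra
      finally show ?thesis using es(3) x by simp
    qed
    then show ?thesis using es by (intro exI[of _ es]) simp
  qed
qed simp

text \<open>One root \<open>s m\<close> is fixed and divided out: modulo the prime, every other root
  agrees with \<open>s m\<close> or is a root of the cofactor. One alternative has infinitely many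
  indices, and in the second the degree has dropped. Degree zero is impossible, as it would put one
  into \<open>I\<close>.\<close>

lemma pigeonhole_prime:
  assumes I: "primeideal I R" and "infinite J" "\<And>n. n \<in> J \<Longrightarrow> s n \<in> carrier R"
    "set cs \<subseteq> carrier R" "\<And>n. n \<in> J \<Longrightarrow> hp R cs (s n) \<in> I"
  shows "\<exists>J'\<subseteq>J. infinite (J'::nat set) \<and> (\<forall>m \<in> J'. \<forall>n \<in> J'. s m \<ominus> s n \<in> I)"
  using assms(2-)
proof (induction "length cs" arbitrary: cs J)
  case 0
  interpret I: primeideal I R by fact
  obtain n where "n \<in> J" using 0(2) by (metis ex_in_conv finite.emptyI)
  then have "\<one> \<in> I" using 0(5)[of n] 0(1) by simp
  then show ?case using I.one_imp_carrier I.I_notcarr by simp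
next
  case (Suc q)
  interpret I: primeideal I R by fact
  obtain m where m: "m \<in> J" using Suc.prems(1) by (metis ex_in_conv finite.emptyI)
  have sm: "s m \<in> carrier R" using m Suc.prems by blast
  have "cs \<noteq> []" using Suc.hyps(2) by auto
  then obtain ds where ds: "set ds \<subseteq> carrier R" "Suc (length ds) = length cs"
    "\<forall>x \<in> carrier R. hp R cs x \<ominus> hp R cs (s m) = (x \<ominus> s m) \<otimes> hp R ds x"
    using hp_factor[OF Suc.prems(3) _ sm] by blast
  let ?J1 = "{n \<in> J. s n \<ominus> s m \<in> I}" and ?J2 = "{n \<in> J. hp R ds (s n) \<in> I}"
  have "n \<in> ?J1 \<union> ?J2" if n: "n \<in> J" for n
  proof -
    have sn: "s n \<in> carrier R" using n Suc.prems by blast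
    have "hp R cs (s n) \<ominus> hp R cs (s m) \<in> I"
      using Suc.prems(4)[OF n] Suc.prems(4)[OF m] unfolding a_minus_def
      by (intro I.a_closed I.a_inv_closed)
    then have "(s n \<ominus> s m) \<otimes> hp R ds (s n) \<in> I" using ds(3) sn by simp
    then have "s n \<ominus> s m \<in> I \<or> hp R ds (s n) \<in> I"
      using I.I_prime sn sm ds(1) by simp
    then show ?thesis using n by blast
  qed
  then have "J \<subseteq> ?J1 \<union> ?J2" by blast
  then have "infinite ?J1 \<or> infinite ?J2"
    using Suc.prems(1) finite_subset[of J "?J1 \<union> ?J2"] finite_UnI[of ?J1 ?J2] by blast
  then show ?case
  proof
    assume inf: "infinite ?J1"
    have "s k \<ominus> s n \<in> I" if kn: "k \<in> ?J1" "n \<in> ?J1" for k n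
    proof -
      have c: "s k \<in> carrier R" "s n \<in> carrier R" using kn Suc.prems by blast+
      have "(s k \<ominus> s m) \<oplus> \<ominus> (s n \<ominus> s m) \<in> I" using kn by (intro I.a_closed I.a_inv_closed) blast+
      moreover have "(s k \<ominus> s m) \<oplus> \<ominus> (s n \<ominus> s m) = s k \<ominus> s n" using c sm by algebra
      ultimately show ?thesis by simp
    qed
    then show ?thesis using inf by (intro exI[of _ ?J1]) blast
  next
    assume inf: "infinite ?J2"
    have "\<exists>J'\<subseteq>?J2. infinite J' \<and> (\<forall>m \<in> J'. \<forall>n \<in> J'. s m \<ominus> s n \<in> I)"
      by (rule Suc.hyps(1)[OF _ inf _ ds(1)]) (use Suc.hyps(2) Suc.prems ds in auto)
    then show ?thesis by blast
  qed
qed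

text \<open>An induction in place of the binomial expansion: one factor a + b is split, and its
  summand a or b is absorbed into \<open>u\<close>, which lowers \<open>k\<close> or
  \<open>l\<close> respectively.\<close>

lemma rad_add_aux:
  fixes k l :: nat
  assumes I: "ideal I R" and ab: "a \<in> carrier R" "b \<in> carrier R"
  shows "u \<in> carrier R \<Longrightarrow> a [^] k \<otimes> u \<in> I \<Longrightarrow> b [^] l \<otimes> u \<in> I \<Longrightarrow> (a \<oplus> b) [^] (k + l) \<otimes> u \<in> I"
proof (induction "k + l" arbitrary: k l u)
  case 0
  then show ?case by simp
next
  case (Suc m)
  interpret I: ideal I R by fact
  show ?case
  proof (cases "k = 0 \<or> l = 0")
    case True
    then have "u \<in> I" using Suc.prems by auto
    then show ?thesis using ab by (intro I.I_l_closed) simp_all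
  next
    case False
    then obtain k' l' where kl: "k = Suc k'" "l = Suc l'" by (metis nat.exhaust)
    have c: "a [^] k' \<in> carrier R" "b [^] l' \<in> carrier R" using ab by simp_all
    have "a [^] k' \<otimes> (a \<otimes> u) \<in> I"
      using Suc.prems(1,2) ab c by (simp add: kl m_assoc)
    moreover have "b [^] l \<otimes> (a \<otimes> u) \<in> I"
    proof -
      have "b [^] l \<otimes> (a \<otimes> u) = a \<otimes> (b [^] l \<otimes> u)" using Suc.prems(1) ab by (simp add: m_lcomm)
      then show ?thesis using I.I_l_closed[OF Suc.prems(3) ab(1)] by simp
    qed
    ultimately have 1: "(a \<oplus> b) [^] (k' + l) \<otimes> (a \<otimes> u) \<in> I"
      using Suc.prems(1) ab Suc.hyps(2) kl by (intro Suc.hyps(1)) simp_all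
    have "b [^] l' \<otimes> (b \<otimes> u) \<in> I"
      using Suc.prems(1,3) ab c by (simp add: kl m_assoc)
    moreover have "a [^] k \<otimes> (b \<otimes> u) \<in> I"
    proof -
      have "a [^] k \<otimes> (b \<otimes> u) = b \<otimes> (a [^] k \<otimes> u)" using Suc.prems(1) ab by (simp add: m_lcomm)
      then show ?thesis using I.I_l_closed[OF Suc.prems(2) ab(2)] by simp
    qed
    ultimately have 2: "(a \<oplus> b) [^] (k + l') \<otimes> (b \<otimes> u) \<in> I"
      using Suc.prems(1) ab Suc.hyps(2) kl by (intro Suc.hyps(1)) simp_all
    have e: "k + l = Suc (k' + l)" "k + l' = k' + l" using kl by simp_all
    have "(a \<oplus> b) [^] Suc (k' + l) \<otimes> u =
        (a \<oplus> b) [^] (k' + l) \<otimes> (a \<otimes> u) \<oplus> (a \<oplus> b) [^] (k' + l) \<otimes> (b \<otimes> u)"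
      using ab Suc.prems(1) by (simp add: m_assoc l_distr r_distr)
    then show ?thesis using I.a_closed[OF 1 2[unfolded e(2)]] unfolding e(1) by metis
  qed
qed

lemma rad_closed:
  assumes I: "ideal I R"
  shows "x \<in> rad R I \<Longrightarrow> y \<in> rad R I \<Longrightarrow> x \<oplus> y \<in> rad R I"
    and "x \<in> rad R I \<Longrightarrow> c \<in> carrier R \<Longrightarrow> c \<otimes> x \<in> rad R I"
    and "x \<in> rad R I \<Longrightarrow> \<ominus> x \<in> rad R I" and "\<zero> \<in> rad R I"
proof -
  interpret I: ideal I R by fact
  show 1: "x \<in> rad R I \<Longrightarrow> c \<in> carrier R \<Longrightarrow> c \<otimes> x \<in> rad R I" for x c
  proof -
    assume x: "x \<in> rad R I" and c: "c \<in> carrier R"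
    then obtain k :: nat where k: "x \<in> carrier R" "x [^] k \<in> I" by (auto simp: rad_def)
    have "(c \<otimes> x) [^] k \<in> I"
      using I.I_l_closed[OF k(2), of "c [^] k"] c k by (simp add: nat_pow_distrib)
    then show "c \<otimes> x \<in> rad R I" using c k by (auto simp: rad_def)
  qed
  show "x \<in> rad R I \<Longrightarrow> \<ominus> x \<in> rad R I"
    using 1[of x "\<ominus> \<one>"] by (simp add: rad_def l_minus)
  show "\<zero> \<in> rad R I" using I.zero_closed by (auto simp: rad_def intro: exI[of _ "1::nat"])
  assume xy: "x \<in> rad R I" "y \<in> rad R I"
  then obtain k l :: nat where kl: "x [^] k \<in> I" "y [^] l \<in> I" "x \<in> carrier R" "y \<in> carrier R"
    by (auto simp: rad_def)
  then have "(x \<oplus> y) [^] (k + l) \<in> I" using rad_add_aux[OF I kl(3,4), of \<one> k l] by simp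
  then show "x \<oplus> y \<in> rad R I" using kl by (auto simp: rad_def)
qed

text \<open>A power of \<open>x\<close> in I + (a) times a power of \<open>x\<close> in I + (b) lies
  in \<open>I\<close>, because ab does.\<close>

lemma rad_Int:
  assumes I: "ideal I R" and ab: "a \<in> carrier R" "b \<in> carrier R" "a \<otimes> b \<in> I"
    and x: "x \<in> rad R (I <+>\<^bsub>R\<^esub> PIdl a)" "x \<in> rad R (I <+>\<^bsub>R\<^esub> PIdl b)"
  shows "x \<in> rad R I"
proof -
  interpret I: ideal I R by fact
  obtain k l :: nat where kl: "x [^] k \<in> I <+>\<^bsub>R\<^esub> PIdl a" "x [^] l \<in> I <+>\<^bsub>R\<^esub> PIdl b" and xc: "x \<in> carrier R"
    using x by (auto simp: rad_def)
  obtain i r where ir: "i \<in> I" "r \<in> carrier R" "x [^] k = i \<oplus> r \<otimes> a"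
    using kl(1) by (auto simp: set_add_def' cgenideal_def)
  obtain i' r' where ir': "i' \<in> I" "r' \<in> carrier R" "x [^] l = i' \<oplus> r' \<otimes> b"
    using kl(2) by (auto simp: set_add_def' cgenideal_def)
  have c: "i \<in> carrier R" "i' \<in> carrier R" using ir ir' I.Icarr by blast+
  have "x [^] (k + l) = x [^] k \<otimes> x [^] l" using xc by (simp add: nat_pow_mult)
  also have "\<dots> = (i' \<oplus> r' \<otimes> b) \<otimes> i \<oplus> (r \<otimes> a) \<otimes> i' \<oplus> (r \<otimes> r') \<otimes> (a \<otimes> b)"
    unfolding ir(3) ir'(3) using c ir(2) ir'(2) ab by algebra
  also have "\<dots> \<in> I"
    using I.I_l_closed[OF ir(1), of "i' \<oplus> r' \<otimes> b"] I.I_l_closed[OF ir'(1), of "r \<otimes> a"]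
      I.I_l_closed[OF ab(3), of "r \<otimes> r'"] c ir(2) ir'(2) ab(1,2) by simp
  finally show ?thesis using xc by (auto simp: rad_def)
qed

lemma wf_ideals:
  assumes "noeth (add_monoid R)"
  shows "wf {(J, I). ideal I R \<and> ideal J R \<and> I \<subset> J}"
  unfolding wf_iff_no_infinite_down_chain
proof
  assume "\<exists>f. \<forall>i. (f (Suc i), f i) \<in> {(J, I). ideal I R \<and> ideal J R \<and> I \<subset> J}"
  then obtain f where f: "\<And>i. ideal (f i) R" "\<And>i. f i \<subset> f (Suc i)" by blast
  have "\<exists>n. \<forall>m\<ge>n. f m = f n"
  proof (rule noeth_chain[OF assms])
    show "subgroup (f i) (add_monoid R)" for i
      using f(1)[of i] by (simp add: ideal.axioms(1) additive_subgroup.a_subgroup)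
  qed (use f(2) in blast)
  then obtain n where "\<forall>m\<ge>n. f m = f n" by blast
  then have "f (Suc n) = f n" by (meson le_SucI le_refl)
  then show False using f(2)[of n] by simp
qed

text \<open>Noetherian induction on \<open>I\<close> takes the place of a list of the minimal primes
  over \<open>I\<close>. If \<open>I\<close> is proper and not prime, some product ab lies in
  \<open>I\<close> with a and b outside; the index set is thinned for I + (a), then again for I +
  (b), and \<open>rad_Int\<close> combines the two.\<close>

lemma pigeonhole_rad:
  assumes noeth: "noeth (add_monoid R)" and s: "\<And>n. n \<in> J0 \<Longrightarrow> s n \<in> carrier R"
    and cs: "set cs \<subseteq> carrier R" "\<And>n. n \<in> J0 \<Longrightarrow> hp R cs (s n) = \<zero>" and I: "ideal I R"
    and J: "infinite J" "J \<subseteq> J0"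
  shows "\<exists>J'\<subseteq>J. infinite (J'::nat set) \<and> (\<forall>m \<in> J'. \<forall>n \<in> J'. s m \<ominus> s n \<in> rad R I)"
  using wf_ideals[OF noeth] I J
proof (induction I arbitrary: J rule: wf_induct_rule)
  case (less I)
  interpret I: ideal I R using less.prems by blast
  have Irad: "I \<subseteq> rad R I"
  proof
    fix x assume "x \<in> I"
    then show "x \<in> rad R I" using I.Icarr by (auto simp: rad_def intro!: exI[of _ "1::nat"])
  qed
  have diff: "s m \<ominus> s n \<in> carrier R" if "m \<in> J" "n \<in> J" for m n using s that less.prems(3) by blast
  consider "I = carrier R" | "primeideal I R"
    | a b where "a \<in> carrier R" "b \<in> carrier R" "a \<otimes> b \<in> I" "a \<notin> I" "b \<notin> I"
    using primeidealI[OF I.ideal_axioms is_cring] by metis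
  then show ?case
  proof cases
    case 1
    then show ?thesis using less.prems(2) diff Irad by (intro exI[of _ J]) blast
  next
    case 2
    have "\<exists>J'\<subseteq>J. infinite J' \<and> (\<forall>m \<in> J'. \<forall>n \<in> J'. s m \<ominus> s n \<in> I)"
      by (rule pigeonhole_prime[OF 2 less.prems(2) _ cs(1)])
        (use less.prems(3) s cs(2) I.zero_closed in \<open>auto simp: subset_iff\<close>)
    then show ?thesis using Irad by blast
  next
    case (3 a b)
    have big: "ideal (I <+>\<^bsub>R\<^esub> PIdl c) R \<and> I \<subset> I <+>\<^bsub>R\<^esub> PIdl c" if c: "c \<in> carrier R" "c \<notin> I" for c
    proof -
      have id: "ideal (I <+>\<^bsub>R\<^esub> PIdl c) R" using add_ideals[OF I.ideal_axioms cgenideal_ideal[OF c(1)]] .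
      have z: "\<zero> \<in> PIdl c" using cgenideal_ideal[OF c(1)] additive_subgroup.zero_closed ideal.axioms(1) by blast
      have "x \<in> I <+>\<^bsub>R\<^esub> PIdl c" if "x \<in> I" for x
      proof -
        have "x \<oplus> \<zero> \<in> I <+>\<^bsub>R\<^esub> PIdl c" using that z unfolding set_add_def' by blast
        then show ?thesis using I.Icarr[OF that] by simp
      qed
      moreover have "c \<in> I <+>\<^bsub>R\<^esub> PIdl c"
      proof -
        have "\<zero> \<oplus> c \<in> I <+>\<^bsub>R\<^esub> PIdl c"
          using cgenideal_self[OF c(1)] I.zero_closed unfolding set_add_def' by blast
        then show ?thesis using c(1) by simp
      qed
      ultimately show ?thesis using id c(2) by blast
    qed
    obtain J1 where J1: "J1 \<subseteq> J" "infinite J1" "\<forall>m \<in> J1. \<forall>n \<in> J1. s m \<ominus> s n \<in> rad R (I <+>\<^bsub>R\<^esub> PIdl a)"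
      using less.IH[of "I <+>\<^bsub>R\<^esub> PIdl a" J] big[OF 3(1,4)] less.prems by auto
    obtain J2 where J2: "J2 \<subseteq> J1" "infinite J2" "\<forall>m \<in> J2. \<forall>n \<in> J2. s m \<ominus> s n \<in> rad R (I <+>\<^bsub>R\<^esub> PIdl b)"
      using less.IH[of "I <+>\<^bsub>R\<^esub> PIdl b" J1] big[OF 3(2,5)] less.prems J1 by auto
    have "s m \<ominus> s n \<in> rad R I" if mn: "m \<in> J2" "n \<in> J2" for m n
    proof (rule rad_Int[OF I.ideal_axioms 3(1-3)])
      have "m \<in> J1" "n \<in> J1" using mn J2(1) by (simp_all add: subsetD)
      then show "s m \<ominus> s n \<in> rad R (I <+>\<^bsub>R\<^esub> PIdl a)" using J1(3) by (elim bspec ballE[of _ _ m]) simp_all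
      show "s m \<ominus> s n \<in> rad R (I <+>\<^bsub>R\<^esub> PIdl b)" using J2(3) mn by (elim bspec ballE[of _ _ m]) simp_all
    qed
    then show ?thesis using J2(1,2) subset_trans[OF J2(1) J1(1)] by (intro exI[of _ J2]) simp
  qed
qed

text \<open>The coordinates are treated one after another, each time passing to an infinite subset
  of the indices.\<close>

lemma pigeonhole_family:
  fixes d :: nat
  assumes noeth: "noeth (add_monoid R)"
    and x: "\<And>N l. l < d \<Longrightarrow> x N l \<in> carrier R"
    and cs: "\<And>l. l < d \<Longrightarrow> set (cs l) \<subseteq> carrier R" "\<And>N l. l < d \<Longrightarrow> hp R (cs l) (x N l) = \<zero>"
    and J: "infinite J"
  shows "\<exists>J'\<subseteq>J. infinite (J'::nat set) \<and> (\<forall>m \<in> J'. \<forall>n \<in> J'. \<forall>l<d. x m l \<ominus> x n l \<in> rad R {\<zero>})"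
  using x cs
proof (induction d)
  case 0
  then show ?case using J by blast
next
  case (Suc d)
  then obtain J1 where J1: "J1 \<subseteq> J" "infinite J1" "\<forall>m \<in> J1. \<forall>n \<in> J1. \<forall>l<d. x m l \<ominus> x n l \<in> rad R {\<zero>}"
    by (metis less_SucI)
  obtain J2 where J2: "J2 \<subseteq> J1" "infinite J2" "\<forall>m \<in> J2. \<forall>n \<in> J2. x m d \<ominus> x n d \<in> rad R {\<zero>}"
    using pigeonhole_rad[OF noeth, of UNIV "\<lambda>N. x N d" "cs d" "{\<zero>}" J1] Suc.prems J1(2) zeroideal by auto
  have "x m l \<ominus> x n l \<in> rad R {\<zero>}" if "m \<in> J2" "n \<in> J2" "l < Suc d" for m n l
  proof (cases "l = d")
    case False
    then have "l < d" using that by simp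
    then show ?thesis using J1(3) J2(1) that by blast
  qed (use J2(3) that in blast)
  then show ?case using J1(1) J2(1,2) by blast
qed

end

text \<open>Modulo each prime a monic polynomial has at most as many roots as its degree, so infinitely many of the
  families agree modulo the radical. Along these \<open>N\<close> the span of one fixed family \<open>x M\<close> plus the radical meets every coset of \<open>N! R\<close>,
  hence is everything, because \<open>R\<close> is finitely generated.\<close>

lemma finitely_many_bad_families:
  fixes R (structure) and d :: nat
  assumes R: "cring R" and noeth: "noeth (add_monoid R)"
    and x: "\<And>N l. l < d \<Longrightarrow> x N l \<in> carrier R"
    and cs: "\<And>l. l < d \<Longrightarrow> set (cs l) \<subseteq> carrier R" "\<And>N l. l < d \<Longrightarrow> hp R (cs l) (x N l) = \<zero>"
    and div: "\<And>N r. r \<in> carrier R \<Longrightarrow> \<exists>g \<in> generate (add_monoid R) (x N ` {..<d}). \<exists>u \<in> carrier R.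
      r = g \<oplus> add_pow R (fact N :: nat) u"
  shows "finite {N. \<not> (\<forall>r \<in> carrier R. \<exists>g \<in> generate (add_monoid R) (x N ` {..<d}). r \<ominus> g \<in> rad R {\<zero>})}"
    (is "finite ?Bad")
proof (rule ccontr)
  assume inf: "infinite ?Bad"
  let ?A = "add_monoid R"
  interpret cring R by (rule R)
  have A: "comm_group ?A" by (rule a_comm_group)
  then have Ag: "group ?A" by (rule comm_group.axioms)
  from pigeonhole_family[of d x cs, OF noeth x cs inf]
  obtain J where J: "J \<subseteq> ?Bad" "infinite J" "\<forall>m \<in> J. \<forall>n \<in> J. \<forall>l<d. x m l \<ominus> x n l \<in> rad R {\<zero>}" by blast
  obtain M where M: "M \<in> J" using J(2) by (metis ex_in_conv finite.emptyI)
  let ?gen = "\<lambda>N. generate ?A (x N ` {..<d})"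
  define S where "S = {r \<in> carrier R. \<exists>g \<in> ?gen M. r \<ominus> g \<in> rad R {\<zero>}}"
  have xM: "x N ` {..<d} \<subseteq> carrier ?A" for N using x by auto
  have gs: "subgroup (?gen N) ?A" for N by (rule group.generate_is_subgroup[OF Ag xM])
  have gc: "g \<in> carrier R" if "g \<in> ?gen N" for g N using subgroup.mem_carrier[OF gs that] by simp
  note rc = rad_closed[OF zeroideal]
  have Ssub: "subgroup S ?A"
  proof (rule group.subgroupI[OF Ag])
    show "S \<subseteq> carrier ?A" by (auto simp: S_def)
    have z: "\<zero> \<in> carrier R" by simp
    then have "\<zero> \<ominus> \<zero> \<in> rad R {\<zero>}" using rc(4) by (metis r_neg a_minus_def)
    then have "\<zero> \<in> S" using subgroup.one_closed[OF gs[of M]] z unfolding S_def by auto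
    then show "S \<noteq> {}" by blast
  next
    fix a assume "a \<in> S"
    then obtain g where g: "a \<in> carrier R" "g \<in> ?gen M" "a \<ominus> g \<in> rad R {\<zero>}" by (auto simp: S_def)
    have "\<ominus> a \<ominus> (\<ominus> g) = \<ominus> (a \<ominus> g)" using g(1) gc[OF g(2)] by algebra
    then have "\<ominus> a \<ominus> (\<ominus> g) \<in> rad R {\<zero>}" using rc(3)[OF g(3)] by metis
    moreover have "\<ominus> g \<in> ?gen M" using subgroup.m_inv_closed[OF gs g(2)] by (simp add: a_inv_def)
    moreover have "\<ominus> a \<in> carrier R" using g(1) by simp
    ultimately have "\<ominus> a \<in> S" unfolding S_def by blast
    then show "inv\<^bsub>?A\<^esub> a \<in> S" by (simp add: a_inv_def)
  next
    fix a b assume "a \<in> S" "b \<in> S"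
    then obtain g h where g: "a \<in> carrier R" "g \<in> ?gen M" "a \<ominus> g \<in> rad R {\<zero>}"
      and h: "b \<in> carrier R" "h \<in> ?gen M" "b \<ominus> h \<in> rad R {\<zero>}" by (auto simp: S_def)
    have "a \<oplus> b \<ominus> (g \<oplus> h) = (a \<ominus> g) \<oplus> (b \<ominus> h)" using g(1) gc[OF g(2)] h(1) gc[OF h(2)] by algebra
    then have "a \<oplus> b \<ominus> (g \<oplus> h) \<in> rad R {\<zero>}" using rc(1)[OF g(3) h(3)] by metis
    moreover have "g \<oplus> h \<in> ?gen M" using subgroup.m_closed[OF gs g(2) h(2)] by simp
    moreover have "a \<oplus> b \<in> carrier R" using g(1) h(1) by simp
    ultimately have "a \<oplus> b \<in> S" unfolding S_def by blast
    then show "a \<otimes>\<^bsub>?A\<^esub> b \<in> S" by simp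
  qed
  have genS: "?gen N \<subseteq> S" if N: "N \<in> J" for N
  proof (rule group.generate_subgroup_incl[OF Ag _ Ssub])
    have "x N l \<in> S" if "l < d" for l
      using J(3) N M that x[OF that] generate.incl[of "x M l" "x M ` {..<d}" ?A] unfolding S_def by blast
    then show "x N ` {..<d} \<subseteq> S" by blast
  qed
  obtain T where T: "finite T" "T \<subseteq> carrier ?A" "generate ?A T = carrier ?A"
    using noeth group.subgroup_self[OF Ag] unfolding noeth_def fgs_def by blast
  have "S = carrier ?A"
  proof (rule comm_group.fin_gen_divisible[OF A T(1,2) Ssub])
    show "generate ?A (S \<union> T) = carrier ?A"
      using group.mono_generate[OF Ag, of T "S \<union> T"] T group.generate_incl[OF Ag, of "S \<union> T"] subgroup.subset[OF Ssub] by blast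
  next
    fix t :: nat and r assume t: "0 < t" and r: "r \<in> carrier ?A"
    obtain N where N: "N \<in> J" "t \<le> N" using J(2) unfolding infinite_nat_iff_unbounded_le by blast
    obtain k where k: "fact N = t * k" using dvd_fact[of t N] t N(2) by (auto elim: dvdE)
    obtain g u where gu: "g \<in> ?gen N" "u \<in> carrier R" "r = g \<oplus> add_pow R (fact N :: nat) u"
      using div[of r N] r by auto
    have "add_pow R (fact N :: nat) u = add_pow R t (add_pow R k u)"
      using gu(2) by (simp add: k add.nat_pow_pow mult.commute)
    then have "r = g \<otimes>\<^bsub>?A\<^esub> (add_pow R k u) [^]\<^bsub>?A\<^esub> t" using gu(3) by (simp add: add_pow_def)
    moreover have "add_pow R k u \<in> carrier ?A" using gu(2) by simp
    ultimately show "\<exists>s \<in> S. \<exists>u \<in> carrier ?A. r = s \<otimes>\<^bsub>?A\<^esub> u [^]\<^bsub>?A\<^esub> t" using genS[OF N(1)] gu(1) by blast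
  qed
  then have "\<forall>r \<in> carrier R. \<exists>g \<in> ?gen M. r \<ominus> g \<in> rad R {\<zero>}" unfolding S_def by auto
  then show False using M J(1) by blast
qed

lemma rad_subgroup:
  fixes R (structure)
  assumes "cring R" shows "subgroup (rad R {\<zero>}) (add_monoid R)"
proof -
  interpret cring R by fact
  have Ag: "group (add_monoid R)" using a_comm_group by (rule comm_group.axioms)
  note rc = rad_closed[OF zeroideal]
  show ?thesis
  proof (rule group.subgroupI[OF Ag])
    show "rad R {\<zero>} \<subseteq> carrier (add_monoid R)" by (auto simp: rad_def)
    show "rad R {\<zero>} \<noteq> {}" using rc(4) by blast
  qed (use rc in \<open>simp_all add: a_inv_def[symmetric]\<close>)
qed

text \<open>If K-th powers vanish on a subgroup and g^k = 0, then (s + e g)^(K + k) = 0 for all s in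
  the subgroup and all integers e. Finitely many such steps exhaust the additively finitely
  generated nilradical. A uniform exponent is what makes nilpotency expressible by one
  formula.\<close>

lemma nilpotency_bound:
  fixes R (structure)
  assumes R: "cring R" and noeth: "noeth (add_monoid R)"
  shows "\<exists>K::nat. \<forall>r \<in> rad R {\<zero>}. r [^] K = \<zero>"
proof -
  let ?A = "add_monoid R"
  interpret cring R by (rule R)
  have A: "comm_group ?A" by (rule a_comm_group)
  then have Ag: "group ?A" by (rule comm_group.axioms)
  obtain T where T: "finite T" "T \<subseteq> carrier ?A" "generate ?A T = rad R {\<zero>}"
    using noeth rad_subgroup[OF R] unfolding noeth_def fgs_def by blast
  have "\<exists>K::nat. \<forall>r \<in> generate ?A F. r [^] K = \<zero>" if "finite F" "F \<subseteq> T" for F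
    using that
  proof (induction F)
    case empty
    show ?case using group.generate_empty[OF Ag] by (intro exI[of _ 1]) simp
  next
    case (insert g F)
    then obtain K :: nat where K: "\<forall>r \<in> generate ?A F. r [^] K = \<zero>" by blast
    have g: "g \<in> carrier R" "g \<in> rad R {\<zero>}" using insert.prems T subset_generate[of T T ?A] by auto
    obtain k :: nat where k: "g [^] k = \<zero>" using g by (auto simp: rad_def)
    have F: "F \<subseteq> carrier ?A" using insert.prems T by blast
    have Fs: "subgroup (generate ?A F) ?A" by (rule group.generate_is_subgroup[OF Ag F])
    have "r [^] (K + k) = \<zero>" if "r \<in> generate ?A (insert g F)" for r
    proof -
      have "r \<in> generate ?A (generate ?A F \<union> {g})"
        using that group.generate_idem_Un[OF Ag F, of "{g}"] g by simp
      then obtain s e where se: "s \<in> generate ?A F" "r = s \<otimes>\<^bsub>?A\<^esub> g [^]\<^bsub>?A\<^esub> (e::int)"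
        using comm_group.generate_insert_subgroup[OF A Fs, of g r] g by auto
      have sc: "s \<in> carrier R" using subgroup.mem_carrier[OF Fs se(1)] by simp
      have "g [^]\<^bsub>?A\<^esub> e = add_pow R e g" by (simp add: add_pow_def)
      also have "\<dots> = add_pow R e \<one> \<otimes> g" using add_pow_ldistr_int[OF one_closed g(1), of e] g by simp
      finally have r: "r = s \<oplus> add_pow R e \<one> \<otimes> g" using se(2) by simp
      have c: "add_pow R e \<one> \<in> carrier R" by simp
      have "(add_pow R e \<one> \<otimes> g) [^] k = \<zero>" using c g k by (simp add: nat_pow_distrib)
      then have "(s \<oplus> add_pow R e \<one> \<otimes> g) [^] (K + k) \<otimes> \<one> \<in> {\<zero>}"
        using K se(1) sc c g by (intro rad_add_aux[OF zeroideal]) simp_all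
      then show ?thesis using sc c g by (simp add: r)
    qed
    then show ?case by blast
  qed
  from this[OF T(1) subset_refl] show ?thesis using T(3) by simp
qed

section \<open>The adjoint ring of a nondegenerate pairing\<close>

text \<open>The value at \<beta> of a monic integer polynomial in the endomorphism \<alpha>. Only
  \<alpha> and the operations of \<open>B\<close> occur, no ring, so that the formula
  \<open>hprel\<close> can follow the same recursion.\<close>

primrec hpv :: "('b, 'm) monoid_scheme \<Rightarrow> ('b \<Rightarrow> 'b) \<Rightarrow> int list \<Rightarrow> 'b \<Rightarrow> 'b" where
  "hpv B \<alpha> [] \<beta> = \<beta>"
| "hpv B \<alpha> (c # cs) \<beta> = \<beta> [^]\<^bsub>B\<^esub> c \<otimes>\<^bsub>B\<^esub> hpv B \<alpha> cs (\<alpha> \<beta>)"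

text \<open>\<open>Q\<close> is not assumed commutative: in the application it is the quotient of
  \<open>K\<close> by a term of its upper central series.\<close>

locale pairing = B: comm_group B + K: group K + Q: group Q
  for B :: "('b, 'm) monoid_scheme" and K :: "('x, 'n) monoid_scheme" and Q :: "('q, 'o) monoid_scheme" +
  fixes p :: "'b \<Rightarrow> 'x \<Rightarrow> 'q"
  assumes p_left: "g \<in> carrier K \<Longrightarrow> (\<lambda>\<beta>. p \<beta> g) \<in> hom B Q"
    and p_right: "\<beta> \<in> carrier B \<Longrightarrow> p \<beta> \<in> hom K Q"
    and nondeg: "\<beta> \<in> carrier B \<Longrightarrow> (\<And>g. g \<in> carrier K \<Longrightarrow> p \<beta> g = \<one>\<^bsub>Q\<^esub>) \<Longrightarrow> \<beta> = \<one>\<^bsub>B\<^esub>"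
begin

lemma left_hom: "g \<in> carrier K \<Longrightarrow> group_hom B Q (\<lambda>\<beta>. p \<beta> g)"
  using p_left by (simp add: group_hom_def group_hom_axioms_def B.is_group Q.is_group)

lemma right_hom: "\<beta> \<in> carrier B \<Longrightarrow> group_hom K Q (p \<beta>)"
  using p_right by (simp add: group_hom_def group_hom_axioms_def K.is_group Q.is_group)

lemma p_closed [simp]: "\<beta> \<in> carrier B \<Longrightarrow> g \<in> carrier K \<Longrightarrow> p \<beta> g \<in> carrier Q"
  using group_hom.hom_closed[OF right_hom] by blast

lemma p_mult_left:
  "\<beta> \<in> carrier B \<Longrightarrow> \<gamma> \<in> carrier B \<Longrightarrow> g \<in> carrier K \<Longrightarrow> p (\<beta> \<otimes>\<^bsub>B\<^esub> \<gamma>) g = p \<beta> g \<otimes>\<^bsub>Q\<^esub> p \<gamma> g"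
  using group_hom.hom_mult[OF left_hom] by blast

lemma p_inv_left: "\<beta> \<in> carrier B \<Longrightarrow> g \<in> carrier K \<Longrightarrow> p (inv\<^bsub>B\<^esub> \<beta>) g = inv\<^bsub>Q\<^esub> (p \<beta> g)"
  using group_hom.hom_inv[OF left_hom] by blast

lemma p_one_left: "g \<in> carrier K \<Longrightarrow> p \<one>\<^bsub>B\<^esub> g = \<one>\<^bsub>Q\<^esub>"
  using group_hom.hom_one[OF left_hom] by blast

lemma p_mult_right:
  "\<beta> \<in> carrier B \<Longrightarrow> g \<in> carrier K \<Longrightarrow> u \<in> carrier K \<Longrightarrow> p \<beta> (g \<otimes>\<^bsub>K\<^esub> u) = p \<beta> g \<otimes>\<^bsub>Q\<^esub> p \<beta> u"
  using group_hom.hom_mult[OF right_hom] by blast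

lemma p_inv_right: "\<beta> \<in> carrier B \<Longrightarrow> g \<in> carrier K \<Longrightarrow> p \<beta> (inv\<^bsub>K\<^esub> g) = inv\<^bsub>Q\<^esub> (p \<beta> g)"
  using group_hom.hom_inv[OF right_hom] by blast

lemma p_one_right: "\<beta> \<in> carrier B \<Longrightarrow> p \<beta> \<one>\<^bsub>K\<^esub> = \<one>\<^bsub>Q\<^esub>"
  using group_hom.hom_one[OF right_hom] by blast

text \<open>Endomorphisms that can be moved across the pairing, element by element of
  \<open>K\<close>. The elements u belonging to finitely many g already determine \<alpha> when
  these g separate the points of \<open>B\<close>, so \<alpha> can be coded by a tuple in
  \<open>K\<close>. Functions are extensional to make equality pointwise on
  \<open>B\<close>.\<close>

definition E :: "('b \<Rightarrow> 'b) set" where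
  "E = {\<alpha> \<in> carrier B \<rightarrow>\<^sub>E carrier B. \<alpha> \<in> hom B B \<and>
    (\<forall>g \<in> carrier K. \<exists>u \<in> carrier K. \<forall>\<beta> \<in> carrier B. p (\<alpha> \<beta>) g = p \<beta> u)}"

text \<open>The center of the ring \<open>E\<close>. Commutativity makes primes and radicals
  available; and since \<open>C\<close> depends on the pairing alone, one ring serves for all the
  tuples over which elements are later coded.\<close>

definition C :: "('b \<Rightarrow> 'b) set" where
  "C = {\<alpha> \<in> E. \<forall>\<gamma> \<in> E. \<forall>\<beta> \<in> carrier B. \<alpha> (\<gamma> \<beta>) = \<gamma> (\<alpha> \<beta>)}"

lemma E_closed [simp]: "\<alpha> \<in> E \<Longrightarrow> \<beta> \<in> carrier B \<Longrightarrow> \<alpha> \<beta> \<in> carrier B"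
  by (auto simp: E_def)

lemma E_hom: "\<alpha> \<in> E \<Longrightarrow> group_hom B B \<alpha>"
  by (simp add: E_def group_hom_def group_hom_axioms_def B.is_group)

lemma E_adj: "\<alpha> \<in> E \<Longrightarrow> g \<in> carrier K \<Longrightarrow> \<exists>u \<in> carrier K. \<forall>\<beta> \<in> carrier B. p (\<alpha> \<beta>) g = p \<beta> u"
  by (simp add: E_def)

lemma E_mult: "\<alpha> \<in> E \<Longrightarrow> \<beta> \<in> carrier B \<Longrightarrow> \<gamma> \<in> carrier B \<Longrightarrow> \<alpha> (\<beta> \<otimes>\<^bsub>B\<^esub> \<gamma>) = \<alpha> \<beta> \<otimes>\<^bsub>B\<^esub> \<alpha> \<gamma>"
  using group_hom.hom_mult[OF E_hom] by blast

lemma E_inv: "\<alpha> \<in> E \<Longrightarrow> \<beta> \<in> carrier B \<Longrightarrow> \<alpha> (inv\<^bsub>B\<^esub> \<beta>) = inv\<^bsub>B\<^esub> (\<alpha> \<beta>)"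
  using group_hom.hom_inv[OF E_hom] by blast

lemma E_one: "\<alpha> \<in> E \<Longrightarrow> \<alpha> \<one>\<^bsub>B\<^esub> = \<one>\<^bsub>B\<^esub>"
  using group_hom.hom_one[OF E_hom] by blast

lemma E_ext: "\<alpha> \<in> E \<Longrightarrow> \<gamma> \<in> E \<Longrightarrow> (\<And>\<beta>. \<beta> \<in> carrier B \<Longrightarrow> \<alpha> \<beta> = \<gamma> \<beta>) \<Longrightarrow> \<alpha> = \<gamma>"
  unfolding E_def by (blast intro: PiE_ext)

lemma EI:
  assumes "\<And>\<beta>. \<beta> \<in> carrier B \<Longrightarrow> f \<beta> \<in> carrier B"
    "\<And>\<beta> \<gamma>. \<beta> \<in> carrier B \<Longrightarrow> \<gamma> \<in> carrier B \<Longrightarrow> f (\<beta> \<otimes>\<^bsub>B\<^esub> \<gamma>) = f \<beta> \<otimes>\<^bsub>B\<^esub> f \<gamma>"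
    "\<And>g. g \<in> carrier K \<Longrightarrow> \<exists>u \<in> carrier K. \<forall>\<beta> \<in> carrier B. p (f \<beta>) g = p \<beta> u"
  shows "(\<lambda>\<beta> \<in> carrier B. f \<beta>) \<in> E"
  using assms unfolding E_def by (simp add: hom_def Pi_iff)

lemma E_add:
  assumes "\<alpha> \<in> E" "\<gamma> \<in> E" shows "(\<lambda>\<beta> \<in> carrier B. \<alpha> \<beta> \<otimes>\<^bsub>B\<^esub> \<gamma> \<beta>) \<in> E"
proof (rule EI)
  fix g assume g: "g \<in> carrier K"
  obtain u v where uv: "u \<in> carrier K" "\<forall>\<beta> \<in> carrier B. p (\<alpha> \<beta>) g = p \<beta> u"
    "v \<in> carrier K" "\<forall>\<beta> \<in> carrier B. p (\<gamma> \<beta>) g = p \<beta> v"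
    using E_adj[OF assms(1) g] E_adj[OF assms(2) g] by blast
  show "\<exists>u \<in> carrier K. \<forall>\<beta> \<in> carrier B. p (\<alpha> \<beta> \<otimes>\<^bsub>B\<^esub> \<gamma> \<beta>) g = p \<beta> u"
    using uv g assms by (intro bexI[of _ "u \<otimes>\<^bsub>K\<^esub> v"]) (simp_all add: p_mult_left p_mult_right)
qed (use assms in \<open>simp_all add: E_mult B.m_ac\<close>)

lemma E_neg:
  assumes "\<alpha> \<in> E" shows "(\<lambda>\<beta> \<in> carrier B. inv\<^bsub>B\<^esub> (\<alpha> \<beta>)) \<in> E"
proof (rule EI)
  fix g assume g: "g \<in> carrier K"
  obtain u where u: "u \<in> carrier K" "\<forall>\<beta> \<in> carrier B. p (\<alpha> \<beta>) g = p \<beta> u"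
    using E_adj[OF assms g] by blast
  show "\<exists>u \<in> carrier K. \<forall>\<beta> \<in> carrier B. p (inv\<^bsub>B\<^esub> (\<alpha> \<beta>)) g = p \<beta> u"
    using u g assms by (intro bexI[of _ "inv\<^bsub>K\<^esub> u"]) (simp_all add: p_inv_left p_inv_right)
qed (use assms in \<open>simp_all add: E_mult B.inv_mult\<close>)

lemma E_comp:
  assumes "\<alpha> \<in> E" "\<gamma> \<in> E" shows "(\<lambda>\<beta> \<in> carrier B. \<alpha> (\<gamma> \<beta>)) \<in> E"
proof (rule EI)
  fix g assume g: "g \<in> carrier K"
  obtain u where u: "u \<in> carrier K" "\<forall>\<beta> \<in> carrier B. p (\<alpha> \<beta>) g = p \<beta> u"
    using E_adj[OF assms(1) g] by blast
  obtain v where v: "v \<in> carrier K" "\<forall>\<beta> \<in> carrier B. p (\<gamma> \<beta>) u = p \<beta> v"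
    using E_adj[OF assms(2) u(1)] by blast
  show "\<exists>u \<in> carrier K. \<forall>\<beta> \<in> carrier B. p (\<alpha> (\<gamma> \<beta>)) g = p \<beta> u"
    using u v assms by (intro bexI[of _ v]) simp_all
qed (use assms in \<open>simp_all add: E_mult\<close>)

lemma E_zero: "(\<lambda>\<beta> \<in> carrier B. \<one>\<^bsub>B\<^esub>) \<in> E"
proof (rule EI)
  fix g assume "g \<in> carrier K"
  then show "\<exists>u \<in> carrier K. \<forall>\<beta> \<in> carrier B. p \<one>\<^bsub>B\<^esub> g = p \<beta> u"
    by (intro bexI[of _ "\<one>\<^bsub>K\<^esub>"]) (simp_all add: p_one_left p_one_right)
qed simp_all

lemma E_id: "(\<lambda>\<beta> \<in> carrier B. \<beta>) \<in> E"
  by (rule EI) auto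

lemma C_E: "\<alpha> \<in> C \<Longrightarrow> \<alpha> \<in> E"
  by (simp add: C_def)

lemma C_comm: "\<alpha> \<in> C \<Longrightarrow> \<gamma> \<in> E \<Longrightarrow> \<beta> \<in> carrier B \<Longrightarrow> \<alpha> (\<gamma> \<beta>) = \<gamma> (\<alpha> \<beta>)"
  by (simp add: C_def)

lemma C_add: "\<alpha> \<in> C \<Longrightarrow> \<gamma> \<in> C \<Longrightarrow> (\<lambda>\<beta> \<in> carrier B. \<alpha> \<beta> \<otimes>\<^bsub>B\<^esub> \<gamma> \<beta>) \<in> C"
  unfolding C_def by (simp add: E_add E_mult)

lemma C_neg: "\<alpha> \<in> C \<Longrightarrow> (\<lambda>\<beta> \<in> carrier B. inv\<^bsub>B\<^esub> (\<alpha> \<beta>)) \<in> C"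
  unfolding C_def by (simp add: E_neg E_inv)

lemma C_comp: "\<alpha> \<in> C \<Longrightarrow> \<gamma> \<in> C \<Longrightarrow> (\<lambda>\<beta> \<in> carrier B. \<alpha> (\<gamma> \<beta>)) \<in> C"
proof -
  assume *: "\<alpha> \<in> C" "\<gamma> \<in> C"
  have "\<alpha> (\<gamma> (\<delta> \<beta>)) = \<delta> (\<alpha> (\<gamma> \<beta>))" if "\<delta> \<in> E" "\<beta> \<in> carrier B" for \<delta> \<beta>
    using C_comm[OF *(2) that] C_comm[OF *(1) that(1), of "\<gamma> \<beta>"] C_E[OF *(2)] that(2) by simp
  then show ?thesis using E_comp[OF C_E[OF *(1)] C_E[OF *(2)]] by (simp add: C_def)
qed

lemma C_zero: "(\<lambda>\<beta> \<in> carrier B. \<one>\<^bsub>B\<^esub>) \<in> C"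
  unfolding C_def by (simp add: E_zero E_one)

lemma C_id: "(\<lambda>\<beta> \<in> carrier B. \<beta>) \<in> C"
  unfolding C_def by (simp add: E_id)

definition R :: "('b \<Rightarrow> 'b) ring" where
  "R = \<lparr>carrier = C, monoid.mult = (\<lambda>\<alpha> \<gamma>. \<lambda>\<beta> \<in> carrier B. \<alpha> (\<gamma> \<beta>)), monoid.one = (\<lambda>\<beta> \<in> carrier B. \<beta>),
    ring.zero = (\<lambda>\<beta> \<in> carrier B. \<one>\<^bsub>B\<^esub>), ring.add = (\<lambda>\<alpha> \<gamma>. \<lambda>\<beta> \<in> carrier B. \<alpha> \<beta> \<otimes>\<^bsub>B\<^esub> \<gamma> \<beta>)\<rparr>"

lemma R_simps [simp]:
  "carrier R = C"
  "\<beta> \<in> carrier B \<Longrightarrow> (\<alpha> \<otimes>\<^bsub>R\<^esub> \<gamma>) \<beta> = \<alpha> (\<gamma> \<beta>)"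
  "\<beta> \<in> carrier B \<Longrightarrow> (\<alpha> \<oplus>\<^bsub>R\<^esub> \<gamma>) \<beta> = \<alpha> \<beta> \<otimes>\<^bsub>B\<^esub> \<gamma> \<beta>"
  "\<beta> \<in> carrier B \<Longrightarrow> \<one>\<^bsub>R\<^esub> \<beta> = \<beta>"
  "\<beta> \<in> carrier B \<Longrightarrow> \<zero>\<^bsub>R\<^esub> \<beta> = \<one>\<^bsub>B\<^esub>"
  by (simp_all add: R_def)

lemma R_closed:
  "\<alpha> \<in> C \<Longrightarrow> \<gamma> \<in> C \<Longrightarrow> \<alpha> \<otimes>\<^bsub>R\<^esub> \<gamma> \<in> C" "\<alpha> \<in> C \<Longrightarrow> \<gamma> \<in> C \<Longrightarrow> \<alpha> \<oplus>\<^bsub>R\<^esub> \<gamma> \<in> C"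
  "\<one>\<^bsub>R\<^esub> \<in> C" "\<zero>\<^bsub>R\<^esub> \<in> C"
  by (simp_all add: R_def C_add C_comp C_id C_zero)

lemma C_ext: "\<alpha> \<in> C \<Longrightarrow> \<gamma> \<in> C \<Longrightarrow> (\<And>\<beta>. \<beta> \<in> carrier B \<Longrightarrow> \<alpha> \<beta> = \<gamma> \<beta>) \<Longrightarrow> \<alpha> = \<gamma>"
  using E_ext C_E by blast

lemma C_closed [simp]: "\<alpha> \<in> C \<Longrightarrow> \<beta> \<in> carrier B \<Longrightarrow> \<alpha> \<beta> \<in> carrier B"
  using E_closed C_E by blast

lemma cring_R: "cring R"
proof (rule cringI)
  show "abelian_group R"
  proof (rule abelian_groupI)
    fix \<alpha> assume a: "\<alpha> \<in> carrier R"
    then have n: "(\<lambda>\<beta> \<in> carrier B. inv\<^bsub>B\<^esub> (\<alpha> \<beta>)) \<in> C" using C_neg by simp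
    moreover have "(\<lambda>\<beta> \<in> carrier B. inv\<^bsub>B\<^esub> (\<alpha> \<beta>)) \<oplus>\<^bsub>R\<^esub> \<alpha> = \<zero>\<^bsub>R\<^esub>"
      by (rule C_ext) (use a n in \<open>simp_all add: R_closed\<close>)
    ultimately show "\<exists>\<gamma> \<in> carrier R. \<gamma> \<oplus>\<^bsub>R\<^esub> \<alpha> = \<zero>\<^bsub>R\<^esub>" by auto
    show "\<zero>\<^bsub>R\<^esub> \<oplus>\<^bsub>R\<^esub> \<alpha> = \<alpha>" by (rule C_ext) (use a in \<open>simp_all add: R_closed\<close>)
    fix \<gamma> assume g: "\<gamma> \<in> carrier R"
    show "\<alpha> \<oplus>\<^bsub>R\<^esub> \<gamma> = \<gamma> \<oplus>\<^bsub>R\<^esub> \<alpha>"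
      by (rule C_ext) (use a g in \<open>simp_all add: R_closed B.m_comm\<close>)
    fix \<delta> assume d: "\<delta> \<in> carrier R"
    show "\<alpha> \<oplus>\<^bsub>R\<^esub> \<gamma> \<oplus>\<^bsub>R\<^esub> \<delta> = \<alpha> \<oplus>\<^bsub>R\<^esub> (\<gamma> \<oplus>\<^bsub>R\<^esub> \<delta>)"
      by (rule C_ext) (use a g d in \<open>simp_all add: R_closed B.m_assoc\<close>)
  qed (simp_all add: R_closed)
  show "comm_monoid R"
  proof (rule comm_monoidI)
    fix \<alpha> assume a: "\<alpha> \<in> carrier R"
    show "\<one>\<^bsub>R\<^esub> \<otimes>\<^bsub>R\<^esub> \<alpha> = \<alpha>" by (rule C_ext) (use a in \<open>simp_all add: R_closed\<close>)
    fix \<gamma> assume g: "\<gamma> \<in> carrier R"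
    show "\<alpha> \<otimes>\<^bsub>R\<^esub> \<gamma> = \<gamma> \<otimes>\<^bsub>R\<^esub> \<alpha>"
      by (rule C_ext) (use a g C_comm C_E in \<open>simp_all add: R_closed\<close>)
    fix \<delta> assume d: "\<delta> \<in> carrier R"
    show "\<alpha> \<otimes>\<^bsub>R\<^esub> \<gamma> \<otimes>\<^bsub>R\<^esub> \<delta> = \<alpha> \<otimes>\<^bsub>R\<^esub> (\<gamma> \<otimes>\<^bsub>R\<^esub> \<delta>)"
      by (rule C_ext) (use a g d in \<open>simp_all add: R_closed\<close>)
  qed (simp_all add: R_closed)
  fix \<alpha> \<gamma> \<delta> assume *: "\<alpha> \<in> carrier R" "\<gamma> \<in> carrier R" "\<delta> \<in> carrier R"
  show "(\<alpha> \<oplus>\<^bsub>R\<^esub> \<gamma>) \<otimes>\<^bsub>R\<^esub> \<delta> = \<alpha> \<otimes>\<^bsub>R\<^esub> \<delta> \<oplus>\<^bsub>R\<^esub> \<gamma> \<otimes>\<^bsub>R\<^esub> \<delta>"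
    by (rule C_ext) (use * in \<open>simp_all add: R_closed\<close>)
qed

sublocale R: cring R by (rule cring_R)

lemma addR: "comm_group (add_monoid R)"
  by (rule R.a_comm_group)

lemma addR_group: "group (add_monoid R)"
  using addR by (rule comm_group.axioms)

lemma ev_hom: "\<beta> \<in> carrier B \<Longrightarrow> group_hom (add_monoid R) B (\<lambda>\<alpha>. \<alpha> \<beta>)"
  using addR_group B.is_group
  by (simp add: group_hom_def group_hom_axioms_def hom_def)

lemma add_pow_eval:
  assumes "\<alpha> \<in> C" "\<beta> \<in> carrier B"
  shows "add_pow R (c::int) \<alpha> \<beta> = \<alpha> \<beta> [^]\<^bsub>B\<^esub> c" "add_pow R (n::nat) \<alpha> \<beta> = \<alpha> \<beta> [^]\<^bsub>B\<^esub> n"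
  using group_hom.hom_int_pow[OF ev_hom[OF assms(2)], of \<alpha> c]
    group_hom.hom_nat_pow[OF ev_hom[OF assms(2)], of \<alpha> n] assms(1)
  by (simp_all add: add_pow_def)

text \<open>Evaluation at finitely many generators of \<open>B\<close> embeds the additive group of
  \<open>C\<close> into a power of \<open>B\<close>.\<close>

lemma noeth_R:
  assumes "noeth B" shows "noeth (add_monoid R)"
proof -
  obtain T where T: "finite T" "T \<subseteq> carrier B" "generate B T = carrier B"
    using assms B.subgroup_self unfolding noeth_def fgs_def by blast
  obtain t and s :: nat where t: "T = t ` {..<s}"
    using T(1) by (metis finite_imp_nat_seg_image_inj_on lessThan_def)
  show ?thesis
  proof (rule noeth_separated[OF addR_group assms, of s "\<lambda>j \<alpha>. \<alpha> (t j)"])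
    fix j assume "j < s"
    then show "group_hom (add_monoid R) B (\<lambda>\<alpha>. \<alpha> (t j))" using T(2) t by (intro ev_hom) blast
  next
    fix \<alpha> assume a: "\<alpha> \<in> carrier (add_monoid R)" and j: "\<And>j. j < s \<Longrightarrow> \<alpha> (t j) = \<one>\<^bsub>B\<^esub>"
    have aC: "\<alpha> \<in> C" using a by simp
    interpret a: group_hom B B \<alpha> using E_hom C_E aC by blast
    have "T \<subseteq> kernel B B \<alpha>" using j t T(2) by (auto simp: kernel_def)
    then have "carrier B \<subseteq> kernel B B \<alpha>"
      using B.generate_subgroup_incl[OF _ a.subgroup_kernel] T(3) by metis
    then have "\<alpha> \<beta> = \<one>\<^bsub>B\<^esub>" if "\<beta> \<in> carrier B" for \<beta> using that by (auto simp: kernel_def)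
    then have "\<alpha> = \<zero>\<^bsub>R\<^esub>" using aC by (intro C_ext) (simp_all add: R_closed)
    then show "\<alpha> = \<one>\<^bsub>add_monoid R\<^esub>" by simp
  qed
qed

abbreviation int_coeffs :: "int list \<Rightarrow> ('b \<Rightarrow> 'b) list" where
  "int_coeffs cs \<equiv> map (\<lambda>c. add_pow R c \<one>\<^bsub>R\<^esub>) cs"

lemma int_coeffs_closed: "set (int_coeffs cs) \<subseteq> C"
  using R.add.int_pow_closed[OF R.one_closed] by auto

lemma hpv_closed: "\<alpha> \<in> C \<Longrightarrow> \<beta> \<in> carrier B \<Longrightarrow> hpv B \<alpha> cs \<beta> \<in> carrier B"
  by (induction cs arbitrary: \<beta>) simp_all

text \<open>\<open>hp\<close> multiplies by \<alpha> on the outside, \<open>hpv\<close> applies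
  \<alpha> to the argument first; the two agree because \<alpha> commutes with polynomials in
  \<alpha>.\<close>

lemma hp_eval:
  assumes "\<alpha> \<in> C" shows "\<beta> \<in> carrier B \<Longrightarrow> hp R (int_coeffs cs) \<alpha> \<beta> = hpv B \<alpha> cs \<beta>"
proof (induction cs arbitrary: \<beta>)
  case (Cons c cs)
  have h: "hp R (int_coeffs cs) \<alpha> \<in> C"
    using R.hp_closed[of "int_coeffs cs" \<alpha>] int_coeffs_closed assms by simp
  have "hp R (int_coeffs (c # cs)) \<alpha> \<beta> = add_pow R c \<one>\<^bsub>R\<^esub> \<beta> \<otimes>\<^bsub>B\<^esub> \<alpha> (hp R (int_coeffs cs) \<alpha> \<beta>)"
    using Cons.prems by simp
  also have "\<alpha> (hp R (int_coeffs cs) \<alpha> \<beta>) = hp R (int_coeffs cs) \<alpha> (\<alpha> \<beta>)"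
    using C_comm[OF assms C_E[OF h] Cons.prems] .
  also have "\<dots> = hpv B \<alpha> cs (\<alpha> \<beta>)" using Cons assms by simp
  also have "add_pow R c \<one>\<^bsub>R\<^esub> \<beta> = \<beta> [^]\<^bsub>B\<^esub> c" using add_pow_eval(1)[of "\<one>\<^bsub>R\<^esub>" \<beta> c] Cons.prems R_closed by simp
  finally show ?case by simp
qed simp

lemma hp_zero_iff:
  assumes "\<alpha> \<in> C"
  shows "hp R (int_coeffs cs) \<alpha> = \<zero>\<^bsub>R\<^esub> \<longleftrightarrow> (\<forall>\<beta> \<in> carrier B. hpv B \<alpha> cs \<beta> = \<one>\<^bsub>B\<^esub>)"
proof -
  have h: "hp R (int_coeffs cs) \<alpha> \<in> C"
    using R.hp_closed[of "int_coeffs cs" \<alpha>] int_coeffs_closed assms by simp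
  have "hp R (int_coeffs cs) \<alpha> = \<zero>\<^bsub>R\<^esub> \<longleftrightarrow> (\<forall>\<beta> \<in> carrier B. hp R (int_coeffs cs) \<alpha> \<beta> = \<zero>\<^bsub>R\<^esub> \<beta>)"
    using C_ext[OF h R_closed(4)] by auto
  then show ?thesis using hp_eval[OF assms] by simp
qed

text \<open>Zero coefficients give the monomial of degree \<open>n\<close>, so nilpotency is a case
  of being annihilated by a monic integer polynomial.\<close>

lemma hp_replicate: "\<alpha> \<in> C \<Longrightarrow> hp R (int_coeffs (replicate n 0)) \<alpha> = \<alpha> [^]\<^bsub>R\<^esub> n"
proof (induction n)
  case (Suc n)
  have "add_pow R (0::int) \<one>\<^bsub>R\<^esub> = \<zero>\<^bsub>R\<^esub>" by (simp add: add_pow_def)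
  then show ?case using Suc R.nat_pow_closed[of \<alpha> n] R.nat_pow_Suc2[of \<alpha> n] by (simp add: R_closed)
qed simp

lemma hpv_replicate_iff:
  "\<alpha> \<in> C \<Longrightarrow> \<alpha> [^]\<^bsub>R\<^esub> n = \<zero>\<^bsub>R\<^esub> \<longleftrightarrow> (\<forall>\<beta> \<in> carrier B. hpv B \<alpha> (replicate n 0) \<beta> = \<one>\<^bsub>B\<^esub>)"
  using hp_zero_iff hp_replicate by metis

text \<open>Endomorphisms are coded by the adjoint action on a fixed tuple \<open>b\<close>.\<close>

definition bact :: "(nat \<Rightarrow> 'x) \<Rightarrow> nat \<Rightarrow> (nat \<Rightarrow> 'x) \<Rightarrow> 'b \<Rightarrow> 'b \<Rightarrow> bool" where
  "bact b k y \<beta> \<beta>' \<longleftrightarrow> (\<forall>j<k. p \<beta>' (b j) = p \<beta> (y j))"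

definition bgood :: "(nat \<Rightarrow> 'x) \<Rightarrow> nat \<Rightarrow> (nat \<Rightarrow> 'x) \<Rightarrow> bool" where
  "bgood b k y \<longleftrightarrow> (\<forall>\<beta> \<in> carrier B. \<exists>\<beta>' \<in> carrier B. bact b k y \<beta> \<beta>')"

text \<open>The first clause makes the value of a coded endomorphism unique; the second provides
  adjoints against all of \<open>K\<close> for relations that are tested only on \<open>b\<close>.
  Both hold if \<open>b\<close> generates \<open>K\<close>, but in the group reached by transfer
  generation is not known, and they have to be demanded.\<close>

definition bok :: "(nat \<Rightarrow> 'x) \<Rightarrow> nat \<Rightarrow> bool" where
  "bok b k \<longleftrightarrow> (\<forall>\<beta> \<in> carrier B. (\<forall>j<k. p \<beta> (b j) = \<one>\<^bsub>Q\<^esub>) \<longrightarrow> \<beta> = \<one>\<^bsub>B\<^esub>) \<and>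
    (\<forall>y \<in> tup K k. bgood b k y \<longrightarrow> (\<forall>g \<in> carrier K. \<exists>u \<in> carrier K.
      \<forall>\<beta> \<in> carrier B. \<forall>\<beta>' \<in> carrier B. bact b k y \<beta> \<beta>' \<longrightarrow> p \<beta>' g = p \<beta> u))"

definition bcom :: "(nat \<Rightarrow> 'x) \<Rightarrow> nat \<Rightarrow> (nat \<Rightarrow> 'x) \<Rightarrow> bool" where
  "bcom b k y \<longleftrightarrow> bgood b k y \<and> (\<forall>y' \<in> tup K k. bgood b k y' \<longrightarrow>
    (\<forall>\<beta> \<in> carrier B. \<forall>\<beta>1 \<in> carrier B. \<forall>\<beta>2 \<in> carrier B. \<forall>\<beta>3 \<in> carrier B. \<forall>\<beta>4 \<in> carrier B.
      bact b k y \<beta> \<beta>1 \<longrightarrow> bact b k y' \<beta>1 \<beta>2 \<longrightarrow> bact b k y' \<beta> \<beta>3 \<longrightarrow> bact b k y \<beta>3 \<beta>4 \<longrightarrow> \<beta>2 = \<beta>4))"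

definition codes :: "(nat \<Rightarrow> 'x) \<Rightarrow> nat \<Rightarrow> (nat \<Rightarrow> 'x) \<Rightarrow> ('b \<Rightarrow> 'b) \<Rightarrow> bool" where
  "codes b k y \<alpha> \<longleftrightarrow> (\<forall>\<beta> \<in> carrier B. \<forall>\<beta>' \<in> carrier B. bact b k y \<beta> \<beta>' \<longleftrightarrow> \<beta>' = \<alpha> \<beta>)"

lemma tup_carrier: "y \<in> tup K k \<Longrightarrow> y j \<in> carrier K"
  by (cases "j < k") (simp_all add: tup_def)

context
  fixes b k assumes b: "b \<in> tup K k" and ok: "bok b k"
begin

lemma bact_unique:
  assumes "\<beta> \<in> carrier B" "\<beta>' \<in> carrier B" "\<beta>'' \<in> carrier B" "bact b k y \<beta> \<beta>'" "bact b k y \<beta> \<beta>''"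
  shows "\<beta>' = \<beta>''"
proof -
  have "p (\<beta>' \<otimes>\<^bsub>B\<^esub> inv\<^bsub>B\<^esub> \<beta>'') (b j) = \<one>\<^bsub>Q\<^esub>" if "j < k" for j
  proof -
    have "p \<beta>' (b j) = p \<beta>'' (b j)" using assms(4,5) that by (simp add: bact_def)
    then show ?thesis using assms tup_carrier[OF b, of j] by (simp add: p_mult_left p_inv_left)
  qed
  then have "\<beta>' \<otimes>\<^bsub>B\<^esub> inv\<^bsub>B\<^esub> \<beta>'' = \<one>\<^bsub>B\<^esub>" using ok assms unfolding bok_def by simp
  then show ?thesis using assms B.inv_equality[of \<beta>' "inv\<^bsub>B\<^esub> \<beta>''"] by simp
qed

lemma codesI:
  assumes "\<alpha> \<in> E" "\<And>\<beta> j. \<beta> \<in> carrier B \<Longrightarrow> j < k \<Longrightarrow> p (\<alpha> \<beta>) (b j) = p \<beta> (y j)"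
  shows "codes b k y \<alpha>"
  using assms bact_unique unfolding codes_def by (metis bact_def E_closed)

lemma E_code:
  assumes "\<alpha> \<in> E" shows "\<exists>y \<in> tup K k. codes b k y \<alpha>"
proof -
  have "\<exists>u. u \<in> carrier K \<and> (\<forall>\<beta> \<in> carrier B. p (\<alpha> \<beta>) (b j) = p \<beta> u)" for j
    using E_adj[OF assms tup_carrier[OF b, of j]] by blast
  then obtain u where u: "\<And>j. u j \<in> carrier K" "\<And>j \<beta>. \<beta> \<in> carrier B \<Longrightarrow> p (\<alpha> \<beta>) (b j) = p \<beta> (u j)" by metis
  let ?y = "\<lambda>j. if j < k then u j else \<one>\<^bsub>K\<^esub>"
  have "?y \<in> tup K k" using u by (simp add: tup_def)
  moreover have "codes b k ?y \<alpha>" by (rule codesI[OF assms]) (simp add: u)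
  ultimately show ?thesis by blast
qed

lemma codes_good: "\<alpha> \<in> E \<Longrightarrow> codes b k y \<alpha> \<Longrightarrow> bgood b k y"
  unfolding codes_def bgood_def by (metis E_closed)

lemma codes_eval: "codes b k y \<alpha> \<Longrightarrow> \<alpha> \<in> E \<Longrightarrow> \<beta> \<in> carrier B \<Longrightarrow> j < k \<Longrightarrow> p (\<alpha> \<beta>) (b j) = p \<beta> (y j)"
  unfolding codes_def bact_def using E_closed by metis

text \<open>Totality comes from \<open>bgood\<close>, additivity from uniqueness of values, and
  adjoints from the second clause of \<open>bok\<close>.\<close>

lemma code_E:
  assumes y: "y \<in> tup K k" and good: "bgood b k y" shows "\<exists>\<alpha> \<in> E. codes b k y \<alpha>"
proof -
  obtain f where f: "\<And>\<beta>. \<beta> \<in> carrier B \<Longrightarrow> f \<beta> \<in> carrier B" "\<And>\<beta>. \<beta> \<in> carrier B \<Longrightarrow> bact b k y \<beta> (f \<beta>)"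
    using good unfolding bgood_def by metis
  have E: "(\<lambda>\<beta> \<in> carrier B. f \<beta>) \<in> E"
  proof (rule EI)
    fix \<beta> \<gamma> assume bg: "\<beta> \<in> carrier B" "\<gamma> \<in> carrier B"
    have "bact b k y (\<beta> \<otimes>\<^bsub>B\<^esub> \<gamma>) (f \<beta> \<otimes>\<^bsub>B\<^esub> f \<gamma>)"
      using f[OF bg(1)] f[OF bg(2)] bg tup_carrier[OF b] tup_carrier[OF y]
      unfolding bact_def by (simp add: p_mult_left)
    then show "f (\<beta> \<otimes>\<^bsub>B\<^esub> \<gamma>) = f \<beta> \<otimes>\<^bsub>B\<^esub> f \<gamma>"
      by (rule bact_unique[OF B.m_closed[OF bg] f(1)[OF B.m_closed[OF bg]]
            B.m_closed[OF f(1)[OF bg(1)] f(1)[OF bg(2)]] f(2)[OF B.m_closed[OF bg]]])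
  next
    fix g assume "g \<in> carrier K"
    then show "\<exists>u \<in> carrier K. \<forall>\<beta> \<in> carrier B. p (f \<beta>) g = p \<beta> u"
      using ok y good f unfolding bok_def by meson
  qed (rule f(1))
  moreover have "codes b k y (\<lambda>\<beta> \<in> carrier B. f \<beta>)"
    by (rule codesI[OF E]) (use f in \<open>simp add: bact_def\<close>)
  ultimately show ?thesis by blast
qed

text \<open>Quantifying over good codes amounts to quantifying over \<open>E\<close>: every element
  of \<open>E\<close> has a code, and every good code belongs to an element of
  \<open>E\<close>.\<close>

lemma codes_com_iff:
  assumes "\<alpha> \<in> E" "codes b k y \<alpha>" shows "bcom b k y \<longleftrightarrow> \<alpha> \<in> C"
proof
  assume com: "bcom b k y"
  have "\<alpha> (\<gamma> \<beta>) = \<gamma> (\<alpha> \<beta>)" if g: "\<gamma> \<in> E" "\<beta> \<in> carrier B" for \<gamma> \<beta>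
  proof -
    obtain y' where y': "y' \<in> tup K k" "codes b k y' \<gamma>" using E_code[OF g(1)] by blast
    have "bact b k y \<beta> (\<alpha> \<beta>)" "bact b k y' (\<alpha> \<beta>) (\<gamma> (\<alpha> \<beta>))" "bact b k y' \<beta> (\<gamma> \<beta>)" "bact b k y (\<gamma> \<beta>) (\<alpha> (\<gamma> \<beta>))"
      using assms y'(2) g unfolding codes_def by simp_all
    then show ?thesis using com y'(1) codes_good[OF g(1) y'(2)] g assms(1) unfolding bcom_def
      by (metis E_closed)
  qed
  then show "\<alpha> \<in> C" using assms unfolding C_def by blast
next
  assume C: "\<alpha> \<in> C"
  have "\<beta>2 = \<beta>4" if y': "y' \<in> tup K k" "bgood b k y'" and
    c: "\<beta> \<in> carrier B" "\<beta>1 \<in> carrier B" "\<beta>2 \<in> carrier B" "\<beta>3 \<in> carrier B" "\<beta>4 \<in> carrier B" and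
    a: "bact b k y \<beta> \<beta>1" "bact b k y' \<beta>1 \<beta>2" "bact b k y' \<beta> \<beta>3" "bact b k y \<beta>3 \<beta>4"
    for y' \<beta> \<beta>1 \<beta>2 \<beta>3 \<beta>4
  proof -
    obtain \<gamma> where g: "\<gamma> \<in> E" "codes b k y' \<gamma>" using code_E[OF y'] by blast
    have "\<beta>1 = \<alpha> \<beta>" "\<beta>2 = \<gamma> \<beta>1" "\<beta>3 = \<gamma> \<beta>" "\<beta>4 = \<alpha> \<beta>3"
      using a c assms(2) g(2) unfolding codes_def by blast+
    then show ?thesis using C_comm[OF C g(1) c(1)] by simp
  qed
  then show "bcom b k y" using codes_good[OF assms] unfolding bcom_def by blast
qed

lemma code_C: "y \<in> tup K k \<Longrightarrow> bcom b k y \<Longrightarrow> \<exists>\<alpha> \<in> C. codes b k y \<alpha>"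
proof -
  assume y: "y \<in> tup K k" "bcom b k y"
  then have "bgood b k y" unfolding bcom_def by blast
  from code_E[OF y(1) this] obtain \<alpha> where a: "\<alpha> \<in> E" "codes b k y \<alpha>" by blast
  then show ?thesis using codes_com_iff[OF a] y(2) by blast
qed

lemma C_code: "\<alpha> \<in> C \<Longrightarrow> \<exists>y \<in> tup K k. bcom b k y \<and> codes b k y \<alpha>"
  using E_code[OF C_E] codes_com_iff[OF C_E] by metis

end

text \<open>The pairing is a homomorphism in its second argument, so for g a word in the
  \<open>b j\<close> the same word in the \<open>y j\<close> serves as u.\<close>

lemma bok_generate:
  assumes b: "b \<in> tup K k" "generate K (b ` {..<k}) = carrier K"
  shows "bok b k"
  unfolding bok_def
proof (intro conjI ballI impI)
  fix \<beta> assume beta: "\<beta> \<in> carrier B" and 1: "\<forall>j<k. p \<beta> (b j) = \<one>\<^bsub>Q\<^esub>"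
  interpret h: group_hom K Q "p \<beta>" by (rule right_hom[OF beta])
  have "b ` {..<k} \<subseteq> kernel K Q (p \<beta>)" using 1 tup_carrier[OF b(1)] by (auto simp: kernel_def)
  then have "carrier K \<subseteq> kernel K Q (p \<beta>)"
    using K.generate_subgroup_incl[OF _ h.subgroup_kernel] b(2) by metis
  then show "\<beta> = \<one>\<^bsub>B\<^esub>" using nondeg[OF beta] by (auto simp: kernel_def)
next
  fix y g assume y: "y \<in> tup K k" and good: "bgood b k y" and g: "g \<in> carrier K"
  let ?P = "\<lambda>g u. \<forall>\<beta> \<in> carrier B. \<forall>\<beta>' \<in> carrier B. bact b k y \<beta> \<beta>' \<longrightarrow> p \<beta>' g = p \<beta> u"
  have "g \<in> generate K (b ` {..<k})" using g b(2) by simp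
  then show "\<exists>u \<in> carrier K. ?P g u"
  proof (induction rule: generate.induct)
    case one
    show ?case by (intro bexI[of _ "\<one>\<^bsub>K\<^esub>"]) (simp_all add: p_one_right)
  next
    case (incl h)
    then obtain j where "j < k" "h = b j" by blast
    then show ?case using tup_carrier[OF y] by (intro bexI[of _ "y j"]) (simp_all add: bact_def)
  next
    case (inv h)
    then obtain j where "j < k" "h = b j" by blast
    then show ?case using tup_carrier[OF y] tup_carrier[OF b(1)]
      by (intro bexI[of _ "inv\<^bsub>K\<^esub> (y j)"]) (simp_all add: bact_def p_inv_right)
  next
    case (eng h1 h2)
    then obtain u v where "u \<in> carrier K" "?P h1 u" "v \<in> carrier K" "?P h2 v" by blast
    moreover have "h1 \<in> carrier K" "h2 \<in> carrier K" using eng.hyps b(2) by simp_all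
    ultimately show ?case by (intro bexI[of _ "u \<otimes>\<^bsub>K\<^esub> v"]) (simp_all add: p_mult_right)
  qed
qed

end

text \<open>Appending c to the coefficients replaces the leading x^n by c x^n + x^(n+1); x^n is
  added on the left so that no subtraction occurs.\<close>

lemma (in cring) hp_snoc:
  "set cs \<subseteq> carrier R \<Longrightarrow> c \<in> carrier R \<Longrightarrow> x \<in> carrier R \<Longrightarrow>
   hp R (cs @ [c]) x \<oplus> x [^] length cs = hp R cs x \<oplus> c \<otimes> x [^] length cs \<oplus> x [^] Suc (length cs)"
proof (induction cs)
  case Nil
  then show ?case by (simp add: a_ac)
next
  case (Cons a cs)
  have c: "a \<in> carrier R" "set cs \<subseteq> carrier R" using Cons.prems by simp_all
  have cl: "hp R (cs @ [c]) x \<in> carrier R" "hp R cs x \<in> carrier R" "x [^] length cs \<in> carrier R"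
    using c Cons.prems by simp_all
  have "hp R ((a # cs) @ [c]) x \<oplus> x [^] length (a # cs) = a \<oplus> x \<otimes> (hp R (cs @ [c]) x \<oplus> x [^] length cs)"
    using c cl Cons.prems by (simp add: r_distr m_comm a_ac)
  also have "\<dots> = a \<oplus> x \<otimes> (hp R cs x \<oplus> c \<otimes> x [^] length cs \<oplus> x [^] length cs \<otimes> x)"
    using Cons.IH[OF c(2) Cons.prems(2,3)] by simp
  also have "\<dots> = (a \<oplus> x \<otimes> hp R cs x) \<oplus> c \<otimes> (x [^] length cs \<otimes> x) \<oplus> (x [^] length cs \<otimes> x) \<otimes> x"
    using c cl Cons.prems(2,3) by algebra
  finally show ?case by simp
qed

section \<open>Integrality and generators of the ring C\<close>

context pairing
begin

text \<open>The integer spans of 1, \<alpha>, ..., \<alpha>^(q-1) ascend with q in a group with the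
  maximal condition, so some \<alpha>^n is an integer combination of lower powers.\<close>

lemma integral:
  assumes noeth: "noeth B" and a: "\<alpha> \<in> C"
  shows "\<exists>cs. hp R (int_coeffs cs) \<alpha> = \<zero>\<^bsub>R\<^esub>"
proof -
  let ?A = "add_monoid R"
  have gA: "group ?A" by (rule addR_group)
  have pw: "\<alpha> [^]\<^bsub>R\<^esub> (t::nat) \<in> C" for t using R.nat_pow_closed[of \<alpha> t] a by simp
  have pw': "\<alpha> [^]\<^bsub>R\<^esub> (t::nat) \<in> carrier ?A" for t using pw by simp
  let ?U = "\<lambda>q::nat. generate ?A ((\<lambda>t. \<alpha> [^]\<^bsub>R\<^esub> t) ` {..<q})"
  have "\<exists>n. \<forall>m\<ge>n. ?U m = ?U n"
  proof (rule noeth_chain[OF noeth_R[OF noeth]])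
    show "subgroup (?U q) ?A" for q by (rule group.generate_is_subgroup[OF gA]) (use pw' in blast)
    show "?U q \<subseteq> ?U (Suc q)" for q by (rule generate_monotone) auto
  qed
  then obtain n where "?U (Suc n) = ?U n" by (meson le_SucI le_refl)
  moreover have "\<alpha> [^]\<^bsub>R\<^esub> n \<in> ?U (Suc n)" by (rule generate.incl) blast
  ultimately have "\<alpha> [^]\<^bsub>R\<^esub> n \<in> ?U n" by simp
  from comm_group.generate_lprod[OF addR pw' this]
  obtain e :: "nat \<Rightarrow> int" where e: "\<alpha> [^]\<^bsub>R\<^esub> n = lprod ?A (\<lambda>t. (\<alpha> [^]\<^bsub>R\<^esub> t) [^]\<^bsub>?A\<^esub> e t) n" by blast
  \<comment> \<open>\<open>L m\<close> is the part below degree m of the polynomial with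
    coefficients -e t; the relation found for \<alpha>^n becomes L n = -\<alpha>^n.\<close>
  define L where "L m = lprod ?A (\<lambda>t. (\<alpha> [^]\<^bsub>R\<^esub> t) [^]\<^bsub>?A\<^esub> (- e t)) m" for m
  have LC: "L m \<in> C" for m
    using monoid.lprod_closed[OF group.is_monoid[OF gA], of m "\<lambda>t. (\<alpha> [^]\<^bsub>R\<^esub> t) [^]\<^bsub>?A\<^esub> (- e t)"]
      group.int_pow_closed[OF gA pw'] by (simp add: L_def)
  have hpL: "hp R (int_coeffs (map (\<lambda>t. - e t) [0..<m])) \<alpha> = L m \<oplus>\<^bsub>R\<^esub> \<alpha> [^]\<^bsub>R\<^esub> m" for m
  proof (induction m)
    case 0
    show ?case using R.l_zero[of "\<one>\<^bsub>R\<^esub>"] R_closed(3) by (simp add: L_def)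
  next
    case (Suc m)
    let ?cs = "int_coeffs (map (\<lambda>t. - e t) [0..<m])"
    let ?c = "add_pow R (- e m) \<one>\<^bsub>R\<^esub>"
    have cC: "?c \<in> carrier R" using R.add.int_pow_closed[OF R.one_closed] .
    have cs: "set ?cs \<subseteq> carrier R" unfolding R_simps(1) by (rule int_coeffs_closed)
    have len: "length ?cs = m" by simp
    have step: "hp R (?cs @ [?c]) \<alpha> \<oplus>\<^bsub>R\<^esub> \<alpha> [^]\<^bsub>R\<^esub> m = hp R ?cs \<alpha> \<oplus>\<^bsub>R\<^esub> ?c \<otimes>\<^bsub>R\<^esub> \<alpha> [^]\<^bsub>R\<^esub> m \<oplus>\<^bsub>R\<^esub> \<alpha> [^]\<^bsub>R\<^esub> Suc m"
      using R.hp_snoc[OF cs cC, of \<alpha>] a unfolding len by simp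
    have h1: "hp R (?cs @ [?c]) \<alpha> \<in> carrier R" using R.hp_closed[of "?cs @ [?c]" \<alpha>] cs cC a by simp
    have c1: "?c \<otimes>\<^bsub>R\<^esub> \<alpha> [^]\<^bsub>R\<^esub> m = (\<alpha> [^]\<^bsub>R\<^esub> m) [^]\<^bsub>?A\<^esub> (- e m)"
    proof -
      have "?c \<otimes>\<^bsub>R\<^esub> \<alpha> [^]\<^bsub>R\<^esub> m = add_pow R (- e m) (\<one>\<^bsub>R\<^esub> \<otimes>\<^bsub>R\<^esub> \<alpha> [^]\<^bsub>R\<^esub> m)"
        by (rule R.add_pow_ldistr_int) (use pw R_closed in simp_all)
      then show ?thesis using R.l_one pw by (simp add: add_pow_def)
    qed
    have c2: "(\<alpha> [^]\<^bsub>R\<^esub> m) [^]\<^bsub>?A\<^esub> (- e m) \<in> carrier R" using group.int_pow_closed[OF gA pw'] by simp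
    have "hp R (?cs @ [?c]) \<alpha> \<oplus>\<^bsub>R\<^esub> \<alpha> [^]\<^bsub>R\<^esub> m =
        (L m \<oplus>\<^bsub>R\<^esub> (\<alpha> [^]\<^bsub>R\<^esub> m) [^]\<^bsub>?A\<^esub> (- e m) \<oplus>\<^bsub>R\<^esub> \<alpha> [^]\<^bsub>R\<^esub> Suc m) \<oplus>\<^bsub>R\<^esub> \<alpha> [^]\<^bsub>R\<^esub> m"
    proof -
      have l: "L m \<in> carrier R" "\<alpha> [^]\<^bsub>R\<^esub> m \<in> carrier R" "\<alpha> [^]\<^bsub>R\<^esub> Suc m \<in> carrier R"
        using LC pw[of m] pw[of "Suc m"] by simp_all
      show ?thesis unfolding step Suc.IH c1 using l c2 by algebra
    qed
    moreover have "L (Suc m) = L m \<oplus>\<^bsub>R\<^esub> (\<alpha> [^]\<^bsub>R\<^esub> m) [^]\<^bsub>?A\<^esub> (- e m)" by (simp add: L_def)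
    ultimately have "hp R (?cs @ [?c]) \<alpha> \<oplus>\<^bsub>R\<^esub> \<alpha> [^]\<^bsub>R\<^esub> m = (L (Suc m) \<oplus>\<^bsub>R\<^esub> \<alpha> [^]\<^bsub>R\<^esub> Suc m) \<oplus>\<^bsub>R\<^esub> \<alpha> [^]\<^bsub>R\<^esub> m" by simp
    moreover have "L (Suc m) \<oplus>\<^bsub>R\<^esub> \<alpha> [^]\<^bsub>R\<^esub> Suc m \<in> carrier R"
      using R.a_closed[of "L (Suc m)" "\<alpha> [^]\<^bsub>R\<^esub> Suc m"] LC pw[of "Suc m"] by simp
    ultimately have "hp R (?cs @ [?c]) \<alpha> = L (Suc m) \<oplus>\<^bsub>R\<^esub> \<alpha> [^]\<^bsub>R\<^esub> Suc m"
      using R.add.r_cancel h1 pw[of m] by (metis R_simps(1))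
    then show ?case by simp
  qed
  have "L n = inv\<^bsub>?A\<^esub> (\<alpha> [^]\<^bsub>R\<^esub> n)"
  proof -
    have "L n = lprod ?A (\<lambda>t. inv\<^bsub>?A\<^esub> ((\<alpha> [^]\<^bsub>R\<^esub> t) [^]\<^bsub>?A\<^esub> e t)) n"
      unfolding L_def by (rule lprod_cong) (rule group.int_pow_neg[OF gA pw'])
    also have "\<dots> = inv\<^bsub>?A\<^esub> (lprod ?A (\<lambda>t. (\<alpha> [^]\<^bsub>R\<^esub> t) [^]\<^bsub>?A\<^esub> e t) n)"
      by (rule comm_group.lprod_inv[OF addR]) (rule group.int_pow_closed[OF gA pw'])
    finally show ?thesis using e by simp
  qed
  then have "L n = \<ominus>\<^bsub>R\<^esub> (\<alpha> [^]\<^bsub>R\<^esub> n)" by (simp add: a_inv_def)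
  then have "L n \<oplus>\<^bsub>R\<^esub> \<alpha> [^]\<^bsub>R\<^esub> n = \<zero>\<^bsub>R\<^esub>" using R.l_neg[of "\<alpha> [^]\<^bsub>R\<^esub> n"] pw[of n] by simp
  then show ?thesis using hpL[of n] by metis
qed

text \<open>Generators of the nilradical come first, at indices below \<open>d'\<close>, and carry
  the polynomial X^KG; the remaining ones carry any integral equation. In one list, all are coded
  and transferred in the same way.\<close>

lemma C_generators:
  assumes noeth: "noeth B"
  shows "\<exists>(d::nat) d' x cs KG. d' \<le> d \<and> (\<forall>l<d. x l \<in> C) \<and> generate (add_monoid R) (x ` {..<d}) = C \<and>
    generate (add_monoid R) (x ` {..<d'}) = rad R {\<zero>\<^bsub>R\<^esub>} \<and>
    (\<forall>l<d. \<forall>\<beta> \<in> carrier B. hpv B (x l) (cs l) \<beta> = \<one>\<^bsub>B\<^esub>) \<and> (\<forall>l<d'. cs l = replicate KG (0::int))"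
proof -
  let ?A = "add_monoid R"
  have nR: "noeth ?A" by (rule noeth_R[OF noeth])
  have gA: "group ?A" by (rule addR_group)
  obtain T where T: "finite T" "T \<subseteq> C" "generate ?A T = C"
    using nR group.subgroup_self[OF gA] unfolding noeth_def fgs_def by (auto simp: R_simps)
  obtain T' where T': "finite T'" "T' \<subseteq> C" "generate ?A T' = rad R {\<zero>\<^bsub>R\<^esub>}"
    using nR rad_subgroup[OF cring_R] unfolding noeth_def fgs_def by (auto simp: R_simps)
  obtain ts ts' where ts: "set ts = T" "set ts' = T'" using finite_list T(1) T'(1) by metis
  obtain KG :: nat where KG: "\<forall>r \<in> rad R {\<zero>\<^bsub>R\<^esub>}. r [^]\<^bsub>R\<^esub> KG = \<zero>\<^bsub>R\<^esub>"
    using nilpotency_bound[OF cring_R nR] by blast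
  let ?d = "length (ts' @ ts)" and ?d' = "length ts'" and ?x = "\<lambda>l. (ts' @ ts) ! l"
  have im: "?x ` {..<?d} = T' \<union> T"
    using ts by (metis nth_image atLeast0LessThan le_refl set_append take_all)
  have im': "?x ` {..<?d'} = T'"
    using ts(2) by (metis (no_types, lifting) atLeast0LessThan image_cong length_append lessThan_iff
        list.set_map map_nth nth_append set_upt)
  have xC: "?x l \<in> C" if "l < ?d" for l using im that T(2) T'(2) by blast
  have xr: "?x l \<in> rad R {\<zero>\<^bsub>R\<^esub>}" if "l < ?d'" for l
    using im' that T'(3) subset_generate[of T' T' ?A] by blast
  have "\<exists>cs. hp R (int_coeffs cs) (?x l) = \<zero>\<^bsub>R\<^esub>" if "l < ?d" for l using integral[OF noeth xC[OF that]] .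
  then obtain cs0 where cs0: "\<And>l. l < ?d \<Longrightarrow> hp R (int_coeffs (cs0 l)) (?x l) = \<zero>\<^bsub>R\<^esub>" by metis
  define cs where "cs l = (if l < ?d' then replicate KG 0 else cs0 l)" for l
  have "hpv B (?x l) (cs l) \<beta> = \<one>\<^bsub>B\<^esub>" if l: "l < ?d" and b: "\<beta> \<in> carrier B" for l \<beta>
  proof (cases "l < ?d'")
    case True
    then have "?x l [^]\<^bsub>R\<^esub> KG = \<zero>\<^bsub>R\<^esub>" using KG xr by blast
    then show ?thesis using hpv_replicate_iff[OF xC[OF l]] b True by (simp add: cs_def)
  next
    case False
    then show ?thesis using hp_zero_iff[OF xC[OF l]] cs0[OF l] b by (simp add: cs_def)
  qed
  moreover have "generate ?A (?x ` {..<?d}) = C"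
  proof
    show "generate ?A (?x ` {..<?d}) \<subseteq> C"
      using group.generate_incl[OF gA, of "T' \<union> T"] T(2) T'(2) unfolding im by simp
    show "C \<subseteq> generate ?A (?x ` {..<?d})"
      using generate_monotone[of T "T' \<union> T" ?A] T(3) unfolding im by blast
  qed
  ultimately have "?d' \<le> ?d \<and> (\<forall>l<?d. ?x l \<in> C) \<and> generate ?A (?x ` {..<?d}) = C \<and>
    generate ?A (?x ` {..<?d'}) = rad R {\<zero>\<^bsub>R\<^esub>} \<and>
    (\<forall>l<?d. \<forall>\<beta> \<in> carrier B. hpv B (?x l) (cs l) \<beta> = \<one>\<^bsub>B\<^esub>) \<and> (\<forall>l<?d'. cs l = replicate KG (0::int))"
    using xC T'(3) unfolding im' by (intro conjI allI impI ballI) (simp_all add: cs_def)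
  then show ?thesis
    by (intro exI) assumption
qed

lemma C_digits:
  fixes d n :: nat
  assumes x: "\<And>l. l < d \<Longrightarrow> x l \<in> C" and g: "generate (add_monoid R) (x ` {..<d}) = C" and n: "0 < n" and r: "r \<in> C"
  shows "\<exists>e \<in> digits d n. \<exists>u \<in> C. r = lprod (add_monoid R) (\<lambda>l. x l [^]\<^bsub>add_monoid R\<^esub> e l) d \<oplus>\<^bsub>R\<^esub> add_pow R n u"
proof -
  let ?A = "add_monoid R"
  have xA: "\<And>l. l < d \<Longrightarrow> x l \<in> carrier ?A" using x by simp
  obtain e :: "nat \<Rightarrow> int" where e: "r = lprod ?A (\<lambda>l. x l [^]\<^bsub>?A\<^esub> e l) d"
    using comm_group.generate_lprod[OF addR, of d x r] xA g r by blast
  obtain f and q :: "nat \<Rightarrow> int" where f: "f \<in> digits d n"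
    "lprod ?A (\<lambda>l. x l [^]\<^bsub>?A\<^esub> e l) d =
      lprod ?A (\<lambda>l. x l [^]\<^bsub>?A\<^esub> f l) d \<otimes>\<^bsub>?A\<^esub> lprod ?A (\<lambda>l. x l [^]\<^bsub>?A\<^esub> q l) d [^]\<^bsub>?A\<^esub> n"
    using comm_group.lprod_digits[OF addR, of d x n e] xA n by blast
  have "lprod ?A (\<lambda>l. x l [^]\<^bsub>?A\<^esub> q l) d \<in> C"
    using monoid.lprod_closed[OF group.is_monoid[OF addR_group], of d "\<lambda>l. x l [^]\<^bsub>?A\<^esub> q l"]
      group.int_pow_closed[OF addR_group xA] by simp
  then show ?thesis using f e by (intro bexI[of _ f] bexI[of _ "lprod ?A (\<lambda>l. x l [^]\<^bsub>?A\<^esub> q l) d"]) (simp_all add: add_pow_def)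
qed

text \<open>The integer coefficients of r are unbounded and could not appear in a formula. Moving
  them from x_l onto the argument, as x_l applied to a power of \<beta>, leaves only elements of
  \<open>B\<close> to be quantified.\<close>

lemma rad_image:
  fixes d' :: nat
  assumes x: "\<And>l. l < d' \<Longrightarrow> x l \<in> C" and r: "r \<in> generate (add_monoid R) (x ` {..<d'})" and b: "\<beta> \<in> carrier B"
  shows "\<exists>us. (\<forall>l<d'. us l \<in> carrier B) \<and> r \<beta> = lprod B (\<lambda>l. x l (us l)) d'"
proof -
  let ?A = "add_monoid R"
  have xA: "\<And>l. l < d' \<Longrightarrow> x l \<in> carrier ?A" using x by simp
  obtain e :: "nat \<Rightarrow> int" where e: "r = lprod ?A (\<lambda>l. x l [^]\<^bsub>?A\<^esub> e l) d'"
    using comm_group.generate_lprod[OF addR xA r] by blast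
  interpret ev: group_hom ?A B "\<lambda>\<alpha>. \<alpha> \<beta>" by (rule ev_hom[OF b])
  have "r \<beta> = lprod B (\<lambda>l. (x l [^]\<^bsub>?A\<^esub> e l) \<beta>) d'"
    unfolding e by (rule ev.hom_lprod) (rule group.int_pow_closed[OF addR_group xA])
  also have "\<dots> = lprod B (\<lambda>l. x l (\<beta> [^]\<^bsub>B\<^esub> e l)) d'"
  proof (rule lprod_cong)
    fix l assume l: "l < d'"
    interpret xl: group_hom B B "x l" using E_hom C_E x[OF l] by blast
    show "(x l [^]\<^bsub>?A\<^esub> e l) \<beta> = x l (\<beta> [^]\<^bsub>B\<^esub> e l)"
      using ev.hom_int_pow[OF xA[OF l]] xl.hom_int_pow[OF b] by simp
  qed
  finally show ?thesis using b by (intro exI[of _ "\<lambda>l. \<beta> [^]\<^bsub>B\<^esub> e l"]) simp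
qed

text \<open>The C-submodule generated by t_0, ..., t_(s-1), built by adding one generator per step
  so that membership becomes a formula for fixed \<open>s\<close>.\<close>

primrec spn :: "(nat \<Rightarrow> 'b) \<Rightarrow> nat \<Rightarrow> 'b set" where
  "spn t 0 = {\<one>\<^bsub>B\<^esub>}"
| "spn t (Suc s) = {\<beta> \<otimes>\<^bsub>B\<^esub> r (t s) |\<beta> r. \<beta> \<in> spn t s \<and> r \<in> C}"

text \<open>Integer multiples of the identity belong to \<open>C\<close>, so integer combinations
  are C-combinations.\<close>

lemma generate_spn:
  assumes t: "\<And>i. i < s \<Longrightarrow> t i \<in> carrier B" and g: "\<beta> \<in> generate B (t ` {..<s})"
  shows "\<beta> \<in> spn t s"
proof -
  obtain e :: "nat \<Rightarrow> int" where e: "\<beta> = lprod B (\<lambda>i. t i [^]\<^bsub>B\<^esub> e i) s"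
    using B.generate_lprod[OF t g] by blast
  have "lprod B (\<lambda>i. t i [^]\<^bsub>B\<^esub> e i) m \<in> spn t m" if "m \<le> s" for m
    using that
  proof (induction m)
    case (Suc m)
    have "add_pow R (e m) \<one>\<^bsub>R\<^esub> \<in> C" using R.add.int_pow_closed[OF R.one_closed] by simp
    moreover have "add_pow R (e m) \<one>\<^bsub>R\<^esub> (t m) = t m [^]\<^bsub>B\<^esub> e m"
      using add_pow_eval(1)[OF R_closed(3), of "t m"] t[of m] Suc.prems by simp
    ultimately show ?case using Suc by (auto intro!: exI[of _ "add_pow R (e m) \<one>\<^bsub>R\<^esub>"])
  qed simp
  then show ?thesis using e by simp
qed

text \<open>Additively, this is S + x_0 B + ... + x_(d-1) B.\<close>

definition dset :: "(nat \<Rightarrow> 'b \<Rightarrow> 'b) \<Rightarrow> 'b set \<Rightarrow> nat \<Rightarrow> 'b set" where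
  "dset x S d = {\<sigma> \<otimes>\<^bsub>B\<^esub> lprod B (\<lambda>l. x l (us l)) d |\<sigma> us. \<sigma> \<in> S \<and> (\<forall>l<d. us l \<in> carrier B)}"

lemma dset_mult:
  assumes S: "subgroup S B" and x: "\<And>l. l < d \<Longrightarrow> x l \<in> C" and "\<beta> \<in> dset x S d" "\<gamma> \<in> dset x S d"
  shows "\<beta> \<otimes>\<^bsub>B\<^esub> \<gamma> \<in> dset x S d"
proof -
  obtain \<sigma> us \<tau> vs where *: "\<sigma> \<in> S" "\<forall>l<d. us l \<in> carrier B" "\<beta> = \<sigma> \<otimes>\<^bsub>B\<^esub> lprod B (\<lambda>l. x l (us l)) d"
    "\<tau> \<in> S" "\<forall>l<d. vs l \<in> carrier B" "\<gamma> = \<tau> \<otimes>\<^bsub>B\<^esub> lprod B (\<lambda>l. x l (vs l)) d"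
    using assms(3,4) unfolding dset_def by blast
  have c: "\<sigma> \<in> carrier B" "\<tau> \<in> carrier B" using * subgroup.mem_carrier[OF S] by blast+
  have l: "lprod B (\<lambda>l. x l (us l)) d \<in> carrier B" "lprod B (\<lambda>l. x l (vs l)) d \<in> carrier B"
    using * x by (simp_all add: B.lprod_closed)
  have "lprod B (\<lambda>l. x l (us l \<otimes>\<^bsub>B\<^esub> vs l)) d = lprod B (\<lambda>l. x l (us l) \<otimes>\<^bsub>B\<^esub> x l (vs l)) d"
    by (rule lprod_cong) (use * x E_mult C_E in simp)
  also have "\<dots> = lprod B (\<lambda>l. x l (us l)) d \<otimes>\<^bsub>B\<^esub> lprod B (\<lambda>l. x l (vs l)) d"
    by (rule B.lprod_mult) (use * x in simp_all)
  finally have "\<beta> \<otimes>\<^bsub>B\<^esub> \<gamma> = (\<sigma> \<otimes>\<^bsub>B\<^esub> \<tau>) \<otimes>\<^bsub>B\<^esub> lprod B (\<lambda>l. x l (us l \<otimes>\<^bsub>B\<^esub> vs l)) d"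
    using * c l by (simp add: B.m_ac)
  moreover have "\<sigma> \<otimes>\<^bsub>B\<^esub> \<tau> \<in> S" using subgroup.m_closed[OF S *(1,4)] .
  ultimately show ?thesis using *(2,5) unfolding dset_def by (intro CollectI exI[of _ "\<sigma> \<otimes>\<^bsub>B\<^esub> \<tau>"] exI[of _ "\<lambda>l. us l \<otimes>\<^bsub>B\<^esub> vs l"]) simp
qed

lemma dset_stable:
  assumes S: "subgroup S B" and x: "\<And>l. l < d \<Longrightarrow> x l \<in> C" and a: "\<alpha> \<in> C" "\<And>\<sigma>. \<sigma> \<in> S \<Longrightarrow> \<alpha> \<sigma> \<in> S"
    and b: "\<beta> \<in> dset x S d"
  shows "\<alpha> \<beta> \<in> dset x S d"
proof -
  obtain \<sigma> us where *: "\<sigma> \<in> S" "\<forall>l<d. us l \<in> carrier B" "\<beta> = \<sigma> \<otimes>\<^bsub>B\<^esub> lprod B (\<lambda>l. x l (us l)) d"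
    using b unfolding dset_def by blast
  interpret a: group_hom B B \<alpha> using E_hom C_E a(1) by blast
  have c: "\<sigma> \<in> carrier B" using * subgroup.mem_carrier[OF S] by blast
  have "\<alpha> (lprod B (\<lambda>l. x l (us l)) d) = lprod B (\<lambda>l. \<alpha> (x l (us l))) d"
    by (rule a.hom_lprod) (use * x in simp)
  also have "\<dots> = lprod B (\<lambda>l. x l (\<alpha> (us l))) d"
    by (rule lprod_cong) (use C_comm[OF a(1) C_E[OF x]] *(2) in simp)
  finally have "\<alpha> \<beta> = \<alpha> \<sigma> \<otimes>\<^bsub>B\<^esub> lprod B (\<lambda>l. x l (\<alpha> (us l))) d"
    using * c x by (simp add: B.lprod_closed)
  then show ?thesis using a * unfolding dset_def by (intro CollectI exI[of _ "\<alpha> \<sigma>"] exI[of _ "\<lambda>l. \<alpha> (us l)"]) simp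
qed

text \<open>A Nakayama argument. Let D be the sum without its last term x_d B. D is stable under
  x_d, so substituting B = D + x_d B into itself gives B = D + x_d^n B for every n; nilpotency
  leaves B = D, and induction removes the other terms.\<close>

lemma nilpotent_elimination:
  assumes S: "subgroup S B" and x: "\<And>l. l < d \<Longrightarrow> x l \<in> C" and st: "\<And>l \<sigma>. l < d \<Longrightarrow> \<sigma> \<in> S \<Longrightarrow> x l \<sigma> \<in> S"
    and nil: "\<And>l. l < d \<Longrightarrow> x l [^]\<^bsub>R\<^esub> (m::nat) = \<zero>\<^bsub>R\<^esub>" and full: "carrier B \<subseteq> dset x S d"
  shows "carrier B = S"
  using x st nil full
proof (induction d)
  case 0
  then show ?case using subgroup.subset[OF S] subgroup.mem_carrier[OF S] by (auto simp: dset_def)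
next
  case (Suc d)
  have xd: "x d \<in> C" using Suc.prems(1) by simp
  have pw: "x d [^]\<^bsub>R\<^esub> (n::nat) \<in> C" for n using R.nat_pow_closed[of "x d" n] xd by simp
  note st' = Suc.prems(2)[OF lessI]
  have st: "(x d [^]\<^bsub>R\<^esub> (n::nat)) \<sigma> \<in> S" if "\<sigma> \<in> S" for n \<sigma>
    using that
  proof (induction n arbitrary: \<sigma>)
    case (Suc n)
    have "x d \<sigma> \<in> S" using st' Suc.prems by simp
    moreover have "\<sigma> \<in> carrier B" by (rule subgroup.mem_carrier[OF S Suc.prems])
    ultimately show ?case using Suc.IH[of "x d \<sigma>"] by (simp only: R.nat_pow_Suc R_simps(2))
  next
    case 0
    then show ?case using subgroup.mem_carrier[OF S] by simp
  qed
  have dec: "\<exists>\<delta> \<in> dset x S d. \<exists>u \<in> carrier B. \<beta> = \<delta> \<otimes>\<^bsub>B\<^esub> x d u" if b: "\<beta> \<in> carrier B" for \<beta>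
  proof -
    obtain \<sigma> us where *: "\<sigma> \<in> S" "\<forall>l<Suc d. us l \<in> carrier B" "\<beta> = \<sigma> \<otimes>\<^bsub>B\<^esub> lprod B (\<lambda>l. x l (us l)) (Suc d)"
      using subsetD[OF Suc.prems(4) b] unfolding dset_def mem_Collect_eq by (elim exE conjE)
    have "\<beta> = (\<sigma> \<otimes>\<^bsub>B\<^esub> lprod B (\<lambda>l. x l (us l)) d) \<otimes>\<^bsub>B\<^esub> x d (us d)"
      using * Suc.prems(1) subgroup.mem_carrier[OF S *(1)] by (simp add: B.m_assoc B.lprod_closed)
    moreover have "\<sigma> \<otimes>\<^bsub>B\<^esub> lprod B (\<lambda>l. x l (us l)) d \<in> dset x S d"
      using *(1,2) unfolding dset_def by (intro CollectI exI[of _ \<sigma>] exI[of _ us]) simp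
    ultimately show ?thesis using *(2) by blast
  qed
  have dc: "\<delta> \<in> carrier B" if "\<delta> \<in> dset x S d" for \<delta>
    using that Suc.prems(1) subgroup.mem_carrier[OF S] by (auto simp: dset_def B.lprod_closed)
  have x': "\<And>l. l < d \<Longrightarrow> x l \<in> C" using Suc.prems(1) by simp
  have it: "\<exists>\<delta> \<in> dset x S d. \<exists>u \<in> carrier B. \<beta> = \<delta> \<otimes>\<^bsub>B\<^esub> (x d [^]\<^bsub>R\<^esub> n) u" if "\<beta> \<in> carrier B" for \<beta> and n :: nat
  proof (induction n)
    case 0
    have "\<one>\<^bsub>B\<^esub> \<in> dset x S d"
    proof -
      have "lprod B (\<lambda>l. x l \<one>\<^bsub>B\<^esub>) d = lprod B (\<lambda>l. \<one>\<^bsub>B\<^esub>) d"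
        by (rule lprod_cong) (use x' E_one C_E in simp)
      then have "\<one>\<^bsub>B\<^esub> = \<one>\<^bsub>B\<^esub> \<otimes>\<^bsub>B\<^esub> lprod B (\<lambda>l. x l \<one>\<^bsub>B\<^esub>) d" by (simp add: B.lprod_one)
      then show ?thesis unfolding dset_def using subgroup.one_closed[OF S]
        by (intro CollectI exI[of _ "\<one>\<^bsub>B\<^esub>"] exI[of _ "\<lambda>_. \<one>\<^bsub>B\<^esub>"]) simp
    qed
    then show ?case using that by (rule_tac x = "\<one>\<^bsub>B\<^esub>" in bexI, rule_tac x = \<beta> in bexI) simp_all
  next
    case (Suc n)
    then obtain \<delta> u where 1: "\<delta> \<in> dset x S d" "u \<in> carrier B" "\<beta> = \<delta> \<otimes>\<^bsub>B\<^esub> (x d [^]\<^bsub>R\<^esub> n) u" by blast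
    obtain \<epsilon> w where 2: "\<epsilon> \<in> dset x S d" "w \<in> carrier B" "u = \<epsilon> \<otimes>\<^bsub>B\<^esub> x d w" using dec[OF 1(2)] by blast
    have e: "(x d [^]\<^bsub>R\<^esub> n) \<epsilon> \<in> dset x S d" by (rule dset_stable[OF S x' pw st 2(1)])
    have "(x d [^]\<^bsub>R\<^esub> n) u = (x d [^]\<^bsub>R\<^esub> n) \<epsilon> \<otimes>\<^bsub>B\<^esub> (x d [^]\<^bsub>R\<^esub> Suc n) w"
      using 2 dc E_mult[OF C_E[OF pw]] xd by simp
    then have "\<beta> = (\<delta> \<otimes>\<^bsub>B\<^esub> (x d [^]\<^bsub>R\<^esub> n) \<epsilon>) \<otimes>\<^bsub>B\<^esub> (x d [^]\<^bsub>R\<^esub> Suc n) w"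
      using 1 2 dc dc[OF e] C_closed[OF pw[of "Suc n"] 2(2)] by (simp add: B.m_assoc)
    then show ?case using dset_mult[OF S x' 1(1) e] 2(2) by blast
  qed
  have "carrier B \<subseteq> dset x S d"
  proof
    fix \<beta> assume b: "\<beta> \<in> carrier B"
    obtain \<delta> u where "\<delta> \<in> dset x S d" "u \<in> carrier B" "\<beta> = \<delta> \<otimes>\<^bsub>B\<^esub> (x d [^]\<^bsub>R\<^esub> m) u" using it[OF b] by blast
    then show "\<beta> \<in> dset x S d" using Suc.prems(3)[of d] dc by simp
  qed
  then show ?case using Suc by simp
qed

text \<open>For almost all N, \<open>finitely_many_bad_families\<close> writes each r in
  \<open>C\<close> as g + v with g in the additive span of the \<open>x N l\<close> and v in the
  nilradical. \<open>S N\<close> is stable under g, and \<open>nil\<close> puts the values of v into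
  the sum of the images of the \<open>x N l\<close> with l < d'. Since the \<open>t N i\<close> span
  \<open>B\<close>, it is \<open>S N\<close> plus these images, and
  \<open>nilpotent_elimination\<close> removes them.\<close>

lemma finitely_many_bad_levels:
  fixes x :: "nat \<Rightarrow> nat \<Rightarrow> 'b \<Rightarrow> 'b" and t :: "nat \<Rightarrow> nat \<Rightarrow> 'b" and d d' s KG KH :: nat
  assumes noeth: "noeth B" and d': "d' \<le> d"
    and x: "\<And>N l. l < d \<Longrightarrow> x N l \<in> C" and t: "\<And>N i. i < s \<Longrightarrow> t N i \<in> carrier B"
    and cs: "\<And>N l \<beta>. l < d \<Longrightarrow> \<beta> \<in> carrier B \<Longrightarrow> hpv B (x N l) (cs l) \<beta> = \<one>\<^bsub>B\<^esub>"
      "\<And>l. l < d' \<Longrightarrow> cs l = replicate KG 0"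
    and div: "\<And>N r. r \<in> C \<Longrightarrow> \<exists>g \<in> generate (add_monoid R) (x N ` {..<d}). \<exists>u \<in> C. r = g \<oplus>\<^bsub>R\<^esub> add_pow R (fact N :: nat) u"
    and full: "\<And>N. carrier B \<subseteq> spn (t N) s"
    and KH: "\<And>r. r \<in> rad R {\<zero>\<^bsub>R\<^esub>} \<Longrightarrow> r [^]\<^bsub>R\<^esub> KH = \<zero>\<^bsub>R\<^esub>"
    and nil: "\<And>N r \<beta>. r \<in> C \<Longrightarrow> r [^]\<^bsub>R\<^esub> KH = \<zero>\<^bsub>R\<^esub> \<Longrightarrow> \<beta> \<in> carrier B \<Longrightarrow>
      \<exists>us. (\<forall>l<d'. us l \<in> carrier B) \<and> r \<beta> = lprod B (\<lambda>l. x N l (us l)) d'"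
    and S: "\<And>N. subgroup (S N) B" "\<And>N l \<sigma>. l < d \<Longrightarrow> \<sigma> \<in> S N \<Longrightarrow> x N l \<sigma> \<in> S N" "\<And>N i. i < s \<Longrightarrow> t N i \<in> S N"
  shows "finite {N. S N \<noteq> carrier B}"
proof -
  let ?A = "add_monoid R"
  let ?Bad = "{N. \<not> (\<forall>r \<in> carrier R. \<exists>g \<in> generate ?A (x N ` {..<d}). r \<ominus>\<^bsub>R\<^esub> g \<in> rad R {\<zero>\<^bsub>R\<^esub>})}"
  have fin: "finite ?Bad"
  proof (rule finitely_many_bad_families[OF cring_R noeth_R[OF noeth], of d x "\<lambda>l. int_coeffs (cs l)"])
    show "hp R (int_coeffs (cs l)) (x N l) = \<zero>\<^bsub>R\<^esub>" if "l < d" for N l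
      using hp_zero_iff[OF x[OF that]] cs(1)[OF that] by blast
  qed (use x int_coeffs_closed div in simp_all)
  have "S N = carrier B" if N: "N \<notin> ?Bad" for N
  proof -
    have x': "\<And>l. l < d' \<Longrightarrow> x N l \<in> C" using x d' by simp
    have stable: "g \<sigma> \<in> S N" if "g \<in> generate ?A (x N ` {..<d})" "\<sigma> \<in> S N" for g \<sigma>
    proof -
      have sc: "\<sigma> \<in> carrier B" using subgroup.mem_carrier[OF S(1) that(2)] .
      interpret ev: group_hom ?A B "\<lambda>\<alpha>. \<alpha> \<sigma>" by (rule ev_hom[OF sc])
      have sub: "x N ` {..<d} \<subseteq> carrier ?A" using x by auto
      have "(\<lambda>\<alpha>. \<alpha> \<sigma>) ` generate ?A (x N ` {..<d}) = generate B ((\<lambda>\<alpha>. \<alpha> \<sigma>) ` x N ` {..<d})"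
        using ev.generate_img[OF sub] by simp
      also have "\<dots> \<subseteq> S N" by (rule B.generate_subgroup_incl[OF _ S(1)]) (use S(2) that(2) in blast)
      finally show ?thesis using that(1) by blast
    qed
    have rt: "r (t N i) \<in> dset (x N) (S N) d'" if r: "r \<in> C" and i: "i < s" for r i
    proof -
      obtain g where g: "g \<in> generate ?A (x N ` {..<d})" "r \<ominus>\<^bsub>R\<^esub> g \<in> rad R {\<zero>\<^bsub>R\<^esub>}" using N r by auto
      have gC: "g \<in> C"
        using group.generate_in_carrier[OF addR_group, of "x N ` {..<d}" g] g(1) x by auto
      let ?v = "r \<ominus>\<^bsub>R\<^esub> g"
      have vC: "?v \<in> C" using R.minus_closed[of r g] r gC by simp
      obtain us where us: "\<forall>l<d'. us l \<in> carrier B" "?v (t N i) = lprod B (\<lambda>l. x N l (us l)) d'"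
        using nil[OF vC KH[OF g(2)] t[OF i]] by blast
      have "r = g \<oplus>\<^bsub>R\<^esub> ?v"
      proof -
        have "r \<in> carrier R" "g \<in> carrier R" using r gC by simp_all
        then show ?thesis by algebra
      qed
      then have "r (t N i) = g (t N i) \<otimes>\<^bsub>B\<^esub> ?v (t N i)" using R_simps(3)[OF t[OF i]] by metis
      then show ?thesis using stable[OF g(1) S(3)[OF i]] us unfolding dset_def by auto
    qed
    have "spn (t N) n \<subseteq> dset (x N) (S N) d'" if "n \<le> s" for n
      using that
    proof (induction n)
      case 0
      have "lprod B (\<lambda>l. x N l \<one>\<^bsub>B\<^esub>) d' = lprod B (\<lambda>l. \<one>\<^bsub>B\<^esub>) d'"
        by (rule lprod_cong) (use x' E_one C_E in simp)
      then have "\<one>\<^bsub>B\<^esub> = \<one>\<^bsub>B\<^esub> \<otimes>\<^bsub>B\<^esub> lprod B (\<lambda>l. x N l \<one>\<^bsub>B\<^esub>) d'" by (simp add: B.lprod_one)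
      then have "\<one>\<^bsub>B\<^esub> \<in> dset (x N) (S N) d'" unfolding dset_def using subgroup.one_closed[OF S(1)]
        by (intro CollectI exI[of _ "\<one>\<^bsub>B\<^esub>"] exI[of _ "\<lambda>_. \<one>\<^bsub>B\<^esub>"]) simp
      then show ?case by simp
    next
      case (Suc n)
      show ?case
      proof
        fix \<beta> assume "\<beta> \<in> spn (t N) (Suc n)"
        then obtain \<gamma> r where "\<gamma> \<in> spn (t N) n" "r \<in> C" "\<beta> = \<gamma> \<otimes>\<^bsub>B\<^esub> r (t N n)" by auto
        then show "\<beta> \<in> dset (x N) (S N) d'"
          using dset_mult[OF S(1) x'] rt[of r n] Suc by auto
      qed
    qed
    then have full': "carrier B \<subseteq> dset (x N) (S N) d'" using full by blast
    have nil': "x N l [^]\<^bsub>R\<^esub> KG = \<zero>\<^bsub>R\<^esub>" if l: "l < d'" for l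
    proof -
      have "hpv B (x N l) (replicate KG 0) \<beta> = \<one>\<^bsub>B\<^esub>" if "\<beta> \<in> carrier B" for \<beta>
        using cs(1)[of l \<beta> N] cs(2)[OF l] l d' that by simp
      then show ?thesis using hpv_replicate_iff[OF x'[OF l], of KG] by blast
    qed
    have "x N l \<sigma> \<in> S N" if "l < d'" "\<sigma> \<in> S N" for l \<sigma> using S(2) that d' by simp
    from nilpotent_elimination[of "S N" d' "x N", OF S(1) x' this nil' full']
    show ?thesis by simp
  qed
  then have "{N. S N \<noteq> carrier B} \<subseteq> ?Bad" by blast
  then show ?thesis using fin by (rule finite_subset)
qed

end

section \<open>The pairing of a factor of the upper central series\<close>

text \<open>\<open>PB K h\<close> is a copy of \<open>Z\<^sub>h\<^sub>+\<^sub>2/Z\<^sub>h\<^sub>+\<^sub>1\<close>: \<open>z\<close> is represented by the map \<open>g \<mapsto> [z,g] Z\<^sub>h\<close>, whose kernel is \<open>Z\<^sub>h\<^sub>+\<^sub>1\<close>.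
  The definitions that follow it restate, inside \<open>K\<close>, the notions \<open>bact\<close>, \<open>bgood\<close>, \<open>bok\<close>, \<open>bcom\<close> of the locale \<open>pairing\<close>.\<close>

definition psi :: "('u, 'm) monoid_scheme \<Rightarrow> nat \<Rightarrow> 'u \<Rightarrow> 'u \<Rightarrow> 'u set" where
  "psi K h z = (\<lambda>g \<in> carrier K. uc K h #>\<^bsub>K\<^esub> com K z g)"

definition PB :: "('u, 'm) monoid_scheme \<Rightarrow> nat \<Rightarrow> ('u \<Rightarrow> 'u set) monoid" where
  "PB K h = \<lparr>carrier = psi K h ` uc K (Suc (Suc h)),
    monoid.mult = (\<lambda>\<alpha> \<beta>. \<lambda>g \<in> carrier K. \<alpha> g \<otimes>\<^bsub>K Mod uc K h\<^esub> \<beta> g),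
    monoid.one = (\<lambda>g \<in> carrier K. \<one>\<^bsub>K Mod uc K h\<^esub>)\<rparr>"

definition act :: "('u, 'm) monoid_scheme \<Rightarrow> nat \<Rightarrow> nat \<Rightarrow> (nat \<Rightarrow> 'u) \<Rightarrow> (nat \<Rightarrow> 'u) \<Rightarrow> 'u \<Rightarrow> 'u \<Rightarrow> bool" where
  "act K h k b y z z' \<longleftrightarrow> z \<in> uc K (Suc (Suc h)) \<and> z' \<in> uc K (Suc (Suc h)) \<and>
    (\<forall>j<k. com K z' (b j) \<otimes>\<^bsub>K\<^esub> inv\<^bsub>K\<^esub> (com K z (y j)) \<in> uc K h)"

definition good :: "('u, 'm) monoid_scheme \<Rightarrow> nat \<Rightarrow> nat \<Rightarrow> (nat \<Rightarrow> 'u) \<Rightarrow> (nat \<Rightarrow> 'u) \<Rightarrow> bool" where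
  "good K h k b y \<longleftrightarrow> (\<forall>z \<in> carrier K. z \<in> uc K (Suc (Suc h)) \<longrightarrow> (\<exists>z' \<in> carrier K. act K h k b y z z'))"

definition okt :: "('u, 'm) monoid_scheme \<Rightarrow> nat \<Rightarrow> nat \<Rightarrow> (nat \<Rightarrow> 'u) \<Rightarrow> bool" where
  "okt K h k b \<longleftrightarrow>
    (\<forall>z \<in> carrier K. z \<in> uc K (Suc (Suc h)) \<longrightarrow> (\<forall>j<k. com K z (b j) \<in> uc K h) \<longrightarrow> z \<in> uc K (Suc h)) \<and>
    (\<forall>y \<in> tup K k. good K h k b y \<longrightarrow> (\<forall>g \<in> carrier K. \<exists>u \<in> carrier K. \<forall>z \<in> carrier K. \<forall>z' \<in> carrier K.
      act K h k b y z z' \<longrightarrow> com K z' g \<otimes>\<^bsub>K\<^esub> inv\<^bsub>K\<^esub> (com K z u) \<in> uc K h))"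

definition ccode :: "('u, 'm) monoid_scheme \<Rightarrow> nat \<Rightarrow> nat \<Rightarrow> (nat \<Rightarrow> 'u) \<Rightarrow> (nat \<Rightarrow> 'u) \<Rightarrow> bool" where
  "ccode K h k b y \<longleftrightarrow> good K h k b y \<and> (\<forall>y' \<in> tup K k. good K h k b y' \<longrightarrow>
    (\<forall>z \<in> carrier K. \<forall>z1 \<in> carrier K. \<forall>z2 \<in> carrier K. \<forall>z3 \<in> carrier K. \<forall>z4 \<in> carrier K.
      act K h k b y z z1 \<longrightarrow> act K h k b y' z1 z2 \<longrightarrow> act K h k b y' z z3 \<longrightarrow> act K h k b y z3 z4 \<longrightarrow>
      z2 \<otimes>\<^bsub>K\<^esub> inv\<^bsub>K\<^esub> z4 \<in> uc K (Suc h)))"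

text \<open>The graph of \<open>hpv\<close> on representatives: intermediate values are quantified,
  one pair per coefficient, and equalities are read modulo \<open>uc K (Suc h)\<close>.\<close>

primrec hprel :: "('u, 'm) monoid_scheme \<Rightarrow> nat \<Rightarrow> nat \<Rightarrow> (nat \<Rightarrow> 'u) \<Rightarrow> (nat \<Rightarrow> 'u) \<Rightarrow> int list \<Rightarrow> 'u \<Rightarrow> 'u \<Rightarrow> bool" where
  "hprel K h k b y [] z w \<longleftrightarrow> z \<in> uc K (Suc (Suc h)) \<and> w \<in> uc K (Suc (Suc h)) \<and> w \<otimes>\<^bsub>K\<^esub> inv\<^bsub>K\<^esub> z \<in> uc K (Suc h)"
| "hprel K h k b y (c # cs) z w \<longleftrightarrow> w \<in> uc K (Suc (Suc h)) \<and> (\<exists>z1 \<in> carrier K. \<exists>w1 \<in> carrier K.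
    act K h k b y z z1 \<and> hprel K h k b y cs z1 w1 \<and> w \<otimes>\<^bsub>K\<^esub> inv\<^bsub>K\<^esub> (z [^]\<^bsub>K\<^esub> c \<otimes>\<^bsub>K\<^esub> w1) \<in> uc K (Suc h))"

definition annih :: "('u, 'm) monoid_scheme \<Rightarrow> nat \<Rightarrow> nat \<Rightarrow> (nat \<Rightarrow> 'u) \<Rightarrow> (nat \<Rightarrow> 'u) \<Rightarrow> int list \<Rightarrow> bool" where
  "annih K h k b y cs \<longleftrightarrow> (\<forall>z \<in> carrier K. \<forall>w \<in> carrier K. hprel K h k b y cs z w \<longrightarrow> w \<in> uc K (Suc h))"

text \<open>The counterpart of \<open>spn\<close>; elements of \<open>C\<close> are quantified
  through their codes y.\<close>

primrec cspan :: "('u, 'm) monoid_scheme \<Rightarrow> nat \<Rightarrow> nat \<Rightarrow> (nat \<Rightarrow> 'u) \<Rightarrow> (nat \<Rightarrow> 'u) \<Rightarrow> nat \<Rightarrow> 'u \<Rightarrow> bool" where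
  "cspan K h k b \<tau> 0 z \<longleftrightarrow> z \<in> uc K (Suc h)"
| "cspan K h k b \<tau> (Suc s) z \<longleftrightarrow> z \<in> uc K (Suc (Suc h)) \<and> (\<exists>y \<in> tup K k. \<exists>w \<in> carrier K. \<exists>z' \<in> carrier K.
    ccode K h k b y \<and> act K h k b y (\<tau> s) w \<and> cspan K h k b \<tau> s z' \<and> z \<otimes>\<^bsub>K\<^esub> inv\<^bsub>K\<^esub> (z' \<otimes>\<^bsub>K\<^esub> w) \<in> uc K (Suc h))"

text \<open>\<open>KH\<close> is meant as an exponent that kills the nilradical in the group to
  which the formula is transferred. The \<upsilon> l i represent the images of \<tau> i under the
  endomorphism coded by \<sigma> l; they are named because they will be words in the \<tau> i, which
  makes the subgroup generated by the \<tau> i stable. Only the clause on generation modulo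
  \<open>n\<close> involves \<open>n\<close>.\<close>

definition level :: "('u, 'm) monoid_scheme \<Rightarrow> nat \<Rightarrow> nat \<Rightarrow> nat \<Rightarrow> nat \<Rightarrow> nat \<Rightarrow> (nat \<Rightarrow> int list) \<Rightarrow> nat \<Rightarrow> nat \<Rightarrow>
    (nat \<Rightarrow> 'u) \<Rightarrow> (nat \<Rightarrow> nat \<Rightarrow> 'u) \<Rightarrow> (nat \<Rightarrow> 'u) \<Rightarrow> (nat \<Rightarrow> nat \<Rightarrow> 'u) \<Rightarrow> bool" where
  "level K h k d d' s cs KH n b \<sigma> \<tau> \<upsilon> \<longleftrightarrow>
    okt K h k b \<and> (\<forall>l<d. ccode K h k b (\<sigma> l)) \<and> (\<forall>i<s. \<tau> i \<in> uc K (Suc (Suc h))) \<and>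
    (\<forall>l<d. \<forall>i<s. act K h k b (\<sigma> l) (\<tau> i) (\<upsilon> l i)) \<and>
    (\<forall>y \<in> tup K k. ccode K h k b y \<longrightarrow> (\<exists>e \<in> digits d n. \<exists>y' \<in> tup K k. ccode K h k b y' \<and>
      (\<forall>z \<in> carrier K. z \<in> uc K (Suc (Suc h)) \<longrightarrow> (\<forall>j<k. com K z (y j) \<otimes>\<^bsub>K\<^esub>
        inv\<^bsub>K\<^esub> (com K z (lprod K (\<lambda>l. \<sigma> l j [^]\<^bsub>K\<^esub> e l) d \<otimes>\<^bsub>K\<^esub> y' j [^]\<^bsub>K\<^esub> n)) \<in> uc K h)))) \<and>
    (\<forall>l<d. annih K h k b (\<sigma> l) (cs l)) \<and>
    (\<forall>z \<in> carrier K. z \<in> uc K (Suc (Suc h)) \<longrightarrow> cspan K h k b \<tau> s z) \<and>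
    (\<forall>y \<in> tup K k. ccode K h k b y \<longrightarrow> annih K h k b y (replicate KH 0) \<longrightarrow>
      (\<forall>z \<in> carrier K. \<forall>z' \<in> carrier K. act K h k b y z z' \<longrightarrow>
        (\<exists>us \<in> tup K d'. \<exists>ws \<in> tup K d'. (\<forall>l<d'. act K h k b (\<sigma> l) (us l) (ws l)) \<and>
          z' \<otimes>\<^bsub>K\<^esub> inv\<^bsub>K\<^esub> (lprod K ws d') \<in> uc K (Suc h))))"

section \<open>The commutator pairing as an instance of the abstract pairing\<close>

locale group_level = group K for K :: "('u, 'm) monoid_scheme" (structure) + fixes h :: nat
begin

abbreviation "low \<equiv> uc K h"
abbreviation "mid \<equiv> uc K (Suc h)"
abbreviation "M \<equiv> uc K (Suc (Suc h))"
abbreviation "Q \<equiv> K Mod low"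
abbreviation "\<psi> \<equiv> psi K h"
abbreviation "B \<equiv> PB K h"

lemma q_hom: "group_hom K Q ((#>) low)"
  by (rule normal.quot_hom[OF uc_normal])

lemma Q_group: "group Q"
  using q_hom by (simp add: group_hom_def)

lemma q_mult: "x \<in> carrier K \<Longrightarrow> y \<in> carrier K \<Longrightarrow> low #> (x \<otimes> y) = (low #> x) \<otimes>\<^bsub>Q\<^esub> (low #> y)"
  using group_hom.hom_mult[OF q_hom] by blast

lemma q_trans: "a \<in> low \<Longrightarrow> x \<in> carrier K \<Longrightarrow> low #> (a \<otimes> x) = low #> x"
  using coset_eq_iff[OF uc_normal[of h], of "a \<otimes> x" x] uc_closed[of a h] by (simp add: m_assoc)

lemma M_carrier: "z \<in> M \<Longrightarrow> z \<in> carrier K" by (rule uc_closed)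

lemma M_mult: "z \<in> M \<Longrightarrow> z' \<in> M \<Longrightarrow> z \<otimes> z' \<in> M" by (rule normalD(4)[OF uc_normal])

lemma M_inv: "z \<in> M \<Longrightarrow> inv z \<in> M" by (rule normalD(5)[OF uc_normal])

lemma mid_sub_M: "z \<in> mid \<Longrightarrow> z \<in> M" using uc_subset_Suc by blast

lemma com_mid: "z \<in> M \<Longrightarrow> g \<in> carrier K \<Longrightarrow> com K z g \<in> mid" by (rule uc_com)

lemma q_comm:
  assumes "c \<in> mid" "x \<in> carrier K" shows "low #> (c \<otimes> x) = low #> (x \<otimes> c)"
proof -
  have c: "c \<in> carrier K" using assms(1) by (rule uc_closed)
  have "c \<otimes> x = com K c x \<otimes> (x \<otimes> c)" using c assms(2) by (simp add: com_def gsimps)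
  then show ?thesis using q_trans[OF uc_com[OF assms], of "x \<otimes> c"] c assms(2) by simp
qed

lemma q_conj:
  assumes "c \<in> mid" "x \<in> carrier K" shows "low #> (x \<otimes> c \<otimes> inv x) = low #> c"
proof -
  have c: "c \<in> carrier K" using assms(1) by (rule uc_closed)
  show ?thesis using q_trans[OF uc_com'[OF assms] c] conj_eq_com[OF c assms(2)] by simp
qed

lemma psi_apply: "g \<in> carrier K \<Longrightarrow> \<psi> z g = low #> com K z g"
  by (simp add: psi_def)

text \<open>Commutators of elements of \<open>M\<close> lie in \<open>mid\<close>, which is central
  modulo \<open>low\<close>; hence the conjugation in [zz', g] = z [z', g] z^(-1) [z, g] disappears
  and the two factors commute.\<close>

lemma psi_mult_eval:
  assumes z: "z \<in> M" "z' \<in> M" and g: "g \<in> carrier K"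
  shows "\<psi> (z \<otimes> z') g = \<psi> z g \<otimes>\<^bsub>Q\<^esub> \<psi> z' g"
proof -
  have c: "com K z' g \<in> mid" "com K z' g \<in> carrier K" "com K z g \<in> carrier K" "z \<in> carrier K" "z' \<in> carrier K"
    using com_mid z g M_carrier by (simp_all del: uc.simps)
  have "low #> com K (z \<otimes> z') g = (low #> (z \<otimes> com K z' g \<otimes> inv z)) \<otimes>\<^bsub>Q\<^esub> (low #> com K z g)"
    using c g by (simp add: com_mult_left q_mult del: uc.simps)
  also have "\<dots> = low #> (com K z' g \<otimes> com K z g)" using c by (simp only: q_conj q_mult)
  also have "\<dots> = low #> (com K z g \<otimes> com K z' g)" by (rule q_comm[OF c(1,3)])
  finally show ?thesis using g c by (simp only: psi_apply q_mult)
qed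

lemma PB_simps [simp]:
  "carrier B = \<psi> ` M" "\<beta> \<otimes>\<^bsub>B\<^esub> \<gamma> = (\<lambda>g \<in> carrier K. \<beta> g \<otimes>\<^bsub>Q\<^esub> \<gamma> g)" "\<one>\<^bsub>B\<^esub> = (\<lambda>g \<in> carrier K. \<one>\<^bsub>Q\<^esub>)"
  by (simp_all add: PB_def)

lemma psi_mult: "z \<in> M \<Longrightarrow> z' \<in> M \<Longrightarrow> \<psi> (z \<otimes> z') = \<psi> z \<otimes>\<^bsub>B\<^esub> \<psi> z'"
proof
  fix g assume z: "z \<in> M" "z' \<in> M"
  show "\<psi> (z \<otimes> z') g = (\<psi> z \<otimes>\<^bsub>B\<^esub> \<psi> z') g"
  proof (cases "g \<in> carrier K")
    case True
    then show ?thesis using psi_mult_eval[OF z True] unfolding PB_simps by simp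
  next
    case False
    then show ?thesis unfolding PB_simps psi_def by simp
  qed
qed

lemma psi_one: "\<psi> \<one> = \<one>\<^bsub>B\<^esub>"
proof
  fix g
  show "\<psi> \<one> g = \<one>\<^bsub>B\<^esub> g"
    using quot_one_iff[OF uc_normal one_closed, of h] normalD(3)[OF uc_normal, of h]
    by (simp add: psi_def restrict_def)
qed

lemma B_comm_group: "comm_group B"
proof (rule comm_groupI)
  show "\<one>\<^bsub>B\<^esub> \<in> carrier B"
    using normalD(3)[OF uc_normal, of "Suc (Suc h)"] unfolding psi_one[symmetric] PB_simps by blast
  fix \<beta> assume b: "\<beta> \<in> carrier B"
  then obtain z where z: "z \<in> M" "\<beta> = \<psi> z" by (auto simp del: uc.simps)
  have zc: "z \<in> carrier K" using z(1) by (rule M_carrier)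
  show "\<one>\<^bsub>B\<^esub> \<otimes>\<^bsub>B\<^esub> \<beta> = \<beta>"
    using psi_mult[OF normalD(3)[OF uc_normal] z(1)] zc unfolding z(2) psi_one by simp
  have "\<psi> (inv z) \<otimes>\<^bsub>B\<^esub> \<beta> = \<one>\<^bsub>B\<^esub>"
    using psi_mult[OF M_inv[OF z(1)] z(1)] zc unfolding z(2) psi_one[symmetric] by simp
  then show "\<exists>\<gamma> \<in> carrier B. \<gamma> \<otimes>\<^bsub>B\<^esub> \<beta> = \<one>\<^bsub>B\<^esub>" using M_inv[OF z(1)] unfolding PB_simps(1) by blast
  fix \<gamma> assume c: "\<gamma> \<in> carrier B"
  then obtain w where w: "w \<in> M" "\<gamma> = \<psi> w" by (auto simp del: uc.simps)
  have wc: "w \<in> carrier K" using w(1) by (rule M_carrier)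
  show "\<beta> \<otimes>\<^bsub>B\<^esub> \<gamma> \<in> carrier B"
    using psi_mult[OF z(1) w(1)] M_mult[OF z(1) w(1)] unfolding z(2) w(2) PB_simps(1) by (metis imageI)
  show "\<beta> \<otimes>\<^bsub>B\<^esub> \<gamma> = \<gamma> \<otimes>\<^bsub>B\<^esub> \<beta>"
  proof
    fix g show "(\<beta> \<otimes>\<^bsub>B\<^esub> \<gamma>) g = (\<gamma> \<otimes>\<^bsub>B\<^esub> \<beta>) g"
    proof (cases "g \<in> carrier K")
      case True
      then have "\<beta> g \<otimes>\<^bsub>Q\<^esub> \<gamma> g = \<gamma> g \<otimes>\<^bsub>Q\<^esub> \<beta> g"
        using q_comm[OF com_mid[OF z(1) True], of "com K w g"] zc wc unfolding z(2) w(2)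
        by (simp only: psi_apply q_mult com_closed)
      then show ?thesis using True by simp
    qed simp
  qed
  fix \<delta> assume "\<delta> \<in> carrier B"
  then obtain v where v: "v \<in> M" "\<delta> = \<psi> v" by (auto simp del: uc.simps)
  have vc: "v \<in> carrier K" using v(1) by (rule M_carrier)
  have "\<beta> \<otimes>\<^bsub>B\<^esub> \<gamma> \<otimes>\<^bsub>B\<^esub> \<delta> = \<psi> (z \<otimes> w \<otimes> v)"
    unfolding z(2) w(2) v(2) using psi_mult[OF z(1) w(1)] psi_mult[OF M_mult[OF z(1) w(1)] v(1)] by metis
  moreover have "\<beta> \<otimes>\<^bsub>B\<^esub> (\<gamma> \<otimes>\<^bsub>B\<^esub> \<delta>) = \<psi> (z \<otimes> (w \<otimes> v))"
    unfolding z(2) w(2) v(2) using psi_mult[OF w(1) v(1)] psi_mult[OF z(1) M_mult[OF w(1) v(1)]] by metis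
  ultimately show "\<beta> \<otimes>\<^bsub>B\<^esub> \<gamma> \<otimes>\<^bsub>B\<^esub> \<delta> = \<beta> \<otimes>\<^bsub>B\<^esub> (\<gamma> \<otimes>\<^bsub>B\<^esub> \<delta>)" using zc wc vc by (simp add: m_assoc)
qed

lemma M_group: "group (K\<lparr>carrier := M\<rparr>)"
  by (rule subgroup_imp_group[OF normalD(1)[OF uc_normal]])

lemma psi_hom: "group_hom (K\<lparr>carrier := M\<rparr>) B \<psi>"
  unfolding group_hom_def group_hom_axioms_def
proof (intro conjI M_group)
  show "group B" using B_comm_group by (rule comm_group.axioms)
  show "\<psi> \<in> hom (K\<lparr>carrier := M\<rparr>) B"
  proof (rule homI)
    fix x assume "x \<in> carrier (K\<lparr>carrier := M\<rparr>)"
    then show "\<psi> x \<in> carrier B" unfolding PB_simps(1) by simp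
  next
    fix x y assume "x \<in> carrier (K\<lparr>carrier := M\<rparr>)" "y \<in> carrier (K\<lparr>carrier := M\<rparr>)"
    then show "\<psi> (x \<otimes>\<^bsub>K\<lparr>carrier := M\<rparr>\<^esub> y) = \<psi> x \<otimes>\<^bsub>B\<^esub> \<psi> y" using psi_mult by (simp del: uc.simps PB_simps)
  qed
qed

lemma psi_right:
  assumes z: "z \<in> M" shows "\<psi> z \<in> hom K Q"
proof (rule homI)
  fix g assume g: "g \<in> carrier K"
  then show "\<psi> z g \<in> carrier Q"
    using group_hom.hom_closed[OF q_hom com_closed[OF M_carrier[OF z] g]] by (simp only: psi_apply)
next
  fix g u assume g: "g \<in> carrier K" "u \<in> carrier K"
  have zc: "z \<in> carrier K" using z by (rule M_carrier)
  have c: "com K z u \<in> mid" "com K z u \<in> carrier K" "com K z g \<in> carrier K"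
    using com_mid z g zc by (simp_all del: uc.simps)
  have "low #> com K z (g \<otimes> u) = (low #> com K z g) \<otimes>\<^bsub>Q\<^esub> (low #> (g \<otimes> com K z u \<otimes> inv g))"
    using g zc c by (simp add: com_mult_right q_mult del: uc.simps)
  then show "\<psi> z (g \<otimes> u) = \<psi> z g \<otimes>\<^bsub>Q\<^esub> \<psi> z u"
    using q_conj[OF c(1) g(1)] g by (simp only: psi_apply m_closed)
qed

text \<open>Elements of \<open>B\<close> are functions on \<open>K\<close>, so the pairing is
  evaluation and nondegeneracy is extensionality.\<close>

sublocale pairing B K Q "\<lambda>\<beta> g. \<beta> g"
proof -
  interpret B: comm_group B by (rule B_comm_group)
  interpret Q: group Q by (rule Q_group)
  show "pairing B K Q (\<lambda>\<beta> g. \<beta> g)"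
  proof
    fix g assume g: "g \<in> carrier K"
    show "(\<lambda>\<beta>. \<beta> g) \<in> hom B Q"
    proof (rule homI)
      fix \<beta> assume "\<beta> \<in> carrier B"
      then obtain z where z: "z \<in> M" "\<beta> = \<psi> z" by (auto simp del: uc.simps)
      show "\<beta> g \<in> carrier Q" using psi_right[OF z(1)] g unfolding z(2) hom_def by blast
    qed (use g in simp)
  next
    fix \<beta> assume "\<beta> \<in> carrier B"
    then obtain z where z: "z \<in> M" "\<beta> = \<psi> z" by (auto simp del: uc.simps)
    show "\<beta> \<in> hom K Q" unfolding z(2) by (rule psi_right[OF z(1)])
    assume "\<And>g. g \<in> carrier K \<Longrightarrow> \<beta> g = \<one>\<^bsub>Q\<^esub>"
    then show "\<beta> = \<one>\<^bsub>B\<^esub>" unfolding z(2) PB_simps psi_def by (intro ext) (simp add: restrict_def)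
  qed
qed

lemma noeth_B: "noeth K \<Longrightarrow> noeth B"
  by (rule group_hom.noeth_image[OF psi_hom noeth_subgroup[OF _ normalD(1)[OF uc_normal]]]) simp_all

lemma psi_in_B [simp]: "z \<in> M \<Longrightarrow> \<psi> z \<in> carrier B"
  unfolding PB_simps(1) by blast

lemma B_cases: "\<beta> \<in> carrier B \<Longrightarrow> (\<And>z. z \<in> M \<Longrightarrow> \<beta> = \<psi> z \<Longrightarrow> thesis) \<Longrightarrow> thesis"
  unfolding PB_simps(1) by blast

lemma psi_eval_eq_iff:
  assumes "z \<in> M" "z' \<in> M" "g \<in> carrier K" "g' \<in> carrier K"
  shows "\<psi> z g = \<psi> z' g' \<longleftrightarrow> com K z g \<otimes> inv (com K z' g') \<in> low"
  using coset_eq_iff[OF uc_normal[of h] com_closed com_closed, of z g z' g'] assms M_carrier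
  by (simp only: psi_apply)

lemma psi_one_iff: "z \<in> M \<Longrightarrow> \<psi> z = \<one>\<^bsub>B\<^esub> \<longleftrightarrow> z \<in> mid"
proof -
  assume z: "z \<in> M"
  have zc: "z \<in> carrier K" using z by (rule M_carrier)
  have "\<psi> z = \<one>\<^bsub>B\<^esub> \<longleftrightarrow> (\<forall>g \<in> carrier K. low #> com K z g = \<one>\<^bsub>Q\<^esub>)"
    unfolding PB_simps psi_def by (auto simp: fun_eq_iff restrict_def)
  also have "\<dots> \<longleftrightarrow> (\<forall>g \<in> carrier K. com K z g \<in> low)"
    by (intro ball_cong refl quot_one_iff[OF uc_normal com_closed[OF zc]])
  finally show ?thesis using zc by simp
qed

lemma psi_eq_iff:
  assumes z: "z \<in> M" "z' \<in> M" shows "\<psi> z = \<psi> z' \<longleftrightarrow> z \<otimes> inv z' \<in> mid"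
proof -
  interpret p: group_hom "K\<lparr>carrier := M\<rparr>" B \<psi> by (rule psi_hom)
  interpret B: comm_group B by (rule B_comm_group)
  have "\<psi> (inv z') = inv\<^bsub>B\<^esub> (\<psi> z')"
    using p.hom_inv[of z'] z m_inv_consistent[OF normalD(1)[OF uc_normal], of z' "Suc (Suc h)"] by simp
  then have "\<psi> (z \<otimes> inv z') = \<psi> z \<otimes>\<^bsub>B\<^esub> inv\<^bsub>B\<^esub> (\<psi> z')" using psi_mult[OF z(1) M_inv[OF z(2)]] by simp
  moreover have "\<psi> z = \<psi> z' \<longleftrightarrow> \<psi> z \<otimes>\<^bsub>B\<^esub> inv\<^bsub>B\<^esub> (\<psi> z') = \<one>\<^bsub>B\<^esub>"
  proof
    assume e: "\<psi> z = \<psi> z'"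
    show "\<psi> z \<otimes>\<^bsub>B\<^esub> inv\<^bsub>B\<^esub> (\<psi> z') = \<one>\<^bsub>B\<^esub>" unfolding e by (rule B.r_inv[OF psi_in_B[OF z(2)]])
  next
    assume "\<psi> z \<otimes>\<^bsub>B\<^esub> inv\<^bsub>B\<^esub> (\<psi> z') = \<one>\<^bsub>B\<^esub>"
    then show "\<psi> z = \<psi> z'"
      using B.inv_equality[OF _ B.inv_closed[OF psi_in_B[OF z(2)]] psi_in_B[OF z(1)]]
        B.inv_inv[OF psi_in_B[OF z(2)]] by metis
  qed
  ultimately show ?thesis using psi_one_iff[OF M_mult[OF z(1) M_inv[OF z(2)]]] by metis
qed

end

text \<open>Generation is turned into syntax: a term found for an element of one group can be
  evaluated at a tuple of another.\<close>

lemma generate_term: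
  "x \<in> generate K (b ` {..<k}) \<Longrightarrow> \<exists>t. teval K b t = x"
proof (induction rule: generate.induct)
  case one
  show ?case by (rule exI[of _ GOne]) simp
next
  case (incl h)
  then obtain j where "h = b j" by blast
  then show ?case by (intro exI[of _ "GVar j"]) simp
next
  case (inv h)
  then obtain j where "h = b j" by blast
  then show ?case by (intro exI[of _ "GInv (GVar j)"]) simp
next
  case (eng h1 h2)
  then obtain s t where "teval K b s = h1" "teval K b t = h2" by blast
  then show ?case by (intro exI[of _ "GMul s t"]) simp
qed

lemma (in group) term_generate:
  assumes b: "b \<in> tup G k" shows "teval G b t \<in> generate G (b ` {..<k})"
proof (induction t)
  case (GVar j)
  show ?case
  proof (cases "j < k")
    case True
    then show ?thesis by (auto intro: generate.incl)
  next
    case False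
    then show ?thesis using b generate.one[of G "b ` {..<k}"] by (simp add: tup_def)
  qed
next
  case (GInv t)
  have "b ` {..<k} \<subseteq> carrier G" using b by (auto simp: tup_def)
  then show ?case using generate_m_inv_closed GInv by simp
qed (auto intro: generate.one generate.eng)

lemma lprod_update [simp]: "lprod (K\<lparr>carrier := V\<rparr>) x d = lprod K x d"
  by (induction d) simp_all

section \<open>Formulas on representatives against notions of the pairing\<close>

context group_level
begin

lemma lprod_M: "(\<And>l. l < d \<Longrightarrow> z l \<in> M) \<Longrightarrow> lprod K z d \<in> M"
  by (rule lprod_in_subgroup[OF normalD(1)[OF uc_normal]])

lemma psi_lprod:
  assumes "\<And>l. l < d \<Longrightarrow> z l \<in> M" shows "\<psi> (lprod K z d) = lprod B (\<lambda>l. \<psi> (z l)) d"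
  using group_hom.hom_lprod[OF psi_hom, of d z] assms by (simp del: uc.simps)

lemma psi_int_pow: "z \<in> M \<Longrightarrow> \<psi> (z [^] (c::int)) = \<psi> z [^]\<^bsub>B\<^esub> c"
  using group_hom.hom_int_pow[OF psi_hom, of z c] int_pow_consistent[OF normalD(1)[OF uc_normal], of z "Suc (Suc h)" c]
  by (simp del: uc.simps)

lemma int_pow_M: "z \<in> M \<Longrightarrow> z [^] (c::int) \<in> M"
  by (rule subgroup_int_pow_closed[OF normalD(1)[OF uc_normal]])

lemma ball_M: "(\<forall>z \<in> carrier K. z \<in> M \<longrightarrow> P z) \<longleftrightarrow> (\<forall>z \<in> M. P z)"
  using M_carrier by blast

lemma ball_B: "(\<forall>\<beta> \<in> carrier B. P \<beta>) \<longleftrightarrow> (\<forall>z \<in> M. P (\<psi> z))"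
  unfolding PB_simps(1) by blast

lemma bex_B: "(\<exists>\<beta> \<in> carrier B. P \<beta>) \<longleftrightarrow> (\<exists>z \<in> M. P (\<psi> z))"
  unfolding PB_simps(1) by blast

lemma act_iff:
  assumes "b \<in> tup K k" "y \<in> tup K k"
  shows "act K h k b y z z' \<longleftrightarrow> z \<in> M \<and> z' \<in> M \<and> bact b k y (\<psi> z) (\<psi> z')"
proof (cases "z \<in> M \<and> z' \<in> M")
  case True
  then have "com K z' (b j) \<otimes> inv (com K z (y j)) \<in> low \<longleftrightarrow> \<psi> z' (b j) = \<psi> z (y j)" for j
    using psi_eval_eq_iff[of z' z "b j" "y j"] tup_carrier assms by blast
  then show ?thesis unfolding act_def bact_def using True by simp
next
  case False
  then show ?thesis unfolding act_def by blast
qed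

lemma good_iff:
  assumes "b \<in> tup K k" "y \<in> tup K k" shows "good K h k b y \<longleftrightarrow> bgood b k y"
proof -
  have "(\<exists>z' \<in> carrier K. act K h k b y z z') \<longleftrightarrow> (\<exists>z' \<in> M. bact b k y (\<psi> z) (\<psi> z'))" if "z \<in> M" for z
    unfolding act_iff[OF assms] using that M_carrier by blast
  then show ?thesis unfolding good_def bgood_def ball_M ball_B bex_B by simp
qed

lemma okt_iff:
  assumes b: "b \<in> tup K k" shows "okt K h k b \<longleftrightarrow> bok b k"
proof -
  have 1: "com K z (b j) \<in> low \<longleftrightarrow> \<psi> z (b j) = \<one>\<^bsub>Q\<^esub>" if "z \<in> M" for z j
    using quot_one_iff[OF uc_normal[of h] com_closed[OF M_carrier[OF that] tup_carrier[OF b, of j]]]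
      psi_apply[OF tup_carrier[OF b, of j], of z] by metis
  have 2: "(\<forall>z \<in> carrier K. \<forall>z' \<in> carrier K. act K h k b y z z' \<longrightarrow> com K z' g \<otimes> inv (com K z u) \<in> low) \<longleftrightarrow>
      (\<forall>z \<in> M. \<forall>z' \<in> M. bact b k y (\<psi> z) (\<psi> z') \<longrightarrow> \<psi> z' g = \<psi> z u)"
    if "y \<in> tup K k" "g \<in> carrier K" "u \<in> carrier K" for y g u
    unfolding act_iff[OF b that(1)] using psi_eval_eq_iff[OF _ _ that(2,3)] M_carrier by meson
  have 3: "(\<forall>z \<in> carrier K. z \<in> M \<longrightarrow> (\<forall>j<k. com K z (b j) \<in> low) \<longrightarrow> z \<in> mid) \<longleftrightarrow>
      (\<forall>\<beta> \<in> carrier B. (\<forall>j<k. \<beta> (b j) = \<one>\<^bsub>Q\<^esub>) \<longrightarrow> \<beta> = \<one>\<^bsub>B\<^esub>)"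
    unfolding ball_M ball_B using 1 psi_one_iff by (metis (no_types, lifting))
  have 4: "(\<forall>y \<in> tup K k. good K h k b y \<longrightarrow> (\<forall>g \<in> carrier K. \<exists>u \<in> carrier K. \<forall>z \<in> carrier K. \<forall>z' \<in> carrier K.
      act K h k b y z z' \<longrightarrow> com K z' g \<otimes> inv (com K z u) \<in> low)) \<longleftrightarrow>
    (\<forall>y \<in> tup K k. bgood b k y \<longrightarrow> (\<forall>g \<in> carrier K. \<exists>u \<in> carrier K.
      \<forall>\<beta> \<in> carrier B. \<forall>\<beta>' \<in> carrier B. bact b k y \<beta> \<beta>' \<longrightarrow> \<beta>' g = \<beta> u))"
    unfolding ball_B by (intro ball_cong bex_cong refl imp_cong good_iff[OF b] 2)
  show ?thesis unfolding okt_def bok_def 3 4 ..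
qed

lemma ccode_iff:
  assumes b: "b \<in> tup K k" and y: "y \<in> tup K k" shows "ccode K h k b y \<longleftrightarrow> bcom b k y"
proof -
  have "(\<forall>z \<in> carrier K. \<forall>z1 \<in> carrier K. \<forall>z2 \<in> carrier K. \<forall>z3 \<in> carrier K. \<forall>z4 \<in> carrier K.
      act K h k b y z z1 \<longrightarrow> act K h k b y' z1 z2 \<longrightarrow> act K h k b y' z z3 \<longrightarrow> act K h k b y z3 z4 \<longrightarrow>
      z2 \<otimes> inv z4 \<in> mid) \<longleftrightarrow>
    (\<forall>\<beta> \<in> carrier B. \<forall>\<beta>1 \<in> carrier B. \<forall>\<beta>2 \<in> carrier B. \<forall>\<beta>3 \<in> carrier B. \<forall>\<beta>4 \<in> carrier B.
      bact b k y \<beta> \<beta>1 \<longrightarrow> bact b k y' \<beta>1 \<beta>2 \<longrightarrow> bact b k y' \<beta> \<beta>3 \<longrightarrow> bact b k y \<beta>3 \<beta>4 \<longrightarrow> \<beta>2 = \<beta>4)"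
    (is "?L \<longleftrightarrow> ?R") if y': "y' \<in> tup K k" for y'
  proof
    assume L: ?L
    show ?R unfolding ball_B
    proof (intro ballI impI)
      fix z z1 z2 z3 z4 assume m: "z \<in> M" "z1 \<in> M" "z2 \<in> M" "z3 \<in> M" "z4 \<in> M"
        and a: "bact b k y (\<psi> z) (\<psi> z1)" "bact b k y' (\<psi> z1) (\<psi> z2)" "bact b k y' (\<psi> z) (\<psi> z3)" "bact b k y (\<psi> z3) (\<psi> z4)"
      have "z2 \<otimes> inv z4 \<in> mid"
        using L[rule_format, OF M_carrier[OF m(1)] M_carrier[OF m(2)] M_carrier[OF m(3)] M_carrier[OF m(4)] M_carrier[OF m(5)]]
          m a unfolding act_iff[OF b y] act_iff[OF b y'] by blast
      then show "\<psi> z2 = \<psi> z4" using psi_eq_iff[OF m(3,5)] by blast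
    qed
  next
    assume R: ?R
    show ?L
    proof (intro ballI impI)
      fix z z1 z2 z3 z4
      assume "act K h k b y z z1" "act K h k b y' z1 z2" "act K h k b y' z z3" "act K h k b y z3 z4"
      then have m: "z \<in> M" "z1 \<in> M" "z2 \<in> M" "z3 \<in> M" "z4 \<in> M"
        and a: "bact b k y (\<psi> z) (\<psi> z1)" "bact b k y' (\<psi> z1) (\<psi> z2)" "bact b k y' (\<psi> z) (\<psi> z3)" "bact b k y (\<psi> z3) (\<psi> z4)"
        unfolding act_iff[OF b y] act_iff[OF b y'] by blast+
      have "\<psi> z2 = \<psi> z4"
        using R[rule_format, OF psi_in_B[OF m(1)] psi_in_B[OF m(2)] psi_in_B[OF m(3)] psi_in_B[OF m(4)] psi_in_B[OF m(5)] a] .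
      then show "z2 \<otimes> inv z4 \<in> mid" using psi_eq_iff[OF m(3,5)] by blast
    qed
  qed
  then show ?thesis unfolding ccode_def bcom_def good_iff[OF b y]
    by (intro conj_cong refl ball_cong imp_cong good_iff[OF b])
qed

context
  fixes b k assumes b: "b \<in> tup K k" and ok: "bok b k"
begin

lemma act_codes_iff:
  assumes "y \<in> tup K k" "codes b k y \<alpha>"
  shows "act K h k b y z z' \<longleftrightarrow> z \<in> M \<and> z' \<in> M \<and> \<psi> z' = \<alpha> (\<psi> z)"
  using assms(2) psi_in_B unfolding act_iff[OF b assms(1)] codes_def by blast

lemma hprel_iff:
  assumes y: "y \<in> tup K k" "codes b k y \<alpha>" "\<alpha> \<in> C"
  shows "z \<in> M \<Longrightarrow> w \<in> M \<Longrightarrow> hprel K h k b y cs z w \<longleftrightarrow> \<psi> w = hpv B \<alpha> cs (\<psi> z)"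
proof (induction cs arbitrary: z w)
  case Nil
  then show ?case using psi_eq_iff[of w z] by (auto simp del: uc.simps PB_simps)
next
  case (Cons c cs)
  have hprel_M: "hprel K h k b y cs z w \<Longrightarrow> w \<in> M" for z w by (cases cs) simp_all
  have p: "\<psi> (z [^] c \<otimes> w1) = \<psi> z [^]\<^bsub>B\<^esub> c \<otimes>\<^bsub>B\<^esub> \<psi> w1" if "w1 \<in> M" for w1
    using psi_mult[OF int_pow_M[OF Cons.prems(1)] that] psi_int_pow[OF Cons.prems(1)] by metis
  show ?case
  proof
    assume "hprel K h k b y (c # cs) z w"
    then obtain z1 w1 where *: "act K h k b y z z1" "hprel K h k b y cs z1 w1" "w \<otimes> inv (z [^] c \<otimes> w1) \<in> mid"
      unfolding hprel.simps by blast
    have z1: "z1 \<in> M" "\<psi> z1 = \<alpha> (\<psi> z)" using *(1) unfolding act_codes_iff[OF y(1,2)] by blast+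
    have w1: "w1 \<in> M" using hprel_M[OF *(2)] .
    have "\<psi> w1 = hpv B \<alpha> cs (\<alpha> (\<psi> z))" using Cons.IH[OF z1(1) w1] *(2) z1(2) by simp
    moreover have "\<psi> w = \<psi> (z [^] c \<otimes> w1)"
      using psi_eq_iff[OF Cons.prems(2) M_mult[OF int_pow_M[OF Cons.prems(1)] w1]] *(3) by blast
    ultimately show "\<psi> w = hpv B \<alpha> (c # cs) (\<psi> z)" using p[OF w1] by (simp only: hpv.simps)
  next
    assume e: "\<psi> w = hpv B \<alpha> (c # cs) (\<psi> z)"
    have az: "\<alpha> (\<psi> z) \<in> carrier B" using C_closed[OF y(3) psi_in_B[OF Cons.prems(1)]] .
    obtain z1 where z1: "z1 \<in> M" "\<alpha> (\<psi> z) = \<psi> z1" using B_cases[OF az] by metis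
    obtain w1 where w1: "w1 \<in> M" "hpv B \<alpha> cs (\<alpha> (\<psi> z)) = \<psi> w1"
      using B_cases[OF hpv_closed[OF y(3) az]] by metis
    have "act K h k b y z z1" using z1 Cons.prems unfolding act_codes_iff[OF y(1,2)] by simp
    moreover have "hprel K h k b y cs z1 w1" using Cons.IH[OF z1(1) w1(1)] w1(2) z1(2) by simp
    moreover have "\<psi> w = \<psi> (z [^] c \<otimes> w1)" using e p[OF w1(1)] w1(2) by (simp only: hpv.simps)
    then have "w \<otimes> inv (z [^] c \<otimes> w1) \<in> mid"
      using psi_eq_iff[OF Cons.prems(2) M_mult[OF int_pow_M[OF Cons.prems(1)] w1(1)]] by blast
    ultimately show "hprel K h k b y (c # cs) z w"
      unfolding hprel.simps using M_carrier[OF z1(1)] M_carrier[OF w1(1)] Cons.prems(2) by blast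
  qed
qed

lemma annih_iff:
  assumes y: "y \<in> tup K k" "codes b k y \<alpha>" "\<alpha> \<in> C"
  shows "annih K h k b y cs \<longleftrightarrow> (\<forall>\<beta> \<in> carrier B. hpv B \<alpha> cs \<beta> = \<one>\<^bsub>B\<^esub>)"
proof
  assume a: "annih K h k b y cs"
  show "\<forall>\<beta> \<in> carrier B. hpv B \<alpha> cs \<beta> = \<one>\<^bsub>B\<^esub>"
  proof
    fix \<beta> assume beta: "\<beta> \<in> carrier B"
    obtain z where z: "z \<in> M" "\<beta> = \<psi> z" using B_cases[OF beta] by metis
    obtain w where w: "w \<in> M" "hpv B \<alpha> cs \<beta> = \<psi> w" using B_cases[OF hpv_closed[OF y(3) beta]] by metis
    have "hprel K h k b y cs z w" using hprel_iff[OF y z(1) w(1)] w(2) z(2) by simp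
    then have "w \<in> mid" using a M_carrier[OF z(1)] M_carrier[OF w(1)] unfolding annih_def by blast
    then show "hpv B \<alpha> cs \<beta> = \<one>\<^bsub>B\<^esub>" using w psi_one_iff by simp
  qed
next
  assume r: "\<forall>\<beta> \<in> carrier B. hpv B \<alpha> cs \<beta> = \<one>\<^bsub>B\<^esub>"
  have hM: "hprel K h k b y cs z w \<Longrightarrow> z \<in> M \<and> w \<in> M" for z w
    by (cases cs) (auto simp: act_def simp del: uc.simps)
  show "annih K h k b y cs" unfolding annih_def
  proof (intro ballI impI)
    fix z w assume hr: "hprel K h k b y cs z w"
    then have zw: "z \<in> M" "w \<in> M" using hM by blast+
    then have "\<psi> w = \<one>\<^bsub>B\<^esub>" using hprel_iff[OF y zw] hr r psi_in_B[OF zw(1)] by metis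
    then show "w \<in> mid" using psi_one_iff[OF zw(2)] by blast
  qed
qed

lemma cspan_iff:
  assumes t: "\<And>i. i < s \<Longrightarrow> \<tau> i \<in> M"
  shows "z \<in> M \<Longrightarrow> cspan K h k b \<tau> s z \<longleftrightarrow> \<psi> z \<in> spn (\<lambda>i. \<psi> (\<tau> i)) s"
  using t
proof (induction s arbitrary: z)
  case 0
  then show ?case using psi_one_iff by (simp del: uc.simps PB_simps)
next
  case (Suc s)
  have IH: "\<And>z. z \<in> M \<Longrightarrow> cspan K h k b \<tau> s z \<longleftrightarrow> \<psi> z \<in> spn (\<lambda>i. \<psi> (\<tau> i)) s"
    using Suc.IH Suc.prems(2) by simp
  have ts: "\<tau> s \<in> M" using Suc.prems(2) by simp
  have spn_M: "cspan K h k b \<tau> s z \<Longrightarrow> z \<in> M" for z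
    by (cases s) (use mid_sub_M in \<open>simp_all del: uc.simps\<close>)
  have spn_B: "\<beta> \<in> spn (\<lambda>i. \<psi> (\<tau> i)) n \<Longrightarrow> n \<le> Suc s \<Longrightarrow> \<beta> \<in> carrier B" for \<beta> n
  proof (induction n arbitrary: \<beta>)
    case 0
    then show ?case using B.one_closed by (simp del: PB_simps)
  next
    case (Suc n)
    then obtain \<gamma> r where "\<gamma> \<in> spn (\<lambda>i. \<psi> (\<tau> i)) n" "r \<in> C" "\<beta> = \<gamma> \<otimes>\<^bsub>B\<^esub> r (\<psi> (\<tau> n))" unfolding spn.simps by blast
    moreover have "\<tau> n \<in> M" using Suc.prems(2) \<open>\<And>i. i < Suc s \<Longrightarrow> \<tau> i \<in> M\<close> by simp
    ultimately show ?case using Suc.IH Suc.prems(2) B.m_closed C_closed psi_in_B by (metis Suc_leD)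
  qed
  show ?case
  proof
    assume "cspan K h k b \<tau> (Suc s) z"
    then obtain y w z' where *: "y \<in> tup K k" "ccode K h k b y" "act K h k b y (\<tau> s) w" "cspan K h k b \<tau> s z'"
      "z \<otimes> inv (z' \<otimes> w) \<in> mid" unfolding cspan.simps by blast
    obtain r where r: "r \<in> C" "codes b k y r" using code_C[OF b ok *(1)] *(2) ccode_iff[OF b *(1)] by blast
    have w: "w \<in> M" "\<psi> w = r (\<psi> (\<tau> s))" using *(3) unfolding act_codes_iff[OF *(1) r(2)] by blast+
    have z': "z' \<in> M" "\<psi> z' \<in> spn (\<lambda>i. \<psi> (\<tau> i)) s" using spn_M[OF *(4)] IH *(4) by blast+
    have "\<psi> z = \<psi> z' \<otimes>\<^bsub>B\<^esub> \<psi> w"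
      using psi_eq_iff[OF Suc.prems(1) M_mult[OF z'(1) w(1)]] *(5) psi_mult[OF z'(1) w(1)] by metis
    then show "\<psi> z \<in> spn (\<lambda>i. \<psi> (\<tau> i)) (Suc s)" unfolding spn.simps
      using z'(2) r(1) w(2) by (intro CollectI exI[of _ "\<psi> z'"] exI[of _ r] conjI) simp_all
  next
    assume "\<psi> z \<in> spn (\<lambda>i. \<psi> (\<tau> i)) (Suc s)"
    then obtain \<beta> r where *: "\<beta> \<in> spn (\<lambda>i. \<psi> (\<tau> i)) s" "r \<in> C" "\<psi> z = \<beta> \<otimes>\<^bsub>B\<^esub> r (\<psi> (\<tau> s))"
      unfolding spn.simps by blast
    obtain y where y: "y \<in> tup K k" "bcom b k y" "codes b k y r" using C_code[OF b ok *(2)] by blast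
    obtain z' where z': "z' \<in> M" "\<beta> = \<psi> z'" using B_cases[OF spn_B[OF *(1)]] by (metis le_SucI le_refl)
    obtain w where w: "w \<in> M" "r (\<psi> (\<tau> s)) = \<psi> w" using B_cases[OF C_closed[OF *(2) psi_in_B[OF ts]]] by metis
    have "cspan K h k b \<tau> s z'" using IH[OF z'(1)] *(1) z'(2) by simp
    moreover have "act K h k b y (\<tau> s) w" unfolding act_codes_iff[OF y(1,3)] using ts w by simp
    moreover have "z \<otimes> inv (z' \<otimes> w) \<in> mid"
      using psi_eq_iff[OF Suc.prems(1) M_mult[OF z'(1) w(1)]] *(3) psi_mult[OF z'(1) w(1)] z'(2) w(2) by metis
    moreover have "ccode K h k b y" using ccode_iff[OF b y(1)] y(2) by blast
    ultimately show "cspan K h k b \<tau> (Suc s) z"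
      unfolding cspan.simps using y(1) M_carrier[OF w(1)] M_carrier[OF z'(1)] Suc.prems(1) by blast
  qed
qed

lemma codes_unique: "\<alpha> \<in> C \<Longrightarrow> \<gamma> \<in> C \<Longrightarrow> codes b k y \<alpha> \<Longrightarrow> codes b k y \<gamma> \<Longrightarrow> \<alpha> = \<gamma>"
  by (rule C_ext) (use C_closed in \<open>unfold codes_def, blast+\<close>)

text \<open>The pairing is additive on both sides, so sums and multiples of endomorphisms correspond
  to entrywise products and powers of codes. This is how generation of \<open>C\<close> modulo
  \<open>n\<close> is expressed in \<open>K\<close>.\<close>

lemma code_sum:
  fixes e :: "nat \<Rightarrow> nat" and n :: nat
  assumes x: "\<And>l. l < d \<Longrightarrow> x l \<in> C" "\<And>l. l < d \<Longrightarrow> codes b k (\<sigma> l) (x l)" "\<And>l. l < d \<Longrightarrow> \<sigma> l \<in> tup K k"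
    and u: "u \<in> C" "codes b k y' u" "y' \<in> tup K k" and \<beta>: "\<beta> \<in> carrier B" and j: "j < k"
  shows "(lprod (add_monoid R) (\<lambda>l. x l [^]\<^bsub>add_monoid R\<^esub> e l) d \<oplus>\<^bsub>R\<^esub> add_pow R n u) \<beta> (b j) =
    \<beta> (lprod K (\<lambda>l. \<sigma> l j [^] e l) d \<otimes> y' j [^] n)"
proof -
  let ?A = "add_monoid R"
  have gA: "group ?A" by (rule addR_group)
  interpret ev: group_hom ?A B "\<lambda>\<alpha>. \<alpha> \<beta>" by (rule ev_hom[OF \<beta>])
  have bj: "b j \<in> carrier K" using tup_carrier[OF b] .
  interpret l: group_hom B Q "\<lambda>\<beta>. \<beta> (b j)" by (rule left_hom[OF bj])
  interpret r: group_hom K Q \<beta> by (rule right_hom[OF \<beta>])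
  have sc: "\<sigma> l j \<in> carrier K" if "l < d" for l using tup_carrier[OF x(3)[OF that]] .
  have yc: "y' j \<in> carrier K" using tup_carrier[OF u(3)] .
  have xA: "x l \<in> carrier ?A" if "l < d" for l using x(1)[OF that] by simp
  have xp: "x l [^]\<^bsub>?A\<^esub> e l \<in> carrier ?A" if "l < d" for l
    using monoid.nat_pow_closed[OF group.is_monoid[OF gA] xA[OF that]] .
  have xb: "x l \<beta> \<in> carrier B" if "l < d" for l using C_closed[OF x(1)[OF that] \<beta>] .
  let ?L = "lprod ?A (\<lambda>l. x l [^]\<^bsub>?A\<^esub> e l) d"
  have "?L \<beta> = lprod B (\<lambda>l. (x l [^]\<^bsub>?A\<^esub> e l) \<beta>) d" by (rule ev.hom_lprod[OF xp])
  also have "\<dots> = lprod B (\<lambda>l. x l \<beta> [^]\<^bsub>B\<^esub> e l) d"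
    by (rule lprod_cong) (rule ev.hom_nat_pow[OF xA])
  finally have "?L \<beta> (b j) = lprod Q (\<lambda>l. (x l \<beta> [^]\<^bsub>B\<^esub> e l) (b j)) d"
    using l.hom_lprod[of d "\<lambda>l. x l \<beta> [^]\<^bsub>B\<^esub> e l"] B.nat_pow_closed[OF xb] by simp
  also have "\<dots> = lprod Q (\<lambda>l. \<beta> (\<sigma> l j [^] e l)) d"
  proof (rule lprod_cong)
    fix l assume ld: "l < d"
    have "x l \<beta> (b j) = \<beta> (\<sigma> l j)" using codes_eval[OF b ok x(2)[OF ld] C_E[OF x(1)[OF ld]] \<beta> j] .
    then show "(x l \<beta> [^]\<^bsub>B\<^esub> e l) (b j) = \<beta> (\<sigma> l j [^] e l)"
      using l.hom_nat_pow[OF xb[OF ld]] r.hom_nat_pow[OF sc[OF ld]] by metis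
  qed
  also have "\<dots> = \<beta> (lprod K (\<lambda>l. \<sigma> l j [^] e l) d)"
    using r.hom_lprod[of d "\<lambda>l. \<sigma> l j [^] e l"] sc by simp
  finally have 1: "?L \<beta> (b j) = \<beta> (lprod K (\<lambda>l. \<sigma> l j [^] e l) d)" .
  have ub: "u \<beta> \<in> carrier B" using C_closed[OF u(1) \<beta>] .
  have "add_pow R n u \<beta> (b j) = (u \<beta> [^]\<^bsub>B\<^esub> n) (b j)" using add_pow_eval(2)[OF u(1) \<beta>] by simp
  also have "\<dots> = u \<beta> (b j) [^]\<^bsub>Q\<^esub> n" using l.hom_nat_pow[OF ub] .
  also have "u \<beta> (b j) = \<beta> (y' j)" using codes_eval[OF b ok u(2) C_E[OF u(1)] \<beta> j] .
  also have "\<beta> (y' j) [^]\<^bsub>Q\<^esub> n = \<beta> (y' j [^] n)" using r.hom_nat_pow[OF yc] by simp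
  finally have 2: "add_pow R n u \<beta> (b j) = \<beta> (y' j [^] n)" .
  have LC: "?L \<in> C" using monoid.lprod_closed[OF group.is_monoid[OF gA] xp] by simp
  have nC: "add_pow R n u \<in> C" using monoid.nat_pow_closed[OF group.is_monoid[OF gA], of u n] u(1) by (simp add: add_pow_def)
  have "(?L \<oplus>\<^bsub>R\<^esub> add_pow R n u) \<beta> (b j) = ?L \<beta> (b j) \<otimes>\<^bsub>Q\<^esub> add_pow R n u \<beta> (b j)"
    using p_mult_left[OF C_closed[OF LC \<beta>] C_closed[OF nC \<beta>] bj] R_simps(3)[OF \<beta>] by metis
  also have "\<dots> = \<beta> (lprod K (\<lambda>l. \<sigma> l j [^] e l) d \<otimes> y' j [^] n)"
    unfolding 1 2 using r.hom_mult[of "lprod K (\<lambda>l. \<sigma> l j [^] e l) d" "y' j [^] n"] lprod_closed[of d "\<lambda>l. \<sigma> l j [^] e l"] sc yc by simp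
  finally show ?thesis .
qed

end

end

lemma (in group) generate_enum:
  assumes "fgs G U" shows "\<exists>(s::nat) t. (\<forall>i<s. t i \<in> U) \<and> generate G (t ` {..<s}) = U"
proof -
  obtain T where T: "finite T" "T \<subseteq> carrier G" "generate G T = U" using assms unfolding fgs_def by blast
  obtain t and s :: nat where t: "T = t ` {..<s}"
    using T(1) by (metis finite_imp_nat_seg_image_inj_on lessThan_def)
  have "T \<subseteq> U" using T(3) subset_generate[of T T G] by blast
  then have "\<forall>i<s. t i \<in> U" using t by blast
  then show ?thesis using T(3) t by blast
qed

context group_level
begin

lemma psi_generate:
  assumes "\<And>i. i < s \<Longrightarrow> t i \<in> M"
  shows "\<psi> ` generate K (t ` {..<s}) = generate B ((\<lambda>i. \<psi> (t i)) ` {..<s})"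
proof -
  have sub: "t ` {..<s} \<subseteq> M" using assms by blast
  have "generate K (t ` {..<s}) = generate (K\<lparr>carrier := M\<rparr>) (t ` {..<s})"
    using generate_consistent[OF sub normalD(1)[OF uc_normal]] by simp
  moreover have "\<psi> ` generate (K\<lparr>carrier := M\<rparr>) (t ` {..<s}) = generate B (\<psi> ` t ` {..<s})"
    using group_hom.generate_img[OF psi_hom, of "t ` {..<s}"] sub by (simp del: uc.simps PB_simps)
  ultimately show ?thesis by (simp add: image_image)
qed

text \<open>All data are chosen before \<open>n\<close>, because here the x_l generate
  \<open>C\<close> outright, and \<open>KH\<close> may be any exponent. \<sigma> and \<tau> are
  terms over \<open>a\<close>, but \<omega> are terms over the \<tau> i: the \<tau> i generate
  \<open>M\<close>, so the images under x_l have representatives that are words in them.\<close>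

lemma level_holds:
  assumes noeth: "noeth K" and a: "a \<in> tup K k" "generate K (a ` {..<k}) = carrier K"
  shows "\<exists>d d' s cs KG \<sigma> \<tau> \<omega>. d' \<le> d \<and> (\<forall>l<d'. cs l = replicate KG 0) \<and> (\<forall>l j. k \<le> j \<longrightarrow> \<sigma> l j = GOne) \<and>
    (\<forall>n>0. level K h k d d' s cs KH n a (\<lambda>l j. teval K a (\<sigma> l j)) (\<lambda>i. teval K a (\<tau> i))
      (\<lambda>l i. teval K (\<lambda>i. if i < s then teval K a (\<tau> i) else \<one>) (\<omega> l i)))"
proof -
  let ?A = "add_monoid R"
  have ok: "bok a k" by (rule bok_generate[OF a])
  have range_a: "range a \<subseteq> carrier K" using tup_carrier[OF a(1)] by blast
  obtain d d' :: nat and x cs KG where D: "d' \<le> d" "\<And>l. l < d \<Longrightarrow> x l \<in> C" "generate ?A (x ` {..<d}) = C"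
    "generate ?A (x ` {..<d'}) = rad R {\<zero>\<^bsub>R\<^esub>}"
    "\<And>l \<beta>. l < d \<Longrightarrow> \<beta> \<in> carrier B \<Longrightarrow> hpv B (x l) (cs l) \<beta> = \<one>\<^bsub>B\<^esub>" "\<And>l. l < d' \<Longrightarrow> cs l = replicate KG 0"
    using C_generators[OF noeth_B[OF noeth]] by blast
  have term_ex: "\<exists>t. teval K a t = g" if "g \<in> carrier K" for g
    using generate_term[of g K a k] a(2) that by blast
  have "\<exists>y. l < d \<longrightarrow> y \<in> tup K k \<and> bcom a k y \<and> codes a k y (x l)" for l
    using C_code[OF a(1) ok D(2)] by blast
  then obtain \<sigma>0 where s0: "\<And>l. l < d \<Longrightarrow> \<sigma>0 l \<in> tup K k" "\<And>l. l < d \<Longrightarrow> bcom a k (\<sigma>0 l)" "\<And>l. l < d \<Longrightarrow> codes a k (\<sigma>0 l) (x l)"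
    by metis
  have "\<exists>t. (l < d \<longrightarrow> teval K a t = \<sigma>0 l j) \<and> (k \<le> j \<longrightarrow> t = GOne)" for l j
  proof (cases "l < d \<and> j < k")
    case True
    then obtain t where "teval K a t = \<sigma>0 l j" using term_ex[OF tup_carrier[OF s0(1)], of l j] by blast
    then show ?thesis using True by (intro exI[of _ t]) simp
  next
    case False
    have "\<sigma>0 l j = \<one>" if "l < d"
      using s0(1)[OF that] that False by (simp add: tup_def)
    then show ?thesis by (intro exI[of _ GOne]) simp
  qed
  then obtain \<sigma> where s: "\<And>l j. l < d \<Longrightarrow> teval K a (\<sigma> l j) = \<sigma>0 l j" "\<And>l j. k \<le> j \<Longrightarrow> \<sigma> l j = GOne" by metis
  have "fgs K M" using noeth normalD(1)[OF uc_normal, of "Suc (Suc h)"] unfolding noeth_def by blast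
  from generate_enum[OF this] obtain s :: nat and \<tau>0 where "\<forall>i<s. \<tau>0 i \<in> M" and t0': "generate K (\<tau>0 ` {..<s}) = M"
    by (elim exE conjE)
  then have t0: "\<And>i. i < s \<Longrightarrow> \<tau>0 i \<in> M" "generate K (\<tau>0 ` {..<s}) = M" by simp_all
  have "\<exists>t. i < s \<longrightarrow> teval K a t = \<tau>0 i" for i using term_ex M_carrier[OF t0(1)] by blast
  then obtain \<tau> where t: "\<And>i. i < s \<Longrightarrow> teval K a (\<tau> i) = \<tau>0 i" by metis
  \<comment> \<open>Padding with one from \<open>s\<close> on keeps every word over this assignment
    inside the subgroup generated by the first \<open>s\<close> entries.\<close>
  define \<tau>1 where "\<tau>1 = (\<lambda>i. if i < s then teval K a (\<tau> i) else \<one>)"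
  have im: "\<tau>1 ` {..<s} = \<tau>0 ` {..<s}" by (rule image_cong) (simp_all add: \<tau>1_def t)
  have "\<exists>w. l < d \<longrightarrow> i < s \<longrightarrow> teval K \<tau>1 w \<in> M \<and> \<psi> (teval K \<tau>1 w) = x l (\<psi> (\<tau>0 i))" for l i
  proof (cases "l < d \<and> i < s")
    case True
    then have "x l (\<psi> (\<tau>0 i)) \<in> carrier B" using C_closed[OF D(2) psi_in_B[OF t0(1)]] by blast
    then obtain m where m: "m \<in> M" "x l (\<psi> (\<tau>0 i)) = \<psi> m" using B_cases by metis
    then have "m \<in> generate K (\<tau>1 ` {..<s})" unfolding im t0(2) by blast
    from generate_term[OF this] show ?thesis using m by metis
  qed blast
  then obtain \<omega> where w: "\<And>l i. l < d \<Longrightarrow> i < s \<Longrightarrow> teval K \<tau>1 (\<omega> l i) \<in> M"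
    "\<And>l i. l < d \<Longrightarrow> i < s \<Longrightarrow> \<psi> (teval K \<tau>1 (\<omega> l i)) = x l (\<psi> (\<tau>0 i))" by metis
  let ?\<sigma> = "\<lambda>l j. teval K a (\<sigma> l j)" and ?\<tau> = "\<lambda>i. teval K a (\<tau> i)" and ?\<upsilon> = "\<lambda>l i. teval K \<tau>1 (\<omega> l i)"
  have \<sigma>e: "?\<sigma> l = \<sigma>0 l" if "l < d" for l using s(1)[OF that] by blast
  have "level K h k d d' s cs KH n a ?\<sigma> ?\<tau> ?\<upsilon>" if n: "0 < n" for n
    unfolding level_def
  proof (intro conjI)
    show "okt K h k a" using okt_iff[OF a(1)] ok by blast
    show "\<forall>l<d. ccode K h k a (?\<sigma> l)" using \<sigma>e s0(1,2) ccode_iff[OF a(1)] by simp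
    show "\<forall>i<s. ?\<tau> i \<in> M" using t t0(1) by simp
    show "\<forall>l<d. \<forall>i<s. act K h k a (?\<sigma> l) (?\<tau> i) (?\<upsilon> l i)"
      using act_codes_iff[OF a(1) ok s0(1,3)] \<sigma>e t t0(1) w by simp
    show "\<forall>l<d. annih K h k a (?\<sigma> l) (cs l)"
      using annih_iff[OF a(1) ok s0(1,3) D(2)] \<sigma>e D(5) by simp
    show "\<forall>z \<in> carrier K. z \<in> M \<longrightarrow> cspan K h k a ?\<tau> s z"
    proof (intro ballI impI)
      fix z assume z: "z \<in> M"
      have "\<psi> z \<in> generate B ((\<lambda>i. \<psi> (\<tau>0 i)) ` {..<s})"
        using psi_generate[of s \<tau>0] t0 z by blast
      also have "(\<lambda>i. \<psi> (\<tau>0 i)) ` {..<s} = (\<lambda>i. \<psi> (?\<tau> i)) ` {..<s}" by (rule image_cong) (simp_all add: t)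
      finally have "\<psi> z \<in> spn (\<lambda>i. \<psi> (?\<tau> i)) s"
        by (intro generate_spn) (use t t0(1) psi_in_B in metis)
      then show "cspan K h k a ?\<tau> s z" using cspan_iff[OF a(1) ok, of s ?\<tau> z] t t0(1) z by simp
    qed
    show "\<forall>y \<in> tup K k. ccode K h k a y \<longrightarrow> (\<exists>e \<in> digits d n. \<exists>y' \<in> tup K k. ccode K h k a y' \<and>
      (\<forall>z \<in> carrier K. z \<in> M \<longrightarrow> (\<forall>j<k. com K z (y j) \<otimes>
        inv (com K z (lprod K (\<lambda>l. ?\<sigma> l j [^] e l) d \<otimes> y' j [^] n)) \<in> low)))"
    proof (intro ballI impI)
      fix y assume y: "y \<in> tup K k" "ccode K h k a y"
      obtain r where r: "r \<in> C" "codes a k y r" using code_C[OF a(1) ok y(1)] y ccode_iff[OF a(1)] by blast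
      obtain e u where e: "e \<in> digits d n" "u \<in> C" "r = lprod ?A (\<lambda>l. x l [^]\<^bsub>?A\<^esub> e l) d \<oplus>\<^bsub>R\<^esub> add_pow R n u"
        using C_digits[OF D(2,3) n r(1)] by blast
      obtain y' where y': "y' \<in> tup K k" "bcom a k y'" "codes a k y' u" using C_code[OF a(1) ok e(2)] by blast
      have "com K z (y j) \<otimes> inv (com K z (lprod K (\<lambda>l. ?\<sigma> l j [^] e l) d \<otimes> y' j [^] n)) \<in> low"
        if z: "z \<in> M" and j: "j < k" for z j
      proof -
        have sc: "\<sigma>0 l j \<in> carrier K" if "l < d" for l using tup_carrier[OF s0(1)[OF that]] .
        have "lprod K (\<lambda>l. ?\<sigma> l j [^] e l) d = lprod K (\<lambda>l. \<sigma>0 l j [^] e l) d" by (rule lprod_cong) (simp add: s(1))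
        moreover have "lprod K (\<lambda>l. \<sigma>0 l j [^] e l) d \<otimes> y' j [^] n \<in> carrier K"
          using lprod_closed[of d "\<lambda>l. \<sigma>0 l j [^] e l"] sc tup_carrier[OF y'(1)] by simp
        moreover have "r (\<psi> z) (a j) = \<psi> z (lprod K (\<lambda>l. \<sigma>0 l j [^] e l) d \<otimes> y' j [^] n)"
          unfolding e(3) by (rule code_sum[OF a(1) ok D(2) s0(3,1) e(2) y'(3,1) psi_in_B[OF z] j])
        moreover have "r (\<psi> z) (a j) = \<psi> z (y j)" using codes_eval[OF a(1) ok r(2) C_E[OF r(1)] psi_in_B[OF z] j] .
        ultimately show ?thesis using psi_eval_eq_iff[OF z z tup_carrier[OF y(1), of j]] by metis
      qed
      then show "\<exists>e \<in> digits d n. \<exists>y' \<in> tup K k. ccode K h k a y' \<and>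
        (\<forall>z \<in> carrier K. z \<in> M \<longrightarrow> (\<forall>j<k. com K z (y j) \<otimes>
          inv (com K z (lprod K (\<lambda>l. ?\<sigma> l j [^] e l) d \<otimes> y' j [^] n)) \<in> low))"
        using e(1) y'(1,2) ccode_iff[OF a(1) y'(1)] by (intro bexI[of _ e] bexI[of _ y']) simp_all
    qed
    show "\<forall>y \<in> tup K k. ccode K h k a y \<longrightarrow> annih K h k a y (replicate KH 0) \<longrightarrow>
      (\<forall>z \<in> carrier K. \<forall>z' \<in> carrier K. act K h k a y z z' \<longrightarrow>
        (\<exists>us \<in> tup K d'. \<exists>ws \<in> tup K d'. (\<forall>l<d'. act K h k a (?\<sigma> l) (us l) (ws l)) \<and>
          z' \<otimes> inv (lprod K ws d') \<in> mid))"
    proof (intro ballI impI)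
      fix y z z' assume y: "y \<in> tup K k" "ccode K h k a y" "annih K h k a y (replicate KH 0)" and act: "act K h k a y z z'"
      obtain r where r: "r \<in> C" "codes a k y r" using code_C[OF a(1) ok y(1)] y ccode_iff[OF a(1)] by blast
      have zz: "z \<in> M" "z' \<in> M" "\<psi> z' = r (\<psi> z)" using act unfolding act_codes_iff[OF a(1) ok y(1) r(2)] by blast+
      have "r [^]\<^bsub>R\<^esub> KH = \<zero>\<^bsub>R\<^esub>"
        using annih_iff[OF a(1) ok y(1) r(2,1)] y(3) hpv_replicate_iff[OF r(1)] by blast
      \<comment> \<open>Vanishing of any power puts r into the nilradical, which the first
        \<open>d'\<close> generators span; this is why \<open>KH\<close> is unrestricted.\<close>
      then have rg: "r \<in> generate ?A (x ` {..<d'})" unfolding D(4) rad_def using r(1) by auto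
      have xC': "\<And>l. l < d' \<Longrightarrow> x l \<in> C" using D(1,2) by simp
      obtain vs where vs: "\<forall>l<d'. vs l \<in> carrier B" "r (\<psi> z) = lprod B (\<lambda>l. x l (vs l)) d'"
        using rad_image[OF xC' rg psi_in_B[OF zz(1)]] by blast
      have "\<exists>u w. l < d' \<longrightarrow> u \<in> M \<and> w \<in> M \<and> vs l = \<psi> u \<and> x l (vs l) = \<psi> w" for l
      proof (cases "l < d'")
        case True
        then have "vs l \<in> carrier B" "x l (vs l) \<in> carrier B" using vs(1) C_closed[OF xC'] by blast+
        then show ?thesis using B_cases by metis
      qed blast
      then obtain us ws where uw: "\<And>l. l < d' \<Longrightarrow> us l \<in> M \<and> ws l \<in> M \<and> vs l = \<psi> (us l) \<and> x l (vs l) = \<psi> (ws l)" by metis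
      let ?us = "\<lambda>l. if l < d' then us l else \<one>" and ?ws = "\<lambda>l. if l < d' then ws l else \<one>"
      have "?us \<in> tup K d'" "?ws \<in> tup K d'" using uw M_carrier by (simp_all add: tup_def del: uc.simps)
      moreover have "\<forall>l<d'. act K h k a (?\<sigma> l) (?us l) (?ws l)"
      proof (intro allI impI)
        fix l assume l: "l < d'"
        then have ld: "l < d" using D(1) by simp
        show "act K h k a (?\<sigma> l) (?us l) (?ws l)"
        proof -
          have "x l (\<psi> (us l)) = \<psi> (ws l)" using uw[OF l] by metis
          then show ?thesis
            unfolding \<sigma>e[OF ld] act_codes_iff[OF a(1) ok s0(1)[OF ld] s0(3)[OF ld]]
            using uw[OF l] l by (simp del: uc.simps)
        qed
      qed
      moreover have "z' \<otimes> inv (lprod K ?ws d') \<in> mid"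
      proof -
        have "lprod K ?ws d' = lprod K ws d'" by (rule lprod_cong) simp
        moreover have "\<psi> (lprod K ws d') = lprod B (\<lambda>l. \<psi> (ws l)) d'" by (rule psi_lprod) (use uw in blast)
        moreover have "lprod B (\<lambda>l. \<psi> (ws l)) d' = lprod B (\<lambda>l. x l (vs l)) d'" by (rule lprod_cong) (use uw in metis)
        moreover have "lprod K ws d' \<in> M" by (rule lprod_M) (use uw in blast)
        ultimately show ?thesis using psi_eq_iff[OF zz(2)] zz(3) vs(2) by metis
      qed
      ultimately show "\<exists>us \<in> tup K d'. \<exists>ws \<in> tup K d'. (\<forall>l<d'. act K h k a (?\<sigma> l) (us l) (ws l)) \<and>
          z' \<otimes> inv (lprod K ws d') \<in> mid"
        by - (rule bexI[of _ ?us], rule bexI[of _ ?ws], rule conjI, assumption+)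
    qed
  qed
  then have "d' \<le> d \<and> (\<forall>l<d'. cs l = replicate KG 0) \<and> (\<forall>l j. k \<le> j \<longrightarrow> \<sigma> l j = GOne) \<and>
    (\<forall>n>0. level K h k d d' s cs KH n a (\<lambda>l j. teval K a (\<sigma> l j)) (\<lambda>i. teval K a (\<tau> i))
      (\<lambda>l i. teval K (\<lambda>i. if i < s then teval K a (\<tau> i) else \<one>) (\<omega> l i)))"
    using D(1,6) s(2) unfolding \<tau>1_def by (intro conjI allI impI) simp_all
  then show ?thesis by (intro exI) assumption
qed

text \<open>Here \<open>b\<close> is not known to generate \<open>K\<close>; the clause
  \<open>okt\<close> takes over the role of generation when codes are decoded into elements of
  \<open>C\<close>.\<close>

lemma level_semantics:
  assumes b: "b \<in> tup K k" and s: "\<And>l. l < d \<Longrightarrow> \<sigma> l \<in> tup K k" and lv: "level K h k d d' s cs KH n b \<sigma> \<tau> \<upsilon>" and d': "d' \<le> d"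
  shows "\<exists>x. (\<forall>l<d. x l \<in> C) \<and> (\<forall>i<s. \<tau> i \<in> M) \<and> (\<forall>l<d. \<forall>i<s. x l (\<psi> (\<tau> i)) = \<psi> (\<upsilon> l i)) \<and>
    (\<forall>r \<in> C. \<exists>g \<in> generate (add_monoid R) (x ` {..<d}). \<exists>u \<in> C. r = g \<oplus>\<^bsub>R\<^esub> add_pow R n u) \<and>
    (\<forall>l<d. \<forall>\<beta> \<in> carrier B. hpv B (x l) (cs l) \<beta> = \<one>\<^bsub>B\<^esub>) \<and> carrier B \<subseteq> spn (\<lambda>i. \<psi> (\<tau> i)) s \<and>
    (\<forall>r \<in> C. r [^]\<^bsub>R\<^esub> KH = \<zero>\<^bsub>R\<^esub> \<longrightarrow> (\<forall>\<beta> \<in> carrier B.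
      \<exists>us. (\<forall>l<d'. us l \<in> carrier B) \<and> r \<beta> = lprod B (\<lambda>l. x l (us l)) d'))"
proof -
  let ?A = "add_monoid R"
  note L = lv[unfolded level_def]
  note L1 = conjunct1[OF L] and r1 = conjunct2[OF L]
  note L2 = conjunct1[OF r1] and r2 = conjunct2[OF r1]
  note L3 = conjunct1[OF r2] and r3 = conjunct2[OF r2]
  note L4 = conjunct1[OF r3] and r4 = conjunct2[OF r3]
  note L5 = conjunct1[OF r4] and r5 = conjunct2[OF r4]
  note L6 = conjunct1[OF r5] and r6 = conjunct2[OF r5]
  note L7 = conjunct1[OF r6] and L8 = conjunct2[OF r6]
  have ok: "bok b k" using L1 okt_iff[OF b] by blast
  have "\<exists>x. x \<in> C \<and> codes b k (\<sigma> l) x" if l: "l < d" for l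
    using code_C[OF b ok s[OF l]] ccode_iff[OF b s[OF l]] L2 l by blast
  then obtain x where x: "\<And>l. l < d \<Longrightarrow> x l \<in> C" "\<And>l. l < d \<Longrightarrow> codes b k (\<sigma> l) (x l)" by metis
  have act: "act K h k b (\<sigma> l) z z' \<longleftrightarrow> z \<in> M \<and> z' \<in> M \<and> \<psi> z' = x l (\<psi> z)" if "l < d" for l z z'
    by (rule act_codes_iff[OF b ok s[OF that] x(2)[OF that]])
  have tM: "\<forall>i<s. \<tau> i \<in> M" by (rule L3)
  have f1: "\<forall>l<d. \<forall>i<s. x l (\<psi> (\<tau> i)) = \<psi> (\<upsilon> l i)"
  proof (intro allI impI)
    fix l i assume li: "l < d" "i < s"
    then have "act K h k b (\<sigma> l) (\<tau> i) (\<upsilon> l i)" using L4 by blast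
    then show "x l (\<psi> (\<tau> i)) = \<psi> (\<upsilon> l i)" using act[OF li(1)] by simp
  qed
  have f2: "\<exists>g \<in> generate ?A (x ` {..<d}). \<exists>u \<in> C. r = g \<oplus>\<^bsub>R\<^esub> add_pow R n u" if r: "r \<in> C" for r
  proof -
    obtain y where y: "y \<in> tup K k" "bcom b k y" "codes b k y r" using C_code[OF b ok r] by blast
    then have cc: "ccode K h k b y" using ccode_iff[OF b] by blast
    define D where "D e y' \<longleftrightarrow> (\<forall>z \<in> carrier K. z \<in> M \<longrightarrow> (\<forall>j<k. com K z (y j) \<otimes>
        inv (com K z (lprod K (\<lambda>l. \<sigma> l j [^] e l) d \<otimes> y' j [^] n)) \<in> low))" for e :: "nat \<Rightarrow> nat" and y'
    have "\<exists>e \<in> digits d n. \<exists>y' \<in> tup K k. ccode K h k b y' \<and> D e y'"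
      unfolding D_def by (rule mp[OF bspec[OF L5 y(1)] cc])
    then obtain e y' where e: "y' \<in> tup K k" "ccode K h k b y'" "D e y'" by blast
    note e(3)[unfolded D_def]
    note e = e(1,2) this
    obtain u where u: "u \<in> C" "codes b k y' u" using code_C[OF b ok e(1)] e(2) ccode_iff[OF b e(1)] by blast
    let ?g = "lprod ?A (\<lambda>l. x l [^]\<^bsub>?A\<^esub> e l) d"
    have xA: "x l \<in> carrier ?A" if "l < d" for l using x(1)[OF that] by simp
    have g: "?g \<in> generate ?A (x ` {..<d})"
      using comm_group.lprod_in_generate[OF addR, of d x "\<lambda>l. int (e l)"] xA by (simp add: int_pow_int)
    have gC: "?g \<in> C"
      using monoid.lprod_closed[OF group.is_monoid[OF addR_group], of d "\<lambda>l. x l [^]\<^bsub>?A\<^esub> e l"]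
        monoid.nat_pow_closed[OF group.is_monoid[OF addR_group] xA] by simp
    have nC: "add_pow R n u \<in> C"
      using monoid.nat_pow_closed[OF group.is_monoid[OF addR_group], of u n] u(1) by (simp add: add_pow_def)
    let ?\<rho> = "?g \<oplus>\<^bsub>R\<^esub> add_pow R n u"
    have \<rho>C: "?\<rho> \<in> C" using R_closed(2)[OF gC nC] .
    have "codes b k y ?\<rho>"
    proof (rule codesI[OF b ok C_E[OF \<rho>C]])
      fix \<beta> j assume \<beta>: "\<beta> \<in> carrier B" and j: "j < k"
      obtain z where z: "z \<in> M" "\<beta> = \<psi> z" using B_cases[OF \<beta>] by metis
      have c: "lprod K (\<lambda>l. \<sigma> l j [^] e l) d \<otimes> y' j [^] n \<in> carrier K"
        using lprod_closed[of d "\<lambda>l. \<sigma> l j [^] e l"] tup_carrier[OF s] tup_carrier[OF e(1)] by simp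
      have "?\<rho> \<beta> (b j) = \<beta> (lprod K (\<lambda>l. \<sigma> l j [^] e l) d \<otimes> y' j [^] n)"
        by (rule code_sum[OF b ok x s u e(1) \<beta> j])
      also have "\<dots> = \<beta> (y j)"
        using psi_eval_eq_iff[OF z(1) z(1) tup_carrier[OF y(1), of j] c] e(3) M_carrier[OF z(1)] z(1) j
        unfolding z(2) by metis
      finally show "?\<rho> \<beta> (b j) = \<beta> (y j)" .
    qed
    then have "r = ?\<rho>" using codes_unique[OF b ok r \<rho>C y(3)] by blast
    then show ?thesis using g u(1) by blast
  qed
  have f3: "\<forall>l<d. \<forall>\<beta> \<in> carrier B. hpv B (x l) (cs l) \<beta> = \<one>\<^bsub>B\<^esub>"
    using annih_iff[OF b ok s x(2,1)] L6 by blast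
  have f4: "carrier B \<subseteq> spn (\<lambda>i. \<psi> (\<tau> i)) s"
  proof
    fix \<beta> assume "\<beta> \<in> carrier B"
    then obtain z where z: "z \<in> M" "\<beta> = \<psi> z" using B_cases by metis
    have "cspan K h k b \<tau> s z" using L7 z(1) M_carrier[OF z(1)] by blast
    then show "\<beta> \<in> spn (\<lambda>i. \<psi> (\<tau> i)) s" using cspan_iff[OF b ok, of s \<tau> z] tM z by simp
  qed
  have f5: "\<exists>us. (\<forall>l<d'. us l \<in> carrier B) \<and> r \<beta> = lprod B (\<lambda>l. x l (us l)) d'"
    if r: "r \<in> C" "r [^]\<^bsub>R\<^esub> KH = \<zero>\<^bsub>R\<^esub>" and \<beta>: "\<beta> \<in> carrier B" for r \<beta>
  proof -
    obtain y where y: "y \<in> tup K k" "bcom b k y" "codes b k y r" using C_code[OF b ok r(1)] by blast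
    have cc: "ccode K h k b y" using ccode_iff[OF b y(1)] y(2) by blast
    have an: "annih K h k b y (replicate KH 0)"
      using annih_iff[OF b ok y(1,3) r(1)] hpv_replicate_iff[OF r(1)] r(2) by blast
    obtain z where z: "z \<in> M" "\<beta> = \<psi> z" using B_cases[OF \<beta>] by metis
    obtain z' where z': "z' \<in> M" "r \<beta> = \<psi> z'" using B_cases[OF C_closed[OF r(1) \<beta>]] by metis
    have "act K h k b y z z'" unfolding act_codes_iff[OF b ok y(1,3)] using z z' by simp
    then obtain us ws where uw: "\<forall>l<d'. act K h k b (\<sigma> l) (us l) (ws l)" "z' \<otimes> inv (lprod K ws d') \<in> mid"
      using L8[rule_format, OF y(1) cc an M_carrier[OF z(1)] M_carrier[OF z'(1)]] by blast
    have uw': "us l \<in> M \<and> ws l \<in> M \<and> \<psi> (ws l) = x l (\<psi> (us l))" if "l < d'" for l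
    proof -
      have ld: "l < d" using that d' by simp
      show ?thesis using uw(1) that act[OF ld] by blast
    qed
    have "\<psi> z' = \<psi> (lprod K ws d')"
      using psi_eq_iff[OF z'(1) lprod_M[of d' ws]] uw(2) uw' by blast
    also have "\<dots> = lprod B (\<lambda>l. \<psi> (ws l)) d'" by (rule psi_lprod) (use uw' in blast)
    also have "\<dots> = lprod B (\<lambda>l. x l (\<psi> (us l))) d'" by (rule lprod_cong) (use uw' in blast)
    finally have "r \<beta> = lprod B (\<lambda>l. x l (\<psi> (us l))) d'" using z'(2) by simp
    then show ?thesis using uw' psi_in_B by (intro exI[of _ "\<lambda>l. \<psi> (us l)"]) blast
  qed
  have f0: "\<forall>l<d. x l \<in> C" using x(1) by blast
  show ?thesis
    by (rule exI[of _ x], intro conjI ballI impI f0 tM f1 f3 f4, erule f2, erule (2) f5)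
qed

text \<open>\<open>finitely_many_bad_levels\<close> is applied to the images S N of the subgroups
  generated by the \<tau> N i. Stability under x N l is checked on generators: \<tau> N i goes to
  \<upsilon> N l i, a member of the same subgroup. The tuples \<open>b N\<close> vary, but all x N l
  live in the one ring \<open>R\<close>.\<close>

lemma finitely_many_bad_tuples:
  assumes noeth: "noeth K" and KH: "\<And>r. r \<in> rad R {\<zero>\<^bsub>R\<^esub>} \<Longrightarrow> r [^]\<^bsub>R\<^esub> KH = \<zero>\<^bsub>R\<^esub>"
    and d': "d' \<le> d" and cs: "\<And>l. l < d' \<Longrightarrow> cs l = replicate KG 0"
    and b: "\<And>N. b N \<in> tup K k" and s: "\<And>N l. l < d \<Longrightarrow> \<sigma> N l \<in> tup K k"
    and lv: "\<And>N. level K h k d d' s cs KH (fact N) (b N) (\<sigma> N) (\<tau> N) (\<upsilon> N)"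
    and u: "\<And>N l i. l < d \<Longrightarrow> i < s \<Longrightarrow> \<upsilon> N l i \<in> generate K (\<tau> N ` {..<s})"
  shows "finite {N. \<not> (\<forall>z \<in> M. \<exists>v \<in> generate K (\<tau> N ` {..<s}). z \<otimes> inv v \<in> mid)}"
proof -
  define P where "P N x \<longleftrightarrow> (\<forall>l<d. x l \<in> C) \<and> (\<forall>i<s. \<tau> N i \<in> M) \<and> (\<forall>l<d. \<forall>i<s. x l (\<psi> (\<tau> N i)) = \<psi> (\<upsilon> N l i)) \<and>
    (\<forall>r \<in> C. \<exists>g \<in> generate (add_monoid R) (x ` {..<d}). \<exists>u \<in> C. r = g \<oplus>\<^bsub>R\<^esub> add_pow R (fact N :: nat) u) \<and>
    (\<forall>l<d. \<forall>\<beta> \<in> carrier B. hpv B (x l) (cs l) \<beta> = \<one>\<^bsub>B\<^esub>) \<and> carrier B \<subseteq> spn (\<lambda>i. \<psi> (\<tau> N i)) s \<and>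
    (\<forall>r \<in> C. r [^]\<^bsub>R\<^esub> KH = \<zero>\<^bsub>R\<^esub> \<longrightarrow> (\<forall>\<beta> \<in> carrier B.
      \<exists>us. (\<forall>l<d'. us l \<in> carrier B) \<and> r \<beta> = lprod B (\<lambda>l. x l (us l)) d'))" for N x
  have "\<exists>x. P N x" for N unfolding P_def by (rule level_semantics[OF b s lv d'])
  then obtain x where P: "\<And>N. P N (x N)" by metis
  note p0 = P[unfolded P_def]
  note p1 = conjunct2[OF p0] note p2 = conjunct2[OF p1] note p3 = conjunct2[OF p2]
  note p4 = conjunct2[OF p3] note p5 = conjunct2[OF p4]
  have x: "\<And>N l. l < d \<Longrightarrow> x N l \<in> C" and tM: "\<And>N i. i < s \<Longrightarrow> \<tau> N i \<in> M"
    and xt: "\<And>N l i. l < d \<Longrightarrow> i < s \<Longrightarrow> x N l (\<psi> (\<tau> N i)) = \<psi> (\<upsilon> N l i)"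
    using conjunct1[OF p0] conjunct1[OF p1] conjunct1[OF p2] by blast+
  have div: "\<And>N r. r \<in> C \<Longrightarrow> \<exists>g \<in> generate (add_monoid R) (x N ` {..<d}). \<exists>u \<in> C. r = g \<oplus>\<^bsub>R\<^esub> add_pow R (fact N :: nat) u"
    by (rule bspec[OF conjunct1[OF p3]])
  have hv: "\<And>N l \<beta>. l < d \<Longrightarrow> \<beta> \<in> carrier B \<Longrightarrow> hpv B (x N l) (cs l) \<beta> = \<one>\<^bsub>B\<^esub>"
    using conjunct1[OF p4] by blast
  have full: "\<And>N. carrier B \<subseteq> spn (\<lambda>i. \<psi> (\<tau> N i)) s"
    by (rule conjunct1[OF p5])
  have nil: "\<And>N r \<beta>. r \<in> C \<Longrightarrow> r [^]\<^bsub>R\<^esub> KH = \<zero>\<^bsub>R\<^esub> \<Longrightarrow> \<beta> \<in> carrier B \<Longrightarrow>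
      \<exists>us. (\<forall>l<d'. us l \<in> carrier B) \<and> r \<beta> = lprod B (\<lambda>l. x N l (us l)) d'"
    by (rule bspec[OF mp[OF bspec[OF conjunct2[OF p5]]]])
  define S where "S N = \<psi> ` generate K (\<tau> N ` {..<s})" for N
  have Sg: "S N = generate B ((\<lambda>i. \<psi> (\<tau> N i)) ` {..<s})" for N
    unfolding S_def by (rule psi_generate[OF tM])
  have tB: "(\<lambda>i. \<psi> (\<tau> N i)) ` {..<s} \<subseteq> carrier B" for N using psi_in_B[OF tM] by blast
  have fin: "finite {N. S N \<noteq> carrier B}"
  proof (rule finitely_many_bad_levels[where x = x and t = "\<lambda>N i. \<psi> (\<tau> N i)" and S = S and cs = cs and d = d and d' = d' and s = s and KG = KG and KH = KH])
    show "noeth B" by (rule noeth_B[OF noeth])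
    show "d' \<le> d" by (rule d')
    show "x N l \<in> C" if "l < d" for N l by (rule x[OF that])
    show "\<psi> (\<tau> N i) \<in> carrier B" if "i < s" for N i by (rule psi_in_B[OF tM[OF that]])
    show "hpv B (x N l) (cs l) \<beta> = \<one>\<^bsub>B\<^esub>" if "l < d" "\<beta> \<in> carrier B" for N l \<beta> by (rule hv[OF that])
    show "cs l = replicate KG 0" if "l < d'" for l by (rule cs[OF that])
    show "\<exists>g \<in> generate (add_monoid R) (x N ` {..<d}). \<exists>u \<in> C. r = g \<oplus>\<^bsub>R\<^esub> add_pow R (fact N :: nat) u"
      if "r \<in> C" for N r by (rule div[OF that])
    show "carrier B \<subseteq> spn (\<lambda>i. \<psi> (\<tau> N i)) s" for N by (rule full)
    show "r [^]\<^bsub>R\<^esub> KH = \<zero>\<^bsub>R\<^esub>" if "r \<in> rad R {\<zero>\<^bsub>R\<^esub>}" for r by (rule KH[OF that])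
    show "\<exists>us. (\<forall>l<d'. us l \<in> carrier B) \<and> r \<beta> = lprod B (\<lambda>l. x N l (us l)) d'"
      if "r \<in> C" "r [^]\<^bsub>R\<^esub> KH = \<zero>\<^bsub>R\<^esub>" "\<beta> \<in> carrier B" for N r \<beta> by (rule nil[OF that])
    show Ssub: "subgroup (S N) B" for N unfolding Sg by (rule B.generate_is_subgroup[OF tB])
    show "\<psi> (\<tau> N i) \<in> S N" if "i < s" for N i unfolding Sg by (rule generate.incl) (use that in blast)
    show "x N l \<sigma> \<in> S N" if l: "l < d" and \<sigma>: "\<sigma> \<in> S N" for N l \<sigma>
    proof -
      interpret g: group_hom B B "x N l" using E_hom C_E x[OF l] by blast
      have "x N l ` S N = generate B (x N l ` (\<lambda>i. \<psi> (\<tau> N i)) ` {..<s})"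
        unfolding Sg using g.generate_img[OF tB] by simp
      also have "\<dots> \<subseteq> S N"
      proof (rule B.generate_subgroup_incl[OF _ Ssub])
        have "\<psi> (\<upsilon> N l i) \<in> S N" if "i < s" for i unfolding S_def using u[OF l that] by blast
        then show "x N l ` (\<lambda>i. \<psi> (\<tau> N i)) ` {..<s} \<subseteq> S N" using xt[OF l] by (auto simp del: PB_simps uc.simps)
      qed
      finally show ?thesis using \<sigma> by blast
    qed
  qed
  have fin_imp: "\<forall>z \<in> M. \<exists>v \<in> generate K (\<tau> N ` {..<s}). z \<otimes> inv v \<in> mid" if "S N = carrier B" for N
  proof
    fix z assume z: "z \<in> M"
    then have "\<psi> z \<in> S N" using that psi_in_B by blast
    then obtain v where v: "v \<in> generate K (\<tau> N ` {..<s})" "\<psi> z = \<psi> v" unfolding S_def by blast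
    have "v \<in> M" using generate_subgroup_incl[of "\<tau> N ` {..<s}" M] tM normalD(1)[OF uc_normal] v(1) by blast
    then show "\<exists>v \<in> generate K (\<tau> N ` {..<s}). z \<otimes> inv v \<in> mid" using psi_eq_iff[OF z] v by blast
  qed
  have "{N. \<not> (\<forall>z \<in> M. \<exists>v \<in> generate K (\<tau> N ` {..<s}). z \<otimes> inv v \<in> mid)} \<subseteq> {N. S N \<noteq> carrier B}"
  proof (intro subsetI CollectI notI)
    fix N assume "N \<in> {N. \<not> (\<forall>z \<in> M. \<exists>v \<in> generate K (\<tau> N ` {..<s}). z \<otimes> inv v \<in> mid)}" "S N = carrier B"
    from this(1) fin_imp[OF this(2)] show False unfolding mem_Collect_eq by (rule notE)
  qed
  then show ?thesis by (rule finite_subset[OF _ fin])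
qed

end

section \<open>Definability of the level conditions\<close>

lemma ft_com: "ft s \<Longrightarrow> ft t \<Longrightarrow> ft (\<lambda>K v. com K (s K v) (t K v))"
  unfolding com_def by (intro ft_mult ft_inv)

lemma ft_in_carrier:
  assumes "ft s" "group K" "range v \<subseteq> carrier K" shows "s K v \<in> carrier K"
  using assms teval_closed unfolding ft_def by metis

lemma fo_uc: "ft s \<Longrightarrow> fo (\<lambda>K v. s K v \<in> uc K i)"
proof (induction i arbitrary: s)
  case 0
  then show ?case using fo_eq[OF 0 ft_one] by simp
next
  case (Suc i)
  have "fo (\<lambda>K v. \<forall>g \<in> carrier K. com K (s K v) g \<in> uc K i)"
    by (intro fo_all Suc.IH ft_com ft_var ft_subst[OF Suc.prems])
  then show ?case
    by (rule fo_cong) (use ft_in_carrier[OF Suc.prems] in simp)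
qed

lemma fo_act:
  assumes "\<And>j. ft (\<lambda>K v. b K v j)" "\<And>j. ft (\<lambda>K v. y K v j)" "ft z" "ft z'"
  shows "fo (\<lambda>K v. act K h k (b K v) (y K v) (z K v) (z' K v))"
  unfolding act_def by (intro fo_conj fo_all_less fo_uc ft_mult ft_inv ft_com assms)

lemma fo_good:
  assumes "\<And>j. ft (\<lambda>K v. b K v j)" "\<And>j. ft (\<lambda>K v. y K v j)"
  shows "fo (\<lambda>K v. good K h k (b K v) (y K v))"
  unfolding good_def
  by (intro fo_all fo_ex fo_imp fo_uc fo_act ft_var ft_subst[OF assms(1)] ft_subst[OF assms(2)])

lemma fo_okt:
  assumes "\<And>j. ft (\<lambda>K v. b K v j)"
  shows "fo (\<lambda>K v. okt K h k (b K v))"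
  unfolding okt_def
  by (intro fo_all fo_ex fo_conj fo_imp fo_all_less fo_all_tup fo_good fo_uc fo_act ft_mult ft_inv ft_com
      ft_var ft_if ft_one ft_subst[OF assms])

lemma fo_ccode:
  assumes "\<And>j. ft (\<lambda>K v. b K v j)" "\<And>j. ft (\<lambda>K v. y K v j)"
  shows "fo (\<lambda>K v. ccode K h k (b K v) (y K v))"
  unfolding ccode_def
  by (intro fo_all fo_ex fo_conj fo_imp fo_all_less fo_all_tup fo_good fo_uc fo_act ft_mult ft_inv ft_com
      ft_var ft_if ft_one ft_subst[OF assms(1)] ft_subst[OF assms(2)])

lemma fo_hprel:
  assumes "\<And>j. ft (\<lambda>K v. b K v j)" "\<And>j. ft (\<lambda>K v. y K v j)" "ft z" "ft w"
  shows "fo (\<lambda>K v. hprel K h k (b K v) (y K v) cs (z K v) (w K v))"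
  using assms
proof (induction cs arbitrary: b y z w)
  case Nil
  then show ?case unfolding hprel.simps by (intro fo_conj fo_uc ft_mult ft_inv)
next
  case (Cons c cs)
  show ?case unfolding hprel.simps
    by (intro fo_ex fo_conj fo_uc fo_act Cons.IH ft_mult ft_inv ft_var ft_int_pow
        ft_subst[OF Cons.prems(1)] ft_subst[OF Cons.prems(2)] ft_subst[OF Cons.prems(3)] ft_subst[OF Cons.prems(4)])
qed

lemma fo_annih:
  assumes "\<And>j. ft (\<lambda>K v. b K v j)" "\<And>j. ft (\<lambda>K v. y K v j)"
  shows "fo (\<lambda>K v. annih K h k (b K v) (y K v) cs)"
  unfolding annih_def
  by (intro fo_all fo_imp fo_hprel fo_uc ft_var ft_subst[OF assms(1)] ft_subst[OF assms(2)])

lemma fo_cspan: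
  assumes "\<And>j. ft (\<lambda>K v. b K v j)" "\<And>j. ft (\<lambda>K v. \<tau> K v j)" "ft z"
  shows "fo (\<lambda>K v. cspan K h k (b K v) (\<tau> K v) s (z K v))"
  using assms
proof (induction s arbitrary: b \<tau> z)
  case 0
  then show ?case unfolding cspan.simps by (intro fo_uc)
next
  case (Suc s)
  show ?case unfolding cspan.simps
    by (intro fo_ex fo_ex_tup fo_conj fo_uc fo_act fo_ccode Suc.IH ft_mult ft_inv ft_var ft_if ft_one
        ft_subst[OF Suc.prems(1)] ft_subst[OF Suc.prems(2)] ft_subst[OF Suc.prems(3)])
qed

lemma fo_level:
  assumes "\<And>j. ft (\<lambda>K v. b K v j)" "\<And>l j. ft (\<lambda>K v. \<sigma> K v l j)" "\<And>i. ft (\<lambda>K v. \<tau> K v i)" "\<And>l i. ft (\<lambda>K v. \<upsilon> K v l i)"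
  shows "fo (\<lambda>K v. level K h k d d' s cs KH n (b K v) (\<sigma> K v) (\<tau> K v) (\<upsilon> K v))"
  unfolding level_def
  by (intro fo_all fo_ex fo_ex_tup fo_all_tup fo_all_less fo_ex_finite[OF finite_digits] fo_conj fo_imp fo_uc fo_act fo_okt
      fo_ccode fo_annih fo_cspan ft_mult ft_inv ft_com ft_lprod ft_nat_pow ft_var ft_if ft_one
      ft_subst[OF assms(1)] ft_subst[OF assms(2)] ft_subst[OF assms(3)] ft_subst[OF assms(4)])

lemma fo_all_finite:
  assumes "finite I" "\<And>j. j \<in> I \<Longrightarrow> fo (\<phi> j)" shows "fo (\<lambda>K v. \<forall>j \<in> I. \<phi> j K v)"
  using fo_not[OF fo_ex_finite[of I "\<lambda>j K v. \<not> \<phi> j K v", OF assms(1) fo_not[OF assms(2)]]] by simp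

lemma fo_comprods:
  assumes "ft s" shows "fo (\<lambda>K v. s K v \<in> comprods K m)"
proof -
  have "fo (\<lambda>K v. \<exists>x \<in> tup K m. \<exists>y \<in> tup K m. s K v = lprod K (\<lambda>j. com K (x j) (y j)) m)"
    by (intro fo_ex_tup fo_eq ft_subst[OF assms] ft_lprod ft_com ft_var ft_if ft_one)
  then show ?thesis by (simp add: comprods_def)
qed

section \<open>Finitely many relators suffice\<close>

text \<open>\<open>wgroup H k\<close> is the relatively free group of rank \<open>k\<close> in the variety generated by \<open>H\<close>: terms modulo the laws of \<open>H\<close>. It is
  nilpotent, hence satisfies the maximal condition.\<close>

definition wmap :: "('u, 'm) monoid_scheme \<Rightarrow> nat \<Rightarrow> gterm \<Rightarrow> (nat \<Rightarrow> 'u) \<Rightarrow> 'u" where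
  "wmap H k t = (\<lambda>b \<in> tup H k. teval H b t)"

definition wgroup :: "('u, 'm) monoid_scheme \<Rightarrow> nat \<Rightarrow> ((nat \<Rightarrow> 'u) \<Rightarrow> 'u) monoid" where
  "wgroup H k = \<lparr>carrier = range (wmap H k), monoid.mult = (\<lambda>f g. \<lambda>b \<in> tup H k. f b \<otimes>\<^bsub>H\<^esub> g b),
    monoid.one = (\<lambda>b \<in> tup H k. \<one>\<^bsub>H\<^esub>)\<rparr>"

context group
begin

lemma tup_closed: "b \<in> tup G k \<Longrightarrow> b j \<in> carrier G"
  by (cases "j < k") (simp_all add: tup_def)

lemma teval_tup: "b \<in> tup G k \<Longrightarrow> teval G b t \<in> carrier G"
  by (induction t) (simp_all add: tup_closed)

lemma wgroup_simps:
  "carrier (wgroup G k) = range (wmap G k)" "wmap G k s \<otimes>\<^bsub>wgroup G k\<^esub> wmap G k t = wmap G k (GMul s t)"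
  "\<one>\<^bsub>wgroup G k\<^esub> = wmap G k GOne"
  by (simp_all add: wgroup_def wmap_def fun_eq_iff)

lemma wmap_eq: "(\<And>b. b \<in> tup G k \<Longrightarrow> teval G b s = teval G b t) \<Longrightarrow> wmap G k s = wmap G k t"
  by (auto simp: wmap_def fun_eq_iff)

lemma wgroup_group: "group (wgroup G k)"
proof (rule groupI)
  fix x assume "x \<in> carrier (wgroup G k)"
  then obtain s where s: "x = wmap G k s" by (auto simp: wgroup_simps)
  show "\<one>\<^bsub>wgroup G k\<^esub> \<otimes>\<^bsub>wgroup G k\<^esub> x = x"
    unfolding s wgroup_simps by (rule wmap_eq) (simp add: teval_tup)
  have "wmap G k (GInv s) \<otimes>\<^bsub>wgroup G k\<^esub> x = \<one>\<^bsub>wgroup G k\<^esub>"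
    unfolding s wgroup_simps by (rule wmap_eq) (simp add: teval_tup)
  then show "\<exists>y \<in> carrier (wgroup G k). y \<otimes>\<^bsub>wgroup G k\<^esub> x = \<one>\<^bsub>wgroup G k\<^esub>"
    unfolding wgroup_simps(1) by blast
  fix y assume "y \<in> carrier (wgroup G k)"
  then obtain t where t: "y = wmap G k t" by (auto simp: wgroup_simps)
  show "x \<otimes>\<^bsub>wgroup G k\<^esub> y \<in> carrier (wgroup G k)" unfolding s t wgroup_simps by blast
  fix z assume "z \<in> carrier (wgroup G k)"
  then obtain u where u: "z = wmap G k u" by (auto simp: wgroup_simps)
  show "x \<otimes>\<^bsub>wgroup G k\<^esub> y \<otimes>\<^bsub>wgroup G k\<^esub> z = x \<otimes>\<^bsub>wgroup G k\<^esub> (y \<otimes>\<^bsub>wgroup G k\<^esub> z)"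
    unfolding s t u wgroup_simps by (rule wmap_eq) (simp add: teval_tup m_assoc)
qed (simp add: wgroup_simps)

lemma wmap_inv: "inv\<^bsub>wgroup G k\<^esub> (wmap G k s) = wmap G k (GInv s)"
proof (rule group.inv_equality[OF wgroup_group])
  show "wmap G k (GInv s) \<otimes>\<^bsub>wgroup G k\<^esub> wmap G k s = \<one>\<^bsub>wgroup G k\<^esub>"
    unfolding wgroup_simps by (rule wmap_eq) (simp add: teval_tup)
qed (simp_all add: wgroup_simps)

text \<open>All elements of \<open>wgroup\<close> are word maps, so commutators there are computed
  pointwise; a bound on the nilpotency class passes from \<open>G\<close> to
  \<open>wgroup G k\<close>.\<close>

lemma wmap_uc: "(\<And>b. b \<in> tup G k \<Longrightarrow> teval G b s \<in> uc G i) \<Longrightarrow> wmap G k s \<in> uc (wgroup G k) i"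
proof (induction i arbitrary: s)
  case 0
  have "wmap G k s = wmap G k GOne" by (rule wmap_eq) (use 0 in simp)
  then show ?case by (simp add: wgroup_simps)
next
  case (Suc i)
  have "com (wgroup G k) (wmap G k s) x \<in> uc (wgroup G k) i" if x: "x \<in> carrier (wgroup G k)" for x
  proof -
    obtain t where t: "x = wmap G k t" using x by (auto simp: wgroup_simps)
    have "com (wgroup G k) (wmap G k s) x = wmap G k (GMul (GMul (GMul s t) (GInv s)) (GInv t))"
      by (simp add: t com_def wmap_inv wgroup_simps)
    moreover have "teval G b (GMul (GMul (GMul s t) (GInv s)) (GInv t)) \<in> uc G i" if b: "b \<in> tup G k" for b
      using uc_com[OF Suc.prems[OF b] teval_tup[OF b, of t]] by (simp add: com_def)
    ultimately show ?thesis using Suc.IH by metis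
  qed
  then show ?case by (simp add: wgroup_simps)
qed

lemma noeth_wgroup:
  assumes "uc G c = carrier G" shows "noeth (wgroup G k)"
proof -
  interpret F: group "wgroup G k" by (rule wgroup_group)
  let ?S = "(\<lambda>j. wmap G k (GVar j)) ` {..<k}"
  have "wmap G k t \<in> generate (wgroup G k) ?S" for t
  proof (induction t)
    case (GVar j)
    show ?case
    proof (cases "j < k")
      case True
      then show ?thesis by (intro generate.incl) blast
    next
      case False
      have "wmap G k (GVar j) = wmap G k GOne" by (rule wmap_eq) (use False in \<open>simp add: tup_def\<close>)
      then show ?thesis using generate.one[of "wgroup G k" ?S] by (simp add: wgroup_simps)
    qed
  next
    case GOne
    then show ?case using generate.one[of "wgroup G k" ?S] by (simp add: wgroup_simps)
  next
    case (GMul s t)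
    then show ?case using generate.eng[OF GMul] by (simp add: wgroup_simps)
  next
    case (GInv t)
    have "?S \<subseteq> carrier (wgroup G k)" by (auto simp: wgroup_simps)
    from F.generate_m_inv_closed[OF this GInv] show ?case by (simp add: wmap_inv)
  qed
  then have gen: "generate (wgroup G k) ?S = carrier (wgroup G k)"
    using F.generate_incl[of ?S] by (auto simp: wgroup_simps)
  have "uc (wgroup G k) c = carrier (wgroup G k)"
  proof
    show "carrier (wgroup G k) \<subseteq> uc (wgroup G k) c"
      using wmap_uc teval_tup assms unfolding wgroup_simps(1) by blast
  qed (use F.uc_closed in blast)
  from F.noeth_nilpotent[OF _ _ gen F.lc_if_uc[OF this]] show ?thesis by (simp add: wgroup_simps image_subset_iff)
qed

end

text \<open>The relations of \<open>a\<close>, read as word maps on \<open>H\<close>, form a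
  subgroup of \<open>wgroup H k\<close> and hence have finitely many generators. Evaluation at
  \<open>b\<close> is a homomorphism, so once these generators are killed all relations of
  \<open>a\<close> hold for \<open>b\<close>.\<close>

lemma finitely_many_relators:
  fixes G :: "('u, 'm) monoid_scheme" and H :: "('w, 'n) monoid_scheme"
  assumes G: "group G" and H: "group H" and c: "uc H c = carrier H" and a: "a \<in> tup G k"
  shows "\<exists>\<R>. finite \<R> \<and> (\<forall>t \<in> \<R>. teval G a t = \<one>\<^bsub>G\<^esub>) \<and>
    (\<forall>b \<in> tup H k. (\<forall>t \<in> \<R>. teval H b t = \<one>\<^bsub>H\<^esub>) \<longrightarrow> (\<forall>t. teval G a t = \<one>\<^bsub>G\<^esub> \<longrightarrow> teval H b t = \<one>\<^bsub>H\<^esub>))"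
proof -
  interpret G: group G by fact
  interpret H: group H by fact
  let ?F = "wgroup H k"
  interpret F: group ?F by (rule H.wgroup_group)
  let ?U = "wmap H k ` {t. teval G a t = \<one>\<^bsub>G\<^esub>}"
  have "subgroup ?U ?F"
  proof (rule F.subgroupI)
    show "?U \<subseteq> carrier ?F" by (auto simp: H.wgroup_simps)
    have "teval G a GOne = \<one>\<^bsub>G\<^esub>" by simp
    then show "?U \<noteq> {}" by blast
  next
    fix x assume "x \<in> ?U"
    then obtain t where t: "x = wmap H k t" "teval G a t = \<one>\<^bsub>G\<^esub>" by blast
    have "teval G a (GInv t) = \<one>\<^bsub>G\<^esub>" using t by simp
    then show "inv\<^bsub>?F\<^esub> x \<in> ?U" unfolding t(1) H.wmap_inv by blast
  next
    fix x y assume "x \<in> ?U" "y \<in> ?U"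
    then obtain s t where t: "x = wmap H k s" "teval G a s = \<one>\<^bsub>G\<^esub>" "y = wmap H k t" "teval G a t = \<one>\<^bsub>G\<^esub>" by blast
    have "teval G a (GMul s t) = \<one>\<^bsub>G\<^esub>" using t by simp
    then show "x \<otimes>\<^bsub>?F\<^esub> y \<in> ?U" unfolding t(1,3) H.wgroup_simps(2) by blast
  qed
  then obtain S where S: "finite S" "S \<subseteq> carrier ?F" "generate ?F S = ?U"
    using H.noeth_wgroup[OF c, of k] unfolding noeth_def fgs_def by blast
  have "S \<subseteq> ?U" using S(3) subset_generate[of S S ?F] by blast
  then obtain \<R> where R: "\<R> \<subseteq> {t. teval G a t = \<one>\<^bsub>G\<^esub>}" "finite \<R>" "S = wmap H k ` \<R>"
    using finite_subset_image[OF S(1)] by metis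
  have "teval H b t = \<one>\<^bsub>H\<^esub>"
    if b: "b \<in> tup H k" and r: "\<forall>t \<in> \<R>. teval H b t = \<one>\<^bsub>H\<^esub>" and t: "teval G a t = \<one>\<^bsub>G\<^esub>" for b t
  proof -
    have ev: "group_hom ?F H (\<lambda>f. f b)"
      unfolding group_hom_def group_hom_axioms_def
    proof (intro conjI F.is_group H.is_group homI)
      fix x assume "x \<in> carrier ?F"
      then show "x b \<in> carrier H" using b by (auto simp: H.wgroup_simps wmap_def H.teval_tup)
    next
      fix x y assume "x \<in> carrier ?F" "y \<in> carrier ?F"
      then show "(x \<otimes>\<^bsub>?F\<^esub> y) b = x b \<otimes>\<^bsub>H\<^esub> y b" using b by (simp add: wgroup_def)
    qed
    have "wmap H k t \<in> generate ?F S" using S(3) t by blast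
    then have "wmap H k t b \<in> generate H ((\<lambda>f. f b) ` S)"
      using group_hom.generate_img[OF ev S(2)] by blast
    moreover have "(\<lambda>f. f b) ` S \<subseteq> {\<one>\<^bsub>H\<^esub>}" using R(3) r b by (auto simp: wmap_def)
    then have "generate H ((\<lambda>f. f b) ` S) \<subseteq> {\<one>\<^bsub>H\<^esub>}"
      by (rule H.generate_subgroup_incl) (rule H.triv_subgroup)
    ultimately show ?thesis using b by (auto simp: wmap_def)
  qed
  then show ?thesis using R(1,2) by (intro exI[of _ \<R>]) blast
qed

text \<open>The order of quantifiers matters: \<open>KH\<close> is fixed by \<open>K\<close> and
  \<open>h\<close> before any tuple, polynomial or term is known, so it can be built into a formula
  whose other data come from another group.\<close>

lemma (in group_level) bad_tuples_finite:
  assumes noeth: "noeth K"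
  shows "\<exists>KH. \<forall>k d d' s cs KG b \<sigma> \<tau> \<upsilon>. d' \<le> d \<longrightarrow> (\<forall>l<d'. cs l = replicate KG 0) \<longrightarrow>
    (\<forall>N. b N \<in> tup K k) \<longrightarrow> (\<forall>N. \<forall>l<d. \<sigma> N l \<in> tup K k) \<longrightarrow>
    (\<forall>N. level K h k d d' s cs KH (fact N) (b N) (\<sigma> N) (\<tau> N) (\<upsilon> N)) \<longrightarrow>
    (\<forall>N. \<forall>l<d. \<forall>i<s. \<upsilon> N l i \<in> generate K (\<tau> N ` {..<s})) \<longrightarrow>
    finite {N. \<not> (\<forall>z \<in> M. \<exists>v \<in> generate K (\<tau> N ` {..<s}). z \<otimes> inv v \<in> mid)}"
proof -
  obtain KH :: nat where KH: "\<forall>r \<in> rad R {\<zero>\<^bsub>R\<^esub>}. r [^]\<^bsub>R\<^esub> KH = \<zero>\<^bsub>R\<^esub>"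
    using nilpotency_bound[OF cring_R noeth_R[OF noeth_B[OF noeth]]] by blast
  show ?thesis
  proof (rule exI[of _ KH], intro allI impI)
    fix k d d' s :: nat and cs KG b \<sigma> \<tau> \<upsilon>
    assume "d' \<le> d" and cs: "\<forall>l<d'. cs l = replicate KG 0" and b: "\<forall>N. b N \<in> tup K k"
      and \<sigma>: "\<forall>N. \<forall>l<d. \<sigma> N l \<in> tup K k"
      and lv: "\<forall>N. level K h k d d' s cs KH (fact N) (b N) (\<sigma> N) (\<tau> N) (\<upsilon> N)"
      and \<upsilon>: "\<forall>N. \<forall>l<d. \<forall>i<s. \<upsilon> N l i \<in> generate K (\<tau> N ` {..<s})"
    show "finite {N. \<not> (\<forall>z \<in> M. \<exists>v \<in> generate K (\<tau> N ` {..<s}). z \<otimes> inv v \<in> mid)}"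
    proof (rule finitely_many_bad_tuples[where KH = KH and d = d and d' = d' and cs = cs and KG = KG and b = b
          and k = k and \<sigma> = \<sigma> and s = s and \<tau> = \<tau> and \<upsilon> = \<upsilon>])
      show "r [^]\<^bsub>R\<^esub> KH = \<zero>\<^bsub>R\<^esub>" if "r \<in> rad R {\<zero>\<^bsub>R\<^esub>}" for r using KH that by blast
      show "d' \<le> d" by fact
      show "cs l = replicate KG 0" if "l < d'" for l using cs that by blast
      show "b N \<in> tup K k" for N using b by blast
      show "\<sigma> N l \<in> tup K k" if "l < d" for N l using \<sigma> that by blast
      show "level K h k d d' s cs KH (fact N) (b N) (\<sigma> N) (\<tau> N) (\<upsilon> N)" for N using lv by blast
      show "\<upsilon> N l i \<in> generate K (\<tau> N ` {..<s})" if "l < d" "i < s" for N l i using \<upsilon> that by blast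
    qed (rule noeth)
  qed
qed

section \<open>Control of the center\<close>

definition center_width :: "('u, 'm) monoid_scheme \<Rightarrow> nat \<Rightarrow> nat \<Rightarrow> bool" where
  "center_width K e m \<longleftrightarrow> (\<forall>z \<in> carrier K. z \<in> uc K 1 \<longrightarrow> z [^]\<^bsub>K\<^esub> e \<in> comprods K m)"

lemma fo_center_width: "fo (\<lambda>K v. center_width K e m)"
  unfolding center_width_def by (intro fo_all fo_imp fo_uc fo_comprods ft_nat_pow ft_var)

text \<open>Reducing exponents of generators of the center modulo \<open>e\<close> leaves finitely
  many products, and these represent the center modulo e-th powers of central elements. The e-th
  powers are left to \<open>center_width\<close>.\<close>

definition zspan :: "('u, 'm) monoid_scheme \<Rightarrow> nat \<Rightarrow> nat \<Rightarrow> (nat \<Rightarrow> 'u) \<Rightarrow> bool" where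
  "zspan K e q \<zeta> \<longleftrightarrow> (\<forall>z \<in> carrier K. z \<in> uc K 1 \<longrightarrow> (\<exists>r \<in> digits q e. \<exists>z' \<in> carrier K. z' \<in> uc K 1 \<and>
    z = lprod K (\<lambda>i. \<zeta> i [^]\<^bsub>K\<^esub> r i) q \<otimes>\<^bsub>K\<^esub> z' [^]\<^bsub>K\<^esub> e))"

lemma fo_zspan:
  assumes "\<And>j. ft (\<lambda>K v. \<zeta> K v j)" shows "fo (\<lambda>K v. zspan K e q (\<zeta> K v))"
  unfolding zspan_def
  by (intro fo_all fo_imp fo_ex_finite[OF finite_digits] fo_ex fo_conj fo_uc fo_eq ft_mult ft_nat_pow ft_lprod ft_var
      ft_subst[OF assms])

lemma (in group) uc_1_comm: "z \<in> uc G 1 \<Longrightarrow> x \<in> carrier G \<Longrightarrow> z \<otimes> x = x \<otimes> z"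
proof -
  assume z: "z \<in> uc G 1" and x: "x \<in> carrier G"
  have c: "com G z x = \<one>" using z x by simp
  have zc: "z \<in> carrier G" using z by simp
  have "z \<otimes> x = com G z x \<otimes> (x \<otimes> z)" using zc x by (simp add: com_def gsimps)
  then show ?thesis using c zc x by simp
qed

lemma (in group) center_comm_group: "comm_group (G\<lparr>carrier := uc G 1\<rparr>)"
proof -
  interpret Z: group "G\<lparr>carrier := uc G 1\<rparr>" by (rule subgroup_imp_group[OF normalD(1)[OF uc_normal]])
  show ?thesis
    by (rule Z.group_comm_groupI) (use uc_1_comm uc_closed in \<open>simp del: uc.simps One_nat_def\<close>)
qed

lemma (in group) nat_pow_update: "x [^]\<^bsub>G\<lparr>carrier := V\<rparr>\<^esub> (n::nat) = x [^] n"
  by (induction n) (simp_all add: nat_pow_def)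

lemma (in group) zspan_holds:
  assumes noeth: "noeth G" and e: "0 < e" and a: "generate G (a ` {..<k}) = carrier G"
  shows "\<exists>q \<zeta>. zspan G e q (\<lambda>i. teval G a (\<zeta> i))"
proof -
  let ?Z = "G\<lparr>carrier := uc G 1\<rparr>"
  interpret Z: comm_group ?Z by (rule center_comm_group)
  have sub: "subgroup (uc G 1) G" by (rule normalD(1)[OF uc_normal])
  have "fgs G (uc G 1)" using noeth sub unfolding noeth_def by blast
  from generate_enum[OF this] obtain q :: nat and t where "\<forall>i<q. t i \<in> uc G 1" and gen: "generate G (t ` {..<q}) = uc G 1"
    by (elim exE conjE)
  then have t: "\<And>i. i < q \<Longrightarrow> t i \<in> uc G 1" by simp
  have "\<exists>w. i < q \<longrightarrow> teval G a w = t i" for i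
    using generate_term[of "t i" G a k] a t[of i] uc_closed by blast
  then obtain \<zeta> where z: "\<And>i. i < q \<Longrightarrow> teval G a (\<zeta> i) = t i" by metis
  have tZ: "\<And>i. i < q \<Longrightarrow> t i \<in> carrier ?Z" using t by simp
  have "zspan G e q (\<lambda>i. teval G a (\<zeta> i))"
    unfolding zspan_def
  proof (intro ballI impI)
    fix x assume x: "x \<in> uc G 1"
    have "x \<in> generate ?Z (t ` {..<q})"
      using generate_consistent[OF _ sub, of "t ` {..<q}"] gen t x by (auto simp del: uc.simps One_nat_def)
    from Z.generate_lprod[OF tZ this] obtain f :: "nat \<Rightarrow> int" where f: "x = lprod ?Z (\<lambda>i. t i [^]\<^bsub>?Z\<^esub> f i) q" by blast
    obtain r and g :: "nat \<Rightarrow> int" where r: "r \<in> digits q e" "x = lprod ?Z (\<lambda>i. t i [^]\<^bsub>?Z\<^esub> r i) q \<otimes>\<^bsub>?Z\<^esub> lprod ?Z (\<lambda>i. t i [^]\<^bsub>?Z\<^esub> g i) q [^]\<^bsub>?Z\<^esub> e"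
      using Z.lprod_digits[of q t e f] tZ e unfolding f by blast
    let ?u = "lprod ?Z (\<lambda>i. t i [^]\<^bsub>?Z\<^esub> g i) q"
    have u: "?u \<in> uc G 1" using Z.lprod_closed[of q "\<lambda>i. t i [^]\<^bsub>?Z\<^esub> g i"] Z.int_pow_closed[OF tZ] by simp
    have "lprod G (\<lambda>i. teval G a (\<zeta> i) [^] r i) q = lprod G (\<lambda>i. t i [^] r i) q"
      by (rule lprod_cong) (simp add: z)
    then have "x = lprod G (\<lambda>i. teval G a (\<zeta> i) [^] r i) q \<otimes> ?u [^] e"
      using r(2) by (simp add: nat_pow_update del: uc.simps One_nat_def)
    then show "\<exists>r \<in> digits q e. \<exists>z' \<in> carrier G. z' \<in> uc G 1 \<and> x = lprod G (\<lambda>i. teval G a (\<zeta> i) [^] r i) q \<otimes> z' [^] e"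
      using r(1) u uc_closed[OF u] by blast
  qed
  then show ?thesis by (intro exI)
qed

section \<open>Construction of a surjection between equivalent groups\<close>

theorem surjective_hom:
  fixes G H :: "'u monoid"
  assumes G: "noeth G" and H: "noeth H" and cG: "uc G c = carrier G" and cH: "uc H c = carrier H"
    and cw: "center_width G e m" and e: "0 < e" and equiv: "elem_equiv G H"
  shows "\<exists>f \<in> hom G H. f ` carrier G = carrier H"
proof -
  interpret G: group G using G noeth_def by blast
  interpret H: group H using H noeth_def by blast
  have "fgs G (carrier G)" using G G.subgroup_self unfolding noeth_def by blast
  from G.generate_enum[OF this] obtain k :: nat and t where t: "\<forall>i<k. t i \<in> carrier G" "generate G (t ` {..<k}) = carrier G"
    by (elim exE conjE)
  define a where "a = (\<lambda>j. if j < k then t j else \<one>\<^bsub>G\<^esub>)"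
  have a: "a \<in> tup G k" using t(1) by (simp add: a_def tup_def)
  have "a ` {..<k} = t ` {..<k}" by (rule image_cong) (simp_all add: a_def)
  then have ga: "generate G (a ` {..<k}) = carrier G" using t(2) by simp
  obtain \<R> where R: "finite \<R>" "\<forall>t \<in> \<R>. teval G a t = \<one>\<^bsub>G\<^esub>"
    "\<forall>b \<in> tup H k. (\<forall>t \<in> \<R>. teval H b t = \<one>\<^bsub>H\<^esub>) \<longrightarrow> (\<forall>t. teval G a t = \<one>\<^bsub>G\<^esub> \<longrightarrow> teval H b t = \<one>\<^bsub>H\<^esub>)"
    using finitely_many_relators[OF G.is_group H.is_group cH a] by blast
  obtain q \<zeta> where zs: "zspan G e q (\<lambda>i. teval G a (\<zeta> i))" using G.zspan_holds[OF G e ga] by blast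
  define bad where "bad KH h = (\<forall>k d d' s cs KG b \<sigma> \<tau> \<upsilon>. d' \<le> d \<longrightarrow> (\<forall>l<d'. cs l = replicate KG 0) \<longrightarrow>
    (\<forall>N. b N \<in> tup H k) \<longrightarrow> (\<forall>N. \<forall>l<d. \<sigma> N l \<in> tup H k) \<longrightarrow>
    (\<forall>N. level H h k d d' s cs KH (fact N) (b N) (\<sigma> N) (\<tau> N) (\<upsilon> N)) \<longrightarrow>
    (\<forall>N. \<forall>l<d. \<forall>i<s. \<upsilon> N l i \<in> generate H (\<tau> N ` {..<s})) \<longrightarrow>
    finite {N. \<not> (\<forall>z \<in> uc H (Suc (Suc h)). \<exists>v \<in> generate H (\<tau> N ` {..<s}). z \<otimes>\<^bsub>H\<^esub> inv\<^bsub>H\<^esub> v \<in> uc H (Suc h))})" for KH h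
  have "\<exists>KH. bad KH h" for h
    unfolding bad_def by (rule group_level.bad_tuples_finite[OF _ H]) (simp add: group_level_def H.is_group)
  \<comment> \<open>The exponents come from \<open>H\<close>, although the formula is first verified
    in \<open>G\<close>; \<open>level_holds\<close> accepts any value.\<close>
  then obtain KH where KH: "\<And>h. bad (KH h) h" by metis
  define LV where "LV h K n b d d' s cs \<sigma> \<tau> \<omega> = level K h k d d' s cs (KH h) n b (\<lambda>l j. teval K b (\<sigma> l j))
    (\<lambda>i. teval K b (\<tau> i)) (\<lambda>l i. teval K (\<lambda>i. if i < s then teval K b (\<tau> i) else \<one>\<^bsub>K\<^esub>) (\<omega> l i))"
    for h and K :: "'u monoid" and n b d d' s cs and \<sigma> :: "nat \<Rightarrow> nat \<Rightarrow> gterm" and \<tau> :: "nat \<Rightarrow> gterm" and \<omega> :: "nat \<Rightarrow> nat \<Rightarrow> gterm"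
  have "\<exists>d d' s cs KG \<sigma> \<tau> \<omega>. d' \<le> d \<and> (\<forall>l<d'. cs l = replicate KG 0) \<and> (\<forall>l j. k \<le> j \<longrightarrow> \<sigma> l j = GOne) \<and>
    (\<forall>n>0. LV h G n a d d' s cs \<sigma> \<tau> \<omega>)" for h
    unfolding LV_def by (rule group_level.level_holds[OF _ G a ga]) (simp add: group_level_def G.is_group)
  then obtain d d' s cs KG \<sigma> \<tau> \<omega> where D: "\<And>h. d' h \<le> d h" "\<And>h. \<forall>l<d' h. cs h l = replicate (KG h) 0"
    "\<And>h. \<forall>l j. k \<le> j \<longrightarrow> \<sigma> h l j = GOne" "\<And>h. \<forall>n>0. LV h G n a (d h) (d' h) (s h) (cs h) (\<sigma> h) (\<tau> h) (\<omega> h)"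
    by metis
  let ?b = "\<lambda>(K::'u monoid) (v::nat \<Rightarrow> 'u) j. if j < k then v j else \<one>\<^bsub>K\<^esub>"
  \<comment> \<open>The relators make a \<mapsto> b extend to a homomorphism, the next two conjuncts
    bring the center into its image, and the last supplies level data for the factors above the
    center. \<open>N\<close> enters only as the modulus \<open>fact N\<close>.\<close>
  define \<Phi> where "\<Phi> N K v \<longleftrightarrow> (\<forall>t \<in> \<R>. teval K (?b K v) t = \<one>\<^bsub>K\<^esub>) \<and> center_width K e m \<and>
    zspan K e q (\<lambda>i. teval K (?b K v) (\<zeta> i)) \<and>
    (\<forall>h<c. LV h K (fact N) (?b K v) (d h) (d' h) (s h) (cs h) (\<sigma> h) (\<tau> h) (\<omega> h))" for N K v
  have fob: "ft (\<lambda>K v. ?b K v j)" for j by (intro ft_if ft_var ft_one)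
  have fo\<Phi>: "fo (\<Phi> N)" for N
    unfolding \<Phi>_def LV_def
    by (intro fo_conj fo_all_finite[OF R(1)] fo_eq ft_teval ft_one fob fo_center_width fo_zspan fo_all_less fo_level ft_if)
  have ba: "?b G a = a" using a by (auto simp: tup_def)
  have "\<Phi> N G a" for N
    unfolding \<Phi>_def ba using R(2) cw zs D(4) by simp
  moreover have "range a \<subseteq> carrier G" using G.tup_closed[OF a] by blast
  ultimately have "\<exists>w. range w \<subseteq> carrier H \<and> \<Phi> N H w" for N
    using elem_equiv_transfer[OF fo\<Phi> equiv G.is_group H.is_group] by blast
  then obtain w where w: "\<And>N. range (w N) \<subseteq> carrier H" "\<And>N. \<Phi> N H (w N)" by metis
  define b where "b N = ?b H (w N)" for N
  have b: "b N \<in> tup H k" for N using w(1)[of N] by (auto simp: b_def tup_def)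
  have P: "\<forall>t \<in> \<R>. teval H (b N) t = \<one>\<^bsub>H\<^esub>" "center_width H e m" "zspan H e q (\<lambda>i. teval H (b N) (\<zeta> i))"
    "\<And>h. h < c \<Longrightarrow> LV h H (fact N) (b N) (d h) (d' h) (s h) (cs h) (\<sigma> h) (\<tau> h) (\<omega> h)" for N
    using w(2)[of N] unfolding \<Phi>_def b_def by blast+
  let ?\<tau> = "\<lambda>h N i. teval H (b N) (\<tau> h i)"
  let ?bad = "\<lambda>h. {N. \<not> (\<forall>z \<in> uc H (Suc (Suc h)). \<exists>v \<in> generate H (?\<tau> h N ` {..<s h}).
    z \<otimes>\<^bsub>H\<^esub> inv\<^bsub>H\<^esub> v \<in> uc H (Suc h))}"
  have fin: "finite (?bad h)" if h: "h < c" for h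
  proof -
    have 1: "(\<lambda>j. teval H (b N) (\<sigma> h l j)) \<in> tup H k" for N l
      using D(3)[of h] H.teval_tup[OF b] by (simp add: tup_def)
    have 2: "teval H (\<lambda>i. if i < s h then ?\<tau> h N i else \<one>\<^bsub>H\<^esub>) (\<omega> h l i) \<in> generate H (?\<tau> h N ` {..<s h})" for N l i
    proof -
      have "(\<lambda>i. if i < s h then ?\<tau> h N i else \<one>\<^bsub>H\<^esub>) \<in> tup H (s h)" using H.teval_tup[OF b] by (simp add: tup_def)
      from H.term_generate[OF this, of "\<omega> h l i"] show ?thesis
        by (simp cong: image_cong_simp)
    qed
    have 3: "\<forall>N. level H h k (d h) (d' h) (s h) (cs h) (KH h) (fact N) (b N) (\<lambda>l j. teval H (b N) (\<sigma> h l j))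
        (?\<tau> h N) (\<lambda>l i. teval H (\<lambda>i. if i < s h then ?\<tau> h N i else \<one>\<^bsub>H\<^esub>) (\<omega> h l i))"
      using P(4)[OF h] unfolding LV_def by blast
    show ?thesis
      using KH[of h, unfolded bad_def, rule_format, of "d' h" "d h" "cs h" "KG h" b k
          "\<lambda>N l j. teval H (b N) (\<sigma> h l j)" "s h" "?\<tau> h" "\<lambda>N l i. teval H (\<lambda>i. if i < s h then ?\<tau> h N i else \<one>\<^bsub>H\<^esub>) (\<omega> h l i)"]
        D(1,2) b 1 2 3 by blast
  qed
  have "finite (\<Union>h<c. ?bad h)" using fin by blast
  \<comment> \<open>Each of the finitely many levels excludes finitely many N, so one N suits all of
    them; the tuple \<open>b N\<close> is used from here on.\<close>
  then obtain N where N: "N \<notin> (\<Union>h<c. ?bad h)" using ex_new_if_finite[OF infinite_UNIV_nat] by blast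
  define V where "V = range (teval H (b N))"
  have V: "subgroup V H"
  proof (rule H.subgroupI)
    show "V \<subseteq> carrier H" unfolding V_def using H.teval_tup[OF b] by blast
    show "V \<noteq> {}" unfolding V_def by blast
  next
    fix x assume "x \<in> V"
    then obtain t where "x = teval H (b N) t" unfolding V_def by blast
    then have "inv\<^bsub>H\<^esub> x = teval H (b N) (GInv t)" by simp
    then show "inv\<^bsub>H\<^esub> x \<in> V" unfolding V_def by blast
  next
    fix x y assume "x \<in> V" "y \<in> V"
    then obtain s t where "x = teval H (b N) s" "y = teval H (b N) t" unfolding V_def by blast
    then have "x \<otimes>\<^bsub>H\<^esub> y = teval H (b N) (GMul s t)" by simp
    then show "x \<otimes>\<^bsub>H\<^esub> y \<in> V" unfolding V_def by blast
  qed
  have Vc: "x \<in> V \<Longrightarrow> x \<in> carrier H" for x using subgroup.mem_carrier[OF V] .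
  have lev: "\<exists>v \<in> V. z \<otimes>\<^bsub>H\<^esub> inv\<^bsub>H\<^esub> v \<in> uc H (Suc h)" if h: "h < c" and z: "z \<in> uc H (Suc (Suc h))" for h z
  proof -
    have "\<exists>v \<in> generate H (?\<tau> h N ` {..<s h}). z \<otimes>\<^bsub>H\<^esub> inv\<^bsub>H\<^esub> v \<in> uc H (Suc h)" using N h z by blast
    moreover have "generate H (?\<tau> h N ` {..<s h}) \<subseteq> V"
      by (rule H.generate_subgroup_incl[OF _ V]) (auto simp: V_def)
    ultimately show ?thesis by blast
  qed
  \<comment> \<open>Descent along the upper central series: level i changes an element of Z_(i+2) by
    an element of \<open>V\<close> into one of Z_(i+1), until a central factor remains. The
    hypothesis i \<le> c keeps the levels used below c.\<close>
  have VZ: "\<exists>v \<in> V. \<exists>z \<in> uc H 1. x = z \<otimes>\<^bsub>H\<^esub> v" if "x \<in> uc H (Suc i)" "i \<le> c" for x i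
    using that
  proof (induction i arbitrary: x)
    case 0
    then have x: "x \<in> uc H 1" by simp
    have "x = x \<otimes>\<^bsub>H\<^esub> \<one>\<^bsub>H\<^esub>" using H.uc_closed[OF x] by simp
    with x show ?case using subgroup.one_closed[OF V] by blast
  next
    case (Suc i)
    obtain v where v: "v \<in> V" "x \<otimes>\<^bsub>H\<^esub> inv\<^bsub>H\<^esub> v \<in> uc H (Suc i)" using lev[of i x] Suc.prems by auto
    obtain v' z where z: "v' \<in> V" "z \<in> uc H 1" "x \<otimes>\<^bsub>H\<^esub> inv\<^bsub>H\<^esub> v = z \<otimes>\<^bsub>H\<^esub> v'"
      using Suc.IH[OF v(2)] Suc.prems(2) by auto
    have c: "x \<in> carrier H" "v \<in> carrier H" "v' \<in> carrier H" "z \<in> carrier H"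
      using H.uc_closed[OF Suc.prems(1)] H.uc_closed[OF z(2)] Vc v(1) z(1) by simp_all
    have "x = x \<otimes>\<^bsub>H\<^esub> inv\<^bsub>H\<^esub> v \<otimes>\<^bsub>H\<^esub> v" using c by (simp add: H.m_assoc)
    also have "\<dots> = z \<otimes>\<^bsub>H\<^esub> (v' \<otimes>\<^bsub>H\<^esub> v)" unfolding z(3) using c by (simp add: H.m_assoc)
    finally show ?case using z(2) subgroup.m_closed[OF V z(1) v(1)] by blast
  qed
  have VZ': "\<exists>v \<in> V. \<exists>z \<in> uc H 1. x = z \<otimes>\<^bsub>H\<^esub> v" if x: "x \<in> carrier H" for x
    using VZ[of x c] x cH H.uc_subset_Suc[of c] by blast
  \<comment> \<open>Central factors do not change commutators, so each commutator in
    \<open>H\<close> is one of elements of \<open>V\<close>.\<close>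
  have comV: "com H x y \<in> V" if xy: "x \<in> carrier H" "y \<in> carrier H" for x y
  proof -
    obtain u z where u: "u \<in> V" "z \<in> uc H 1" "x = z \<otimes>\<^bsub>H\<^esub> u" using VZ'[OF xy(1)] by blast
    obtain u' z' where u': "u' \<in> V" "z' \<in> uc H 1" "y = z' \<otimes>\<^bsub>H\<^esub> u'" using VZ'[OF xy(2)] by blast
    have c: "u \<in> carrier H" "z \<in> carrier H" "u' \<in> carrier H" "z' \<in> carrier H"
      using Vc u u' H.uc_closed by blast+
    have zz: "com H z g = \<one>\<^bsub>H\<^esub>" "com H g z' = \<one>\<^bsub>H\<^esub>" if "g \<in> carrier H" for g
      using H.uc_com[of z 0 g] H.uc_com'[of z' 0 g] u(2) u'(2) that by simp_all
    have "com H x y = com H u y" unfolding u(3) using c xy(2) zz(1)[OF xy(2)] H.conj_eq_com[of "com H u y" z] zz(1)[of "com H u y"]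
      by (simp add: H.com_mult_left)
    also have "\<dots> = com H u u'" unfolding u'(3) using c zz(2)[OF c(1)] H.conj_eq_com[of "com H u u'" z']
        H.uc_com[of z' 0 "com H u u'"] u'(2) by (simp add: H.com_mult_right)
    also have "\<dots> \<in> V" unfolding com_def
      using u(1) u'(1) subgroup.m_closed[OF V] subgroup.m_inv_closed[OF V] by blast
    finally show ?thesis .
  qed
  have cpV: "x \<in> V" if "x \<in> comprods H m" for x
  proof -
    obtain xs ys where *: "xs \<in> tup H m" "ys \<in> tup H m" "x = lprod H (\<lambda>j. com H (xs j) (ys j)) m"
      using \<open>x \<in> comprods H m\<close> by (auto simp: comprods_def)
    show ?thesis unfolding *(3) by (rule H.lprod_in_subgroup[OF V comV]) (use * in \<open>simp_all add: tup_def\<close>)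
  qed
  have ZV: "z \<in> V" if z: "z \<in> uc H 1" for z
  proof -
    obtain r :: "nat \<Rightarrow> nat" and z' where r: "z' \<in> carrier H" "z' \<in> uc H 1" "z = lprod H (\<lambda>i. teval H (b N) (\<zeta> i) [^]\<^bsub>H\<^esub> r i) q \<otimes>\<^bsub>H\<^esub> z' [^]\<^bsub>H\<^esub> e"
      using P(3)[of N] H.uc_closed[OF z] z unfolding zspan_def by blast
    have "z' [^]\<^bsub>H\<^esub> e \<in> V" using P(2) r(1,2) cpV unfolding center_width_def by blast
    moreover have "lprod H (\<lambda>i. teval H (b N) (\<zeta> i) [^]\<^bsub>H\<^esub> r i) q \<in> V"
    proof (rule H.lprod_in_subgroup[OF V])
      fix i
      have "teval H (b N) (\<zeta> i) \<in> V" unfolding V_def by blast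
      from H.subgroup_int_pow_closed[OF V this, of "int (r i)"]
      show "teval H (b N) (\<zeta> i) [^]\<^bsub>H\<^esub> r i \<in> V" by (simp add: int_pow_int)
    qed
    ultimately show ?thesis unfolding r(3) by (rule subgroup.m_closed[OF V, rotated])
  qed
  have VH: "V = carrier H"
  proof
    show "V \<subseteq> carrier H" using Vc by blast
    show "carrier H \<subseteq> V"
    proof
      fix x assume "x \<in> carrier H"
      then obtain v z where "v \<in> V" "z \<in> uc H 1" "x = z \<otimes>\<^bsub>H\<^esub> v" using VZ' by blast
      then show "x \<in> V" using subgroup.m_closed[OF V ZV] by blast
    qed
  qed
  have "\<exists>t. teval G a t = x" if "x \<in> carrier G" for x using generate_term[of x G a k] ga that by blast
  then obtain T where T: "\<And>x. x \<in> carrier G \<Longrightarrow> teval G a (T x) = x" by metis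
  define f where "f x = teval H (b N) (T x)" for x
  \<comment> \<open>Two terms with equal value at \<open>a\<close> differ by a relation of
    \<open>a\<close>, which \<open>b N\<close> satisfies; hence \<open>f\<close> does not depend on
    the terms chosen by \<open>T\<close>.\<close>
  have wd: "teval H (b N) u = teval H (b N) t" if "teval G a u = teval G a t" for u t
  proof -
    have "teval G a (GMul u (GInv t)) = \<one>\<^bsub>G\<^esub>" using that G.teval_tup[OF a] by simp
    then have "teval H (b N) (GMul u (GInv t)) = \<one>\<^bsub>H\<^esub>" using R(3) b[of N] P(1)[of N] by blast
    then show ?thesis using H.teval_tup[OF b[of N]] H.inv_equality[of "teval H (b N) u" "inv\<^bsub>H\<^esub> (teval H (b N) t)"] by simp
  qed
  have ft: "f (teval G a t) = teval H (b N) t" for t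
    unfolding f_def by (rule wd) (rule T[OF G.teval_tup[OF a]])
  have "f \<in> hom G H"
  proof (rule homI)
    fix x assume "x \<in> carrier G"
    then show "f x \<in> carrier H" unfolding f_def using H.teval_tup[OF b] by blast
  next
    fix x y assume xy: "x \<in> carrier G" "y \<in> carrier G"
    have "x \<otimes>\<^bsub>G\<^esub> y = teval G a (GMul (T x) (T y))" using T xy by simp
    then have "f (x \<otimes>\<^bsub>G\<^esub> y) = teval H (b N) (GMul (T x) (T y))" using ft by metis
    then show "f (x \<otimes>\<^bsub>G\<^esub> y) = f x \<otimes>\<^bsub>H\<^esub> f y" by (simp add: f_def)
  qed
  moreover have "f ` carrier G = carrier H"
  proof
    show "f ` carrier G \<subseteq> carrier H" unfolding f_def using H.teval_tup[OF b] by blast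
    show "carrier H \<subseteq> f ` carrier G"
    proof
      fix y assume "y \<in> carrier H"
      then obtain t where "y = teval H (b N) t" using VH unfolding V_def by blast
      then show "y \<in> f ` carrier G" using ft[of t] G.teval_tup[OF a, of t] by (metis imageI)
    qed
  qed
  ultimately show ?thesis by blast
qed

section \<open>Elementarily equivalent groups\<close>

text \<open>The definability calculus ranges over groups on one type, so both groups are first copied into the sum type.\<close>

definition copy :: "('a \<Rightarrow> 'u) \<Rightarrow> ('a, 'm) monoid_scheme \<Rightarrow> 'u monoid" where
  "copy h G = \<lparr>carrier = h ` carrier G,
    monoid.mult = (\<lambda>x y. h (inv_into (carrier G) h x \<otimes>\<^bsub>G\<^esub> inv_into (carrier G) h y)), monoid.one = h \<one>\<^bsub>G\<^esub>\<rparr>"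

lemma (in group) copy_iso:
  assumes h: "inj_on h (carrier G)" shows "group (copy h G)" "h \<in> iso G (copy h G)"
proof -
  have mult: "h x \<otimes>\<^bsub>copy h G\<^esub> h y = h (x \<otimes> y)" if "x \<in> carrier G" "y \<in> carrier G" for x y
    using that h by (simp add: copy_def)
  have car: "carrier (copy h G) = h ` carrier G" and one: "\<one>\<^bsub>copy h G\<^esub> = h \<one>" by (simp_all add: copy_def)
  show "group (copy h G)"
  proof (rule groupI)
    show "\<one>\<^bsub>copy h G\<^esub> \<in> carrier (copy h G)" by (simp add: car one)
    fix x assume "x \<in> carrier (copy h G)"
    then obtain a where a: "a \<in> carrier G" "x = h a" by (auto simp: car)
    show "\<one>\<^bsub>copy h G\<^esub> \<otimes>\<^bsub>copy h G\<^esub> x = x" using a by (simp add: one mult)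
    have "h (inv a) \<otimes>\<^bsub>copy h G\<^esub> x = \<one>\<^bsub>copy h G\<^esub>" using a by (simp add: one mult)
    then show "\<exists>y \<in> carrier (copy h G). y \<otimes>\<^bsub>copy h G\<^esub> x = \<one>\<^bsub>copy h G\<^esub>" using a unfolding car by blast
    fix y assume "y \<in> carrier (copy h G)"
    then obtain b where b: "b \<in> carrier G" "y = h b" by (auto simp: car)
    show "x \<otimes>\<^bsub>copy h G\<^esub> y \<in> carrier (copy h G)" using a b by (simp add: mult car)
    fix z assume "z \<in> carrier (copy h G)"
    then obtain c where c: "c \<in> carrier G" "z = h c" by (auto simp: car)
    show "x \<otimes>\<^bsub>copy h G\<^esub> y \<otimes>\<^bsub>copy h G\<^esub> z = x \<otimes>\<^bsub>copy h G\<^esub> (y \<otimes>\<^bsub>copy h G\<^esub> z)"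
      using a b c by (simp add: mult m_assoc)
  qed
  show "h \<in> iso G (copy h G)"
    using h by (auto simp: iso_def hom_def bij_betw_def car mult)
qed

section \<open>Invariance under isomorphism\<close>

context group_hom
begin

lemma hom_com: "x \<in> carrier G \<Longrightarrow> y \<in> carrier G \<Longrightarrow> h (com G x y) = com H (h x) (h y)"
  by (simp add: com_def)

lemma hom_comprods: "x \<in> comprods G m \<Longrightarrow> h x \<in> comprods H m"
proof -
  assume "x \<in> comprods G m"
  then obtain xs ys where *: "xs \<in> tup G m" "ys \<in> tup G m" "x = lprod G (\<lambda>j. com G (xs j) (ys j)) m"
    by (auto simp: comprods_def)
  have c: "xs j \<in> carrier G" "ys j \<in> carrier G" for j using *(1,2) G.tup_closed by blast+
  have "h x = lprod H (\<lambda>j. com H (h (xs j)) (h (ys j))) m"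
    unfolding *(3) using c by (simp add: hom_lprod hom_com)
  moreover have "(\<lambda>j. h (xs j)) \<in> tup H m" "(\<lambda>j. h (ys j)) \<in> tup H m" using *(1,2) by (simp_all add: tup_def)
  ultimately show ?thesis unfolding comprods_def
    by - (rule CollectI, rule bexI[of _ "\<lambda>j. h (xs j)"], rule bexI[of _ "\<lambda>j. h (ys j)"], assumption+)
qed

lemma iso_uc:
  assumes b: "bij_betw h (carrier G) (carrier H)"
  shows "x \<in> carrier G \<Longrightarrow> h x \<in> uc H i \<longleftrightarrow> x \<in> uc G i"
proof (induction i arbitrary: x)
  case 0
  have "h x = h \<one>\<^bsub>G\<^esub> \<longleftrightarrow> x = \<one>\<^bsub>G\<^esub>"
    using b 0 by (simp add: bij_betw_def inj_on_eq_iff[of h "carrier G"] del: hom_one)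
  then show ?case by simp
next
  case (Suc i)
  have im: "carrier H = h ` carrier G" using b by (simp add: bij_betw_def)
  have "(\<forall>g \<in> carrier H. com H (h x) g \<in> uc H i) \<longleftrightarrow> (\<forall>g \<in> carrier G. h (com G x g) \<in> uc H i)"
    unfolding im using Suc.prems by (simp add: hom_com)
  then show ?case using Suc by simp
qed

lemma iso_teval: "range v \<subseteq> carrier G \<Longrightarrow> h (teval G v t) = teval H (\<lambda>i. h (v i)) t"
proof (induction t)
  case (GMul s t)
  then show ?case using teval_closed[OF G.is_group] by simp
next
  case (GInv t)
  then show ?case using teval_closed[OF G.is_group] by simp
qed simp_all

lemma iso_fsat:
  assumes b: "bij_betw h (carrier G) (carrier H)"
  shows "range v \<subseteq> carrier G \<Longrightarrow> fsat H (\<lambda>i. h (v i)) f \<longleftrightarrow> fsat G v f"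
proof (induction f arbitrary: v)
  case (GEq s t)
  have c: "teval G v s \<in> carrier G" "teval G v t \<in> carrier G" using teval_closed[OF G.is_group GEq] by blast+
  have "h (teval G v s) = h (teval G v t) \<longleftrightarrow> teval G v s = teval G v t"
    using b c by (simp add: bij_betw_def inj_on_eq_iff[of h "carrier G"])
  then show ?case by (simp add: iso_teval[OF GEq])
next
  case (GEx j f)
  have im: "carrier H = h ` carrier G" using b by (simp add: bij_betw_def)
  have e: "fsat H ((\<lambda>i. h (v i))(j := h a)) f \<longleftrightarrow> fsat G (v(j := a)) f" if a: "a \<in> carrier G" for a
  proof -
    have "range (v(j := a)) \<subseteq> carrier G" using GEx.prems a by (auto simp: image_subset_iff)
    from GEx.IH[OF this] have "fsat H (\<lambda>i. h ((v(j := a)) i)) f \<longleftrightarrow> fsat G (v(j := a)) f" .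
    moreover have "(\<lambda>i. h ((v(j := a)) i)) = (\<lambda>i. h (v i))(j := h a)" by auto
    ultimately show ?thesis by (simp only:)
  qed
  show ?case unfolding fsat.simps im using e by blast
next
  case (GNeg f)
  show ?case using GNeg.IH[OF GNeg.prems] by simp
next
  case (GAnd f g)
  show ?case using GAnd.IH(1)[OF GAnd.prems] GAnd.IH(2)[OF GAnd.prems] by simp
qed

lemma iso_models:
  assumes "bij_betw h (carrier G) (carrier H)" shows "models H f \<longleftrightarrow> models G f"
  using iso_fsat[OF assms, of "\<lambda>_. \<one>\<^bsub>G\<^esub>" f] by (simp add: models_def)

end

text \<open>The center is finitely generated, and \<open>e\<close> is the product of exponents that
  carry its generators into the derived subgroup. Taking e-th powers is a homomorphism on the
  center, so all of it is carried there, and the derived subgroup has bounded commutator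
  width.\<close>

lemma (in group) center_width_exists:
  assumes noeth: "noeth G" and S: "finite S" "S \<subseteq> carrier G" "generate G S = carrier G" and c: "lower_central G c = {\<one>}"
    and Z: "group_center G \<subseteq> isolator G (derived G (carrier G))"
  shows "\<exists>e>0. \<exists>m. center_width G e m"
proof -
  have sub: "subgroup (uc G 1) G" by (rule normalD(1)[OF uc_normal])
  have der: "subgroup (derived G (carrier G)) G" by (rule derived_is_subgroup) simp
  have iso: "\<exists>k::nat. 0 < k \<and> z [^] k \<in> derived G (carrier G)" if z: "z \<in> uc G 1" for z
  proof -
    have "z \<in> group_center G" using uc_1_comm[OF z] uc_closed[OF z] by (simp add: group_center_def)
    then obtain k :: nat where "1 \<le> k" "z [^] k \<in> derived G (carrier G)" using Z by (auto simp: isolator_def)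
    then show ?thesis by (intro exI[of _ k]) simp
  qed
  have "fgs G (uc G 1)" using noeth sub unfolding noeth_def by blast
  then obtain T where T: "finite T" "T \<subseteq> carrier G" "generate G T = uc G 1" unfolding fgs_def by blast
  have TZ: "T \<subseteq> uc G 1" using T(3) subset_generate[of T T G] by blast
  then obtain k :: "'a \<Rightarrow> nat" where k: "\<And>t. t \<in> T \<Longrightarrow> 0 < k t" "\<And>t. t \<in> T \<Longrightarrow> t [^] k t \<in> derived G (carrier G)"
    using iso by (metis subsetD)
  define e where "e = prod k T"
  have e: "0 < e" unfolding e_def using k(1) by (intro prod_pos) blast
  let ?P = "{z \<in> uc G 1. z [^] e \<in> derived G (carrier G)}"
  have "subgroup ?P G"
  proof (rule subgroupI)
    show "?P \<subseteq> carrier G" using uc_closed by blast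
    have "\<one> \<in> ?P" using subgroup.one_closed[OF sub] subgroup.one_closed[OF der] by simp
    then show "?P \<noteq> {}" by blast
  next
    fix a assume a: "a \<in> ?P"
    then have "a \<in> carrier G" using uc_closed by blast
    then show "inv a \<in> ?P"
      using a subgroup.m_inv_closed[OF sub] subgroup.m_inv_closed[OF der] by (simp add: nat_pow_inv)
  next
    fix a b assume ab: "a \<in> ?P" "b \<in> ?P"
    then have c: "a \<in> carrier G" "b \<in> carrier G" using uc_closed by blast+
    have "a \<otimes> b = b \<otimes> a" using uc_1_comm ab c by blast
    then show "a \<otimes> b \<in> ?P"
      using ab c subgroup.m_closed[OF sub] subgroup.m_closed[OF der] by (simp add: pow_mult_distrib)
  qed
  moreover have "T \<subseteq> ?P"
  proof
    fix t assume t: "t \<in> T"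
    have tc: "t \<in> carrier G" using t T(2) by blast
    have "e = k t * prod k (T - {t})" unfolding e_def by (rule prod.remove[OF T(1) t])
    then have "t [^] e = (t [^] k t) [^] prod k (T - {t})" using tc by (simp add: nat_pow_pow)
    moreover have "(t [^] k t) [^] prod k (T - {t}) \<in> derived G (carrier G)"
      using subgroup_int_pow_closed[OF der k(2)[OF t], of "int (prod k (T - {t}))"] by (simp only: int_pow_int)
    ultimately show "t \<in> ?P" using t TZ by auto
  qed
  ultimately have "uc G 1 \<subseteq> ?P" using generate_subgroup_incl T(3) by metis
  moreover obtain m where "derived G (carrier G) \<subseteq> comprods G m" using derived_width[OF S c] by blast
  ultimately have "center_width G e m" unfolding center_width_def by blast
  then show ?thesis using e by blast
qed

theorem mainTheorem5:
  fixes G :: "('a, 'b) monoid_scheme" and H :: "('c, 'd) monoid_scheme"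
  assumes "group G" and "nilpotent_group G" and "fin_gen_group G"
    and "group_center G \<subseteq> isolator G (derived G (carrier G))"
    and "group H" and "fin_gen_group H"
    and "elem_equiv H G"
  shows "G \<cong> H"
proof -
  interpret G: group G by fact
  interpret H: group H by fact
  obtain c where c: "lower_central G c = {\<one>\<^bsub>G\<^esub>}" using assms(2) by (auto simp: nilpotent_group_def)
  obtain S where S: "finite S" "S \<subseteq> carrier G" "generate G S = carrier G" using assms(3) by (auto simp: fin_gen_group_def)
  obtain T where T: "finite T" "T \<subseteq> carrier H" "generate H T = carrier H" using assms(6) by (auto simp: fin_gen_group_def)
  have nG: "noeth G" by (rule G.noeth_nilpotent[OF S c])
  obtain e m where e: "0 < e" and cw: "center_width G e m"
    using G.center_width_exists[OF nG S c assms(4)] by blast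
  let ?i = "Inl :: 'a \<Rightarrow> 'a + 'c" and ?j = "Inr :: 'c \<Rightarrow> 'a + 'c"
  let ?G = "copy ?i G" and ?H = "copy ?j H"
  note isoG = G.copy_iso[of ?i, OF inj_on_subset[OF inj_Inl subset_UNIV]]
  note isoH = H.copy_iso[of ?j, OF inj_on_subset[OF inj_Inr subset_UNIV]]
  interpret i: group_hom G ?G ?i
    using isoG G.is_group by (simp add: group_hom_def group_hom_axioms_def iso_def)
  interpret j: group_hom H ?H ?j
    using isoH H.is_group by (simp add: group_hom_def group_hom_axioms_def iso_def)
  have bi: "bij_betw ?i (carrier G) (carrier ?G)" and bj: "bij_betw ?j (carrier H) (carrier ?H)"
    using isoG(2) isoH(2) by (simp_all add: iso_def)
  have imG: "?i ` carrier G = carrier ?G" and imH: "?j ` carrier H = carrier ?H"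
    using bi bj by (simp_all add: bij_betw_def)
  have nG': "noeth ?G" by (rule i.noeth_image[OF nG imG])
  have ucG: "uc ?G c = carrier ?G"
  proof
    show "carrier ?G \<subseteq> uc ?G c"
    proof
      fix x assume "x \<in> carrier ?G"
      then obtain g where "g \<in> carrier G" "x = ?i g" using imG by blast
      then show "x \<in> uc ?G c" using i.iso_uc[OF bi, of g c] G.uc_if_lc[OF c] by simp
    qed
  qed (use i.H.uc_closed in blast)
  have cwG: "center_width ?G e m"
    unfolding center_width_def
  proof (intro ballI impI)
    fix z assume z: "z \<in> carrier ?G" "z \<in> uc ?G 1"
    then obtain g where g: "g \<in> carrier G" "z = ?i g" using imG by blast
    then have "g \<in> uc G 1" using i.iso_uc[OF bi, of g 1] z(2) by blast
    then have "g [^]\<^bsub>G\<^esub> e \<in> comprods G m" using cw g(1) unfolding center_width_def by blast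
    then have "?i (g [^]\<^bsub>G\<^esub> e) \<in> comprods ?G m" by (rule i.hom_comprods)
    then show "z [^]\<^bsub>?G\<^esub> e \<in> comprods ?G m" using g i.hom_nat_pow by simp
  qed
  have eq: "elem_equiv ?G ?H"
    using assms(7) i.iso_models[OF bi] j.iso_models[OF bj] by (simp add: elem_equiv_def)
  then have eq': "elem_equiv ?H ?G" by (simp add: elem_equiv_def)
  \<comment> \<open>The isolator hypothesis concerns \<open>G\<close> only; in the form
    \<open>center_width\<close> it becomes first-order and reaches \<open>H\<close>, as the reverse
    surjection requires. The class bound c makes \<open>H\<close> nilpotent and so gives it the
    maximal condition.\<close>
  define \<phi> where "\<phi> = (\<lambda>(K :: ('a + 'c) monoid) (v :: nat \<Rightarrow> 'a + 'c). (\<forall>x \<in> carrier K. x \<in> uc K c) \<and> center_width K e m)"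
  have "fo \<phi>" unfolding \<phi>_def by (intro fo_conj fo_all fo_uc fo_center_width ft_var)
  moreover have "range (\<lambda>_::nat. \<one>\<^bsub>?G\<^esub>) \<subseteq> carrier ?G" using i.H.one_closed by blast
  moreover have "\<phi> ?G (\<lambda>_. \<one>\<^bsub>?G\<^esub>)" unfolding \<phi>_def using ucG cwG by blast
  ultimately have "\<exists>w. range w \<subseteq> carrier ?H \<and> \<phi> ?H w"
    using elem_equiv_transfer[OF _ eq i.H.is_group j.H.is_group] by blast
  then have "(\<forall>x \<in> carrier ?H. x \<in> uc ?H c) \<and> center_width ?H e m" unfolding \<phi>_def by blast
  then have ucH: "uc ?H c = carrier ?H" and cwH: "center_width ?H e m" using j.H.uc_closed by blast+
  have genH: "generate ?H (?j ` T) = carrier ?H" using j.generate_img[OF T(2)] T(3) imH by simp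
  have nH': "noeth ?H"
    by (rule j.H.noeth_nilpotent[OF _ _ genH j.H.lc_if_uc[OF ucH]]) (use T(1,2) imH in blast)+
  obtain f where f: "f \<in> hom ?G ?H" "f ` carrier ?G = carrier ?H"
    using surjective_hom[OF nG' nH' ucG ucH cwG e eq] by blast
  obtain g where g: "g \<in> hom ?H ?G" "g ` carrier ?H = carrier ?G"
    using surjective_hom[OF nH' nG' ucH ucG cwH e eq'] by blast
  have "g \<circ> f \<in> hom ?G ?G" using Group.hom_compose[OF f(1) g(1)] .
  moreover have "(g \<circ> f) ` carrier ?G = carrier ?G" by (simp only: image_comp[symmetric] f(2) g(2))
  ultimately have "inj_on (g \<circ> f) (carrier ?G)" by (rule hopfian[OF nG'])
  then have "inj_on f (carrier ?G)" by (rule inj_on_imageI2)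
  then have "f \<in> iso ?G ?H" using f by (simp add: iso_def bij_betw_def)
  then have "?G \<cong> ?H" by (rule is_isoI)
  moreover have "?H \<cong> H" using H.iso_sym[OF is_isoI[OF isoH(2)]] .
  ultimately have "?G \<cong> H" by (rule iso_trans)
  with is_isoI[OF isoG(2)] show ?thesis by (rule iso_trans)
qed

end
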